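(* Let $G=(\mathbf{Z}/2)^r$. Over any field $\mathbf{k}$ of characteristic different from $2$, there are $1$-dimensional representations $\varepsilon_1,\ldots,\varepsilon_r$ of $G$ such that the graded representation ring is $$\operatorname{gr}R(G,\mathbf{k})\otimes\mathbf{F}_2=\frac{\mathbf{F}_2[c_1(\varepsilon_1),\ldots,c_1(\varepsilon_r)]}{\left(c_1(\varepsilon_i)^2c_1(\varepsilon_j)+c_1(\varepsilon_i)c_1(\varepsilon_j)^2\right)}$$ for $1\le i,j\le r$.
   Context: $R(G,\mathbf{k})$ is the representation ring of $G$ over $\mathbf{k}$, a $\lambda$-ring via exterior powers, with augmentation $\varepsilon$ the dimension. For a $\lambda$-ring $K$ with augmentation $\varepsilon$ and $I=\ker\varepsilon$, put $\gamma^n(x)=\lambda^n(x+n-1)$; $\Gamma^n$ ($n\ge1$) is the additive subgroup generated by the products $\gamma^{k_1}(x_1)\cdots\gamma^{k_s}(x_s)$ with $x_i\in I$ and $\sum k_i\ge n$; $\Gamma^0=K$; $\operatorname{gr}K=\bigoplus_{n\ge0}\Gamma^n/\Gamma^{n+1}$; the Chern class $c_i(x)$ is the class of $\gamma^i(x-\varepsilon(x))$ in $\Gamma^i/\Gamma^{i+1}$. *)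

theory Defs
  imports
    "HOL-Algebra.Product_Groups"
    "HOL-Algebra.Elementary_Groups"
    "HOL-Algebra.QuotRing"
    "HOL-Algebra.Free_Abelian_Groups"
    "HOL-Algebra.Algebraic_Closure_Type"
    "HOL-Library.Z2"
    "Jordan_Normal_Form.Matrix"
    "Jordan_Normal_Form.Determinant"
    "Jordan_Normal_Form.DL_Submatrix"
begin

section \<open>Augmented lambda-rings and the graded ring of the gamma filtration\<close>

record 'a aug_lambda_ring = "'a ring" +
  lam :: "nat \<Rightarrow> 'a \<Rightarrow> 'a"
  aug :: "'a \<Rightarrow> int"

definition int_elt :: "('a, 'b) ring_scheme \<Rightarrow> int \<Rightarrow> 'a"
  where "int_elt K m = add_pow K m \<one>\<^bsub>K\<^esub>"

definition aug_ideal :: "('a, 'b) aug_lambda_ring_scheme \<Rightarrow> 'a set"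
  where "aug_ideal K = {x \<in> carrier K. aug K x = 0}"

definition gamma_op :: "('a, 'b) aug_lambda_ring_scheme \<Rightarrow> nat \<Rightarrow> 'a \<Rightarrow> 'a"
  where "gamma_op K n x = lam K n (x \<oplus>\<^bsub>K\<^esub> int_elt K (int n - 1))"

definition gamma_prod :: "('a, 'b) aug_lambda_ring_scheme \<Rightarrow> (nat \<times> 'a) list \<Rightarrow> 'a"
  where "gamma_prod K ps = foldr (\<lambda>(k, x) z. gamma_op K k x \<otimes>\<^bsub>K\<^esub> z) ps \<one>\<^bsub>K\<^esub>"

definition gamma_filt :: "('a, 'b) aug_lambda_ring_scheme \<Rightarrow> nat \<Rightarrow> 'a set"
  where "gamma_filt K n =
    (if n = 0 then carrier K
     else generate (add_monoid K)
       {gamma_prod K ps |ps. snd ` set ps \<subseteq> aug_ideal K \<and> n \<le> sum_list (map fst ps)})"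

definition gr_piece :: "('a, 'b) aug_lambda_ring_scheme \<Rightarrow> nat \<Rightarrow> 'a set monoid"
  where "gr_piece K n =
    \<lparr>carrier = gamma_filt K n, monoid.mult = add K, one = \<zero>\<^bsub>K\<^esub>\<rparr> Mod gamma_filt K (Suc n)"

definition gr_homog :: "('a, 'b) aug_lambda_ring_scheme \<Rightarrow> nat \<Rightarrow> 'a \<Rightarrow> nat \<Rightarrow> 'a set"
  where "gr_homog K i x =
    (\<lambda>n. if n = i then gamma_filt K (Suc n) +>\<^bsub>K\<^esub> x else \<one>\<^bsub>gr_piece K n\<^esub>)"

text \<open>The groups \<^const>\<open>gr_piece\<close> are additive groups written as monoids, so \<^const>\<open>finprod\<close> below
  is the sum, over \<open>i \<le> n\<close>, of the products of the components of degrees \<open>i\<close> and \<open>n - i\<close>.\<close>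

definition gr_ring :: "('a, 'b) aug_lambda_ring_scheme \<Rightarrow> (nat \<Rightarrow> 'a set) ring"
  where "gr_ring K =
    \<lparr>carrier = carrier (sum_group UNIV (gr_piece K)),
     monoid.mult = (\<lambda>f g n. finprod (gr_piece K n)
        (\<lambda>i. rcoset_mult K (gamma_filt K (Suc n)) (f i) (g (n - i))) {..n}),
     one = gr_homog K 0 \<one>\<^bsub>K\<^esub>,
     zero = \<one>\<^bsub>sum_group UNIV (gr_piece K)\<^esub>,
     add = monoid.mult (sum_group UNIV (gr_piece K))\<rparr>"

definition chern :: "('a, 'b) aug_lambda_ring_scheme \<Rightarrow> nat \<Rightarrow> 'a \<Rightarrow> nat \<Rightarrow> 'a set"
  where "chern K i x = gr_homog K i (gamma_op K i (x \<ominus>\<^bsub>K\<^esub> int_elt K (aug K x)))"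

section \<open>Tensor product of commutative rings over the integers\<close>

definition free_prod_ring ::
    "('a, 'c) ring_scheme \<Rightarrow> ('b, 'd) ring_scheme \<Rightarrow> ('a \<times> 'b \<Rightarrow>\<^sub>0 int) ring"
  where "free_prod_ring A B =
    \<lparr>carrier = carrier (free_Abelian_group (carrier A \<times> carrier B)),
     monoid.mult = (\<lambda>s t. frag_extend (\<lambda>(a, b). frag_extend
        (\<lambda>(a', b'). frag_of (a \<otimes>\<^bsub>A\<^esub> a', b \<otimes>\<^bsub>B\<^esub> b')) t) s),
     one = frag_of (\<one>\<^bsub>A\<^esub>, \<one>\<^bsub>B\<^esub>),
     zero = 0,
     add = (+)\<rparr>"

definition tensor_rels ::
    "('a, 'c) ring_scheme \<Rightarrow> ('b, 'd) ring_scheme \<Rightarrow> ('a \<times> 'b \<Rightarrow>\<^sub>0 int) set"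
  where "tensor_rels A B =
    {frag_of (a \<oplus>\<^bsub>A\<^esub> a', b) - frag_of (a, b) - frag_of (a', b) |a a' b.
       a \<in> carrier A \<and> a' \<in> carrier A \<and> b \<in> carrier B} \<union>
    {frag_of (a, b \<oplus>\<^bsub>B\<^esub> b') - frag_of (a, b) - frag_of (a, b') |a b b'.
       a \<in> carrier A \<and> b \<in> carrier B \<and> b' \<in> carrier B}"

text \<open>The additive subgroup generated by the bilinearity relations is already an ideal, so using the
  generated ideal gives the usual tensor product of abelian groups.\<close>

definition tensor_ideal ::
    "('a, 'c) ring_scheme \<Rightarrow> ('b, 'd) ring_scheme \<Rightarrow> ('a \<times> 'b \<Rightarrow>\<^sub>0 int) set"
  where "tensor_ideal A B = genideal (free_prod_ring A B) (tensor_rels A B)"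

definition tensor_ring ::
    "('a, 'c) ring_scheme \<Rightarrow> ('b, 'd) ring_scheme \<Rightarrow> ('a \<times> 'b \<Rightarrow>\<^sub>0 int) set ring"
  where "tensor_ring A B = free_prod_ring A B Quot tensor_ideal A B"

definition pure_tensor ::
    "('a, 'c) ring_scheme \<Rightarrow> ('b, 'd) ring_scheme \<Rightarrow> 'a \<Rightarrow> 'b \<Rightarrow> ('a \<times> 'b \<Rightarrow>\<^sub>0 int) set"
  where "pure_tensor A B a b = tensor_ideal A B +>\<^bsub>free_prod_ring A B\<^esub> frag_of (a, b)"

section \<open>Matrix representations\<close>

text \<open>A representation on \<open>k\<^sup>n\<close> is a pair of \<open>n\<close> and a matrix-valued map; only the values of the map on
  the carrier of the group matter.\<close>

type_synonym ('g, 'k) rep = "nat \<times> ('g \<Rightarrow> 'k mat)"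

definition reps :: "('g, 'm) monoid_scheme \<Rightarrow> ('g, 'k::field) rep set"
  where "reps G = {(n, \<rho>).
    (\<forall>g\<in>carrier G. \<rho> g \<in> carrier_mat n n) \<and>
    \<rho> \<one>\<^bsub>G\<^esub> = 1\<^sub>m n \<and>
    (\<forall>g\<in>carrier G. \<forall>h\<in>carrier G. \<rho> (g \<otimes>\<^bsub>G\<^esub> h) = \<rho> g * \<rho> h)}"

definition rep_dim :: "('g, 'k) rep \<Rightarrow> nat"
  where "rep_dim V = fst V"

definition rep_iso :: "('g, 'm) monoid_scheme \<Rightarrow> ('g, 'k::field) rep \<Rightarrow> ('g, 'k) rep \<Rightarrow> bool"
  where "rep_iso G V W \<longleftrightarrow> rep_dim V = rep_dim W \<and>
    (\<exists>P\<in>carrier_mat (rep_dim V) (rep_dim V). invertible_mat P \<and>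
      (\<forall>g\<in>carrier G. P * snd V g = snd W g * P))"

definition zero_rep :: "('g, 'k::field) rep"
  where "zero_rep = (0, \<lambda>g. 1\<^sub>m 0)"

definition triv_rep :: "('g, 'k::field) rep"
  where "triv_rep = (1, \<lambda>g. 1\<^sub>m 1)"

definition dsum_rep :: "('g, 'k::field) rep \<Rightarrow> ('g, 'k) rep \<Rightarrow> ('g, 'k) rep"
  where "dsum_rep V W = (rep_dim V + rep_dim W,
    \<lambda>g. four_block_mat (snd V g) (0\<^sub>m (rep_dim V) (rep_dim W))
                       (0\<^sub>m (rep_dim W) (rep_dim V)) (snd W g))"

definition kronecker :: "'k::field mat \<Rightarrow> 'k mat \<Rightarrow> 'k mat"
  where "kronecker A B = mat (dim_row A * dim_row B) (dim_col A * dim_col B)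
    (\<lambda>(i, j). A $$ (i div dim_row B, j div dim_col B) * B $$ (i mod dim_row B, j mod dim_col B))"

definition tensor_rep :: "('g, 'k::field) rep \<Rightarrow> ('g, 'k) rep \<Rightarrow> ('g, 'k) rep"
  where "tensor_rep V W = (rep_dim V * rep_dim W, \<lambda>g. kronecker (snd V g) (snd W g))"

definition ksubsets :: "nat \<Rightarrow> nat \<Rightarrow> nat set list"
  where "ksubsets n k = filter (\<lambda>I. card I = k) (map set (subseqs [0..<n]))"

text \<open>The matrix of the \<open>k\<close>-th exterior power of \<open>A\<close> in the bases of wedge products
  of standard basis vectors; its entries are the \<open>k \<times> k\<close> minors of \<open>A\<close>.\<close>

definition ext_mat :: "nat \<Rightarrow> 'k::field mat \<Rightarrow> 'k mat"
  where "ext_mat k A =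
    mat (length (ksubsets (dim_row A) k)) (length (ksubsets (dim_col A) k))
      (\<lambda>(i, j). det (submatrix A (ksubsets (dim_row A) k ! i) (ksubsets (dim_col A) k ! j)))"

definition ext_rep :: "nat \<Rightarrow> ('g, 'k::field) rep \<Rightarrow> ('g, 'k) rep"
  where "ext_rep k V = (rep_dim V choose k, \<lambda>g. ext_mat k (snd V g))"

section \<open>The representation ring\<close>

text \<open>Grothendieck group of the monoid of isomorphism classes under direct sum: the pair \<open>(V, W)\<close> stands
  for \<open>[V] - [W]\<close>. When the characteristic does not divide the order of a finite group, every short
  exact sequence splits and this is also the Grothendieck group of the abelian category.\<close>

definition vrep_rel ::
    "('g, 'm) monoid_scheme \<Rightarrow> ((('g, 'k::field) rep \<times> ('g, 'k) rep) \<times> (('g, 'k) rep \<times> ('g, 'k) rep)) set"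
  where "vrep_rel G = {((V, W), (V', W')).
    V \<in> reps G \<and> W \<in> reps G \<and> V' \<in> reps G \<and> W' \<in> reps G \<and>
    (\<exists>U\<in>reps G. rep_iso G (dsum_rep (dsum_rep V W') U) (dsum_rep (dsum_rep V' W) U))}"

type_synonym ('g, 'k) vrep = "(('g, 'k) rep \<times> ('g, 'k) rep) set"

definition vrep :: "('g, 'm) monoid_scheme \<Rightarrow> ('g, 'k::field) rep \<Rightarrow> ('g, 'k) rep \<Rightarrow> ('g, 'k) vrep"
  where "vrep G V W = vrep_rel G `` {(V, W)}"

definition rep_class :: "('g, 'm) monoid_scheme \<Rightarrow> ('g, 'k::field) rep \<Rightarrow> ('g, 'k) vrep"
  where "rep_class G V = vrep G V zero_rep"

definition plain_rep_ring :: "('g, 'm) monoid_scheme \<Rightarrow> ('g, 'k::field) vrep ring"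
  where "plain_rep_ring G =
    \<lparr>carrier = (reps G \<times> reps G) // vrep_rel G,
     monoid.mult = (\<lambda>x y. \<Union>(V, W)\<in>x. \<Union>(V', W')\<in>y.
        vrep G (dsum_rep (tensor_rep V V') (tensor_rep W W'))
               (dsum_rep (tensor_rep V W') (tensor_rep W V'))),
     one = rep_class G triv_rep,
     zero = rep_class G zero_rep,
     add = (\<lambda>x y. \<Union>(V, W)\<in>x. \<Union>(V', W')\<in>y. vrep G (dsum_rep V V') (dsum_rep W W'))\<rparr>"

text \<open>With \<open>\<lambda>\<^sub>t = (\<Sum>n. \<lambda>\<^sup>n t\<^sup>n)\<close> turning sums into products, the value at \<open>x = [V] - [W]\<close> is the unique
  solution of \<open>\<lambda>\<^sub>t(W) \<lambda>\<^sub>t(x) = \<lambda>\<^sub>t(V)\<close>; the condition below compares the coefficients of \<open>t\<^sup>m\<close>.\<close>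

definition rep_lam :: "('g, 'm) monoid_scheme \<Rightarrow> nat \<Rightarrow> ('g, 'k::field) vrep \<Rightarrow> ('g, 'k) vrep"
  where "rep_lam G n x = (THE l :: nat \<Rightarrow> ('g, 'k) vrep.
    (\<forall>m. l m \<in> carrier (plain_rep_ring G)) \<and>
    (\<forall>(V, W)\<in>x. \<forall>m.
      finsum (plain_rep_ring G)
        (\<lambda>i. rep_class G (ext_rep i W) \<otimes>\<^bsub>plain_rep_ring G\<^esub> l (m - i)) {..m}
      = rep_class G (ext_rep m V))) n"

definition rep_aug :: "('g, 'k::field) vrep \<Rightarrow> int"
  where "rep_aug x = (THE d. \<forall>(V, W)\<in>x. d = int (rep_dim V) - int (rep_dim W))"

definition rep_ring :: "('g, 'm) monoid_scheme \<Rightarrow> ('g, 'k::field) vrep aug_lambda_ring"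
  where "rep_ring G =
    ring.extend (plain_rep_ring G) (aug_lambda_ring.fields (rep_lam G) rep_aug)"

section \<open>The group and the polynomial ring\<close>

definition elem_ab_2_group :: "nat \<Rightarrow> (nat \<Rightarrow> int) monoid"
  where "elem_ab_2_group r = product_group {1..r} (\<lambda>i. integer_mod_group 2)"

abbreviation F2 :: "bit ring"
  where "F2 \<equiv> ring_of_type_algebra"

definition mpoly_ring :: "nat \<Rightarrow> ((nat \<Rightarrow>\<^sub>0 nat) \<Rightarrow>\<^sub>0 bit) ring"
  where "mpoly_ring r =
    ring_of_type_algebra\<lparr>carrier := {p. \<forall>m\<in>Poly_Mapping.keys p. Poly_Mapping.keys m \<subseteq> {1..r}}\<rparr>"

definition mvar :: "nat \<Rightarrow> (nat \<Rightarrow>\<^sub>0 nat) \<Rightarrow>\<^sub>0 bit"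
  where "mvar i = Poly_Mapping.single (Poly_Mapping.single i 1) 1"

definition chern_rel_ideal :: "nat \<Rightarrow> ((nat \<Rightarrow>\<^sub>0 nat) \<Rightarrow>\<^sub>0 bit) set"
  where "chern_rel_ideal r = genideal (mpoly_ring r)
    {mvar i ^ 2 * mvar j + mvar i * mvar j ^ 2 |i j. i \<in> {1..r} \<and> j \<in> {1..r}}"

end

theory Submission
  imports Defs "Jordan_Normal_Form.Char_Poly"
begin

text \<open>
  Let \<open>G = (\<int>/2)\<^sup>r\<close>. As \<open>2 \<noteq> 0\<close> in the field, commuting involutions can be diagonalized
  simultaneously, so every representation of \<open>G\<close> is a direct sum of characters with values \<open>\<plusminus>1\<close>
  (\<open>reps_diagonalizable\<close>). Elements and characters of \<open>G\<close> are both indexed by subsets of \<open>{1..r}\<close>,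
  with \<open>\<chi>\<^sub>S(T) = (-1)\<^bsup>|S \<inter> T|\<^esup>\<close>. The integer \<open>dim V - 2 m\<close>, where \<open>m\<close> is the multiplicity of the
  eigenvalue \<open>-1\<close> of the element \<open>T\<close> on \<open>V\<close>, is additive and multiplicative in \<open>V\<close>, and by
  orthogonality of characters these integers determine \<open>V\<close>. They give ring homomorphisms \<open>ev T\<close>
  that together embed \<open>R(G)\<close> into the ring of integer-valued functions of \<open>T\<close>; the augmentation is
  \<open>ev {}\<close>.

  The first step computes the gamma filtration: for \<open>n \<ge> 1\<close>, \<open>\<Gamma>\<^sup>n\<close> consists of the \<open>x\<close> such that
  \<open>ev {} x = 0\<close> and \<open>2\<^sup>n\<close> divides every \<open>ev T x\<close> (\<open>gamma_filt_eq\<close>). At \<open>T\<close>, the series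
  \<open>\<Sum>\<^sub>n \<lambda>\<^sup>n(V) t\<^sup>n\<close> of a representation is \<open>(1 + t)\<^sup>p (1 - t)\<^sup>q\<close>, so for \<open>x\<close> of augmentation zero it is an
  integral power of \<open>(1 - t)/(1 + t) = 1 - 2t/(1 + t)\<close>. Since \<open>\<gamma>\<^sup>k(x)\<close> is the \<open>k\<close>th coefficient of
  \<open>(1 + t)\<^bsup>k-1\<^esup>\<close> times this power, an induction shows that it is divisible by \<open>2\<^sup>k\<close>
  (\<open>gamma_series_dvd\<close>). Conversely, let \<open>x\<^sub>i = \<epsilon>\<^sub>i - 1\<close> with \<open>\<epsilon>\<^sub>i\<close> the character of the set \<open>{i}\<close>.
  Its value at \<open>T\<close> is \<open>-2\<close> if \<open>i \<in> T\<close>, and \<open>0\<close> otherwise. Every element of \<open>R(G)\<close> is an integral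
  combination of products of the \<open>x\<^sub>i\<close>, and inclusion-exclusion over the subsets of \<open>T\<close> turns the
  divisibility of the values into divisibility of the coefficients (\<open>Fil_coeffs\<close>), which is what is
  needed to write the element as a combination of products of at least \<open>n\<close> of the \<open>x\<^sub>i = \<gamma>\<^sup>1(x\<^sub>i)\<close>.

  Consequently the class in \<open>\<Gamma>\<^sup>n/\<Gamma>\<^bsup>n+1\<^esup>\<close> of an element \<open>x\<close> is recorded, for \<open>n \<ge> 1\<close>, by the residues
  modulo 2 of the integers \<open>ev T x / 2\<^sup>n\<close>. Collecting these as coefficients of \<open>t\<^sup>n\<close> gives a ring
  homomorphism \<open>digits\<close> from \<open>gr R(G)\<close> to the functions from subsets to \<open>\<F>\<^sub>2[t]\<close>. It loses only the
  difference between \<open>\<Gamma>\<^sup>0/\<Gamma>\<^sup>1 = \<int>\<close> and \<open>\<F>\<^sub>2\<close>, so its kernel is \<open>2 gr R(G)\<close> (\<open>digits_kernel\<close>), and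
  \<open>gr R(G) \<otimes> \<F>\<^sub>2\<close> is isomorphic to its image (\<open>kernel_\<Theta>\<close>, \<open>image_\<Theta>\<close>). The Chern class
  \<open>c\<^sub>1(\<epsilon>\<^sub>i)\<close> is the class of \<open>x\<^sub>i\<close> and goes to the function that is \<open>t\<close> if \<open>i \<in> T\<close> and \<open>0\<close> otherwise.

  It remains to study the homomorphism \<open>pval\<close> that sends the \<open>i\<close>th variable of the polynomial ring to
  this function. The relations are in its kernel because \<open>a\<^sup>2 b = a b\<^sup>2\<close> for \<open>a, b \<in> {0, t}\<close>. Modulo the
  relations a monomial depends only on its degree and on the set of its variables
  (\<open>monomial_cong_normal_mono\<close>), and monomials of the same degree with different sets of variables
  have linearly independent images, again by inclusion-exclusion. So the kernel is generated by the relations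
  (\<open>kernel_pval\<close>). The images of \<open>pval\<close> and \<open>digits\<close> agree (\<open>images_eq\<close>), and both quotient rings are
  isomorphic to this common image.
\<close>

(* The dollar sign is left to the entries of vectors and matrices. *)
no_notation fps_nth (infixl \<open>$\<close> 75)

section \<open>Exterior powers of matrices\<close>

text \<open>Multilinearity of the determinant in its rows: row \<open>i\<close> of the product is the combination
  \<open>\<Sum>\<^sub>l A\<^sub>i\<^sub>l B\<^sub>l\<close> of the rows of \<open>B\<close>, and \<open>f\<close> records which \<open>l\<close> is chosen in each row.\<close>

lemma det_mult_expand:
  fixes A B :: "'a::comm_ring_1 mat"
  assumes A: "A \<in> carrier_mat k n" and B: "B \<in> carrier_mat n k"
  shows "det (A * B) = (\<Sum>f\<in>{f. (\<forall>i\<in>{0..<k}. f i \<in> {0..<n}) \<and> (\<forall>i. i \<notin> {0..<k} \<longrightarrow> f i = i)}.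
    (\<Prod>i\<in>{0..<k}. A $$ (i, f i)) * det (mat k k (\<lambda>(i, j). B $$ (f i, j))))"
proof -
  let ?a = "\<lambda>i j. A $$ (i, j) \<cdot>\<^sub>v row B j"
  have a: "?a \<in> {0..<k} \<rightarrow> {0..<n} \<rightarrow> carrier_vec k" using B by auto
  have "A * B = mat\<^sub>r k k (\<lambda>i. finsum_vec TYPE('a) k (?a i) {0..<n})"
  proof (rule eq_matI)
    fix i j assume "i < dim_row (mat\<^sub>r k k (\<lambda>i. finsum_vec TYPE('a) k (?a i) {0..<n}))"
      "j < dim_col (mat\<^sub>r k k (\<lambda>i. finsum_vec TYPE('a) k (?a i) {0..<n}))"
    then have ij: "i < k" "j < k" by auto
    have "finsum_vec TYPE('a) k (?a i) {0..<n} $ j = (\<Sum>l\<in>{0..<n}. ?a i l $ j)"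
      using ij B by (intro index_finsum_vec) auto
    then show "(A * B) $$ (i, j) = mat\<^sub>r k k (\<lambda>i. finsum_vec TYPE('a) k (?a i) {0..<n}) $$ (i, j)"
      using ij A B by (auto simp: scalar_prod_def row_def intro!: sum.cong)
  qed (use A B in auto)
  then have "det (A * B) = (\<Sum>f\<in>{f. (\<forall>i\<in>{0..<k}. f i \<in> {0..<n}) \<and> (\<forall>i. i \<notin> {0..<k} \<longrightarrow> f i = i)}.
      det (mat\<^sub>r k k (\<lambda>i. A $$ (i, f i) \<cdot>\<^sub>v row B (f i))))"
    using det_linear_rows_sum[OF _ a] by simp
  also have "\<dots> = (\<Sum>f\<in>{f. (\<forall>i\<in>{0..<k}. f i \<in> {0..<n}) \<and> (\<forall>i. i \<notin> {0..<k} \<longrightarrow> f i = i)}.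
    (\<Prod>i\<in>{0..<k}. A $$ (i, f i)) * det (mat k k (\<lambda>(i, j). B $$ (f i, j))))"
  proof (rule sum.cong[OF refl])
    fix f assume f: "f \<in> {f. (\<forall>i\<in>{0..<k}. f i \<in> {0..<n}) \<and> (\<forall>i. i \<notin> {0..<k} \<longrightarrow> f i = i)}"
    have "det (mat\<^sub>r k k (\<lambda>i. A $$ (i, f i) \<cdot>\<^sub>v row B (f i)))
      = (\<Prod>i\<in>{0..<k}. A $$ (i, f i)) * det (mat\<^sub>r k k (\<lambda>i. row B (f i)))"
      using B by (intro det_rows_mul) auto
    also have "mat\<^sub>r k k (\<lambda>i. row B (f i)) = mat k k (\<lambda>(i, j). B $$ (f i, j))"
      using f B by (intro eq_matI) (auto )
    finally show "det (mat\<^sub>r k k (\<lambda>i. A $$ (i, f i) \<cdot>\<^sub>v row B (f i)))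
      = (\<Prod>i\<in>{0..<k}. A $$ (i, f i)) * det (mat k k (\<lambda>(i, j). B $$ (f i, j)))" .
  qed
  finally show ?thesis .
qed

text \<open>In the expansion over choice functions \<open>f\<close>, a noninjective \<open>f\<close> contributes a determinant with two
  equal rows. An injective \<open>f\<close> amounts to its image \<open>K\<close> and a permutation, and for fixed \<open>K\<close> the sum
  over the permutations is the Leibniz formula for the minor of \<open>A\<close>.\<close>

lemma Cauchy_Binet:
  fixes A B :: "'a::comm_ring_1 mat"
  assumes A: "A \<in> carrier_mat k n" and B: "B \<in> carrier_mat n k"
  shows "det (A * B) = (\<Sum>K | K \<subseteq> {0..<n} \<and> card K = k.
    det (mat k k (\<lambda>(i, j). A $$ (i, pick K j))) * det (mat k k (\<lambda>(i, j). B $$ (pick K i, j))))"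
proof -
  let ?F = "{f. (\<forall>i\<in>{0..<k}. f i \<in> {0..<n}) \<and> (\<forall>i. i \<notin> {0..<k} \<longrightarrow> f i = i)}"
  let ?t = "\<lambda>f. (\<Prod>i\<in>{0..<k}. A $$ (i, f i)) * det (mat k k (\<lambda>(i, j). B $$ (f i, j)))"
  let ?S = "{K. K \<subseteq> {0..<n} \<and> card K = k}"
  let ?P = "{p. p permutes {0..<k}}"
  have finF: "finite ?F" by (rule finite_bounded_functions) auto
  have "det (A * B) = sum ?t ?F" by (rule det_mult_expand[OF A B])
  (* Noninjective choices repeat a row of B. *)
  also have "\<dots> = sum ?t {f \<in> ?F. inj_on f {0..<k}}"
  proof (rule sum.mono_neutral_right[OF finF])
    show "\<forall>f\<in>?F - {f \<in> ?F. inj_on f {0..<k}}. ?t f = 0"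
    proof
      fix f assume "f \<in> ?F - {f \<in> ?F. inj_on f {0..<k}}"
      then obtain a b where ab: "a < k" "b < k" "a \<noteq> b" "f a = f b" by (auto simp: inj_on_def)
      have "det (mat k k (\<lambda>(i, j). B $$ (f i, j))) = 0"
        by (rule det_identical_rows[where i=a and j=b and n=k]) (use ab in \<open>auto simp: row_def\<close>)
      then show "?t f = 0" by simp
    qed
  qed auto
  also have "\<dots> = (\<Sum>(K, p)\<in>?S \<times> ?P. ?t (\<lambda>i. if i < k then pick K (p i) else i))"
  proof (rule sum.reindex_bij_witness[where
        i = "\<lambda>(K, p) i. if i < k then pick K (p i) else i" and
        j = "\<lambda>f. (f ` {0..<k}, \<lambda>i. if i < k then card {a \<in> f ` {0..<k}. a < f i} else i)"])
    fix f assume f: "f \<in> {f \<in> ?F. inj_on f {0..<k}}"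
    let ?K = "f ` {0..<k}" let ?p = "\<lambda>i. if i < k then card {a \<in> ?K. a < f i} else i"
    have pk: "pick ?K (?p i) = f i" if "i < k" for i
      using that pick_card_in_set[of "f i" ?K] by auto
    show eq: "(case (?K, ?p) of (K, p) \<Rightarrow> (\<lambda>i. if i < k then pick K (p i) else i)) = f"
      using f pk by (auto simp: fun_eq_iff)
    have cK: "card ?K = k" using f by (auto simp: card_image)
    have "?p i < k" if "i < k" for i
    proof -
      have "{a \<in> ?K. a < f i} \<subset> ?K" using that by auto
      then have "card {a \<in> ?K. a < f i} < card ?K" by (intro psubset_card_mono) auto
      then show ?thesis using that cK by simp
    qed
    moreover have "inj_on ?p {0..<k}"
    proof (rule inj_onI)
      fix x y assume xy: "x \<in> {0..<k}" "y \<in> {0..<k}" "?p x = ?p y"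
      then have "f x = f y" using pk[of x] pk[of y] by simp
      then show "x = y" using f xy by (auto simp: inj_on_def)
    qed
    ultimately have "bij_betw ?p {0..<k} {0..<k}"
      unfolding bij_betw_def by (intro conjI endo_inj_surj) auto
    then have "?p permutes {0..<k}" by (rule bij_imp_permutes) auto
    then show "(?K, ?p) \<in> ?S \<times> ?P" using f cK by auto
    show "(case (?K, ?p) of (K, p) \<Rightarrow> ?t (\<lambda>i. if i < k then pick K (p i) else i)) = ?t f"
      unfolding prod.case using eq[unfolded prod.case] by (rule arg_cong[where f = ?t])
  next
    fix x assume "x \<in> ?S \<times> ?P"
    then obtain K p where x: "x = (K, p)" and K: "K \<subseteq> {0..<n}" "card K = k" and p: "p permutes {0..<k}"
      by auto
    have finK: "finite K" using K(1) finite_subset by blast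
    have plt: "p i < k" if "i < k" for i using permutes_in_image[OF p, of i] that by simp
    have pin: "pick K i \<in> K" if "i < k" for i using that K pick_in_set_le[of i K] by simp
    have cp: "card {a \<in> K. a < pick K i} = i" if "i < k" for i using that K card_pick_le[of i K] by simp
    define h where "h = (\<lambda>i. if i < k then pick K (p i) else i)"
    have hi: "h i = pick K (p i)" "card {a \<in> K. a < h i} = p i" "h i \<in> K" if "i < k" for i
      using cp[OF plt[OF that]] pin[OF plt[OF that]] that by (simp_all add: h_def)
    have inj: "inj_on h {0..<k}"
    proof (rule inj_onI)
      fix i j assume ij: "i \<in> {0..<k}" "j \<in> {0..<k}" "h i = h j"
      then have "p i = p j" using hi(2)[of i] hi(2)[of j] by auto
      then show "i = j" using permutes_inj[OF p] by (simp add: inj_eq)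
    qed
    then have "card (h ` {0..<k}) = card K" using K by (simp add: card_image)
    moreover have "h ` {0..<k} \<subseteq> K" using hi(3) by auto
    ultimately have im: "h ` {0..<k} = K" using finK by (simp add: card_subset_eq)
    have h: "(case x of (K, p) \<Rightarrow> (\<lambda>i. if i < k then pick K (p i) else i)) = h" by (simp add: x h_def)
    have "(\<lambda>i. if i < k then card {a \<in> K. a < h i} else i) = p"
      using hi(2) permutes_not_in[OF p] by (intro ext) auto
    then show "(\<lambda>f. (f ` {0..<k}, \<lambda>i. if i < k then card {a \<in> f ` {0..<k}. a < f i} else i))
        (case x of (K, p) \<Rightarrow> \<lambda>i. if i < k then pick K (p i) else i) = x"
      unfolding h im by (simp add: x)
    have "h i = i" if "i \<notin> {0..<k}" for i using that by (simp add: h_def)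
    moreover have "h i \<in> {0..<n}" if "i \<in> {0..<k}" for i using hi(3)[of i] that K(1) by auto
    ultimately show "(case x of (K, p) \<Rightarrow> (\<lambda>i. if i < k then pick K (p i) else i)) \<in> {f \<in> ?F. inj_on f {0..<k}}"
      unfolding h using inj by blast
  qed
  also have "\<dots> = (\<Sum>K\<in>?S. \<Sum>p\<in>?P. ?t (\<lambda>i. if i < k then pick K (p i) else i))"
    by (simp add: sum.cartesian_product)
  also have "\<dots> = (\<Sum>K\<in>?S. det (mat k k (\<lambda>(i, j). A $$ (i, pick K j))) * det (mat k k (\<lambda>(i, j). B $$ (pick K i, j))))"
  proof (rule sum.cong[OF refl])
    fix K assume K: "K \<in> ?S"
    let ?BK = "mat k k (\<lambda>(i, j). B $$ (pick K i, j))"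
    let ?AK = "mat k k (\<lambda>(i, j). A $$ (i, pick K j))"
    have "?t (\<lambda>i. if i < k then pick K (p i) else i) = signof p * (\<Prod>i = 0..<k. ?AK $$ (i, p i)) * det ?BK"
      if p: "p \<in> ?P" for p
    proof -
      have pl: "p i < k" if "i < k" for i using permutes_in_image[of p "{0..<k}" i] p that by simp
      have "det (mat k k (\<lambda>(i, j). ?BK $$ (p i, j))) = signof p * det ?BK"
        by (rule det_permute_rows) (use p in auto)
      moreover have "mat k k (\<lambda>(i, j). ?BK $$ (p i, j))
          = mat k k (\<lambda>(i, j). B $$ (if i < k then pick K (p i) else i, j))"
        by (rule eq_matI) (auto simp: pl)
      moreover have "(\<Prod>i\<in>{0..<k}. A $$ (i, if i < k then pick K (p i) else i)) = (\<Prod>i = 0..<k. ?AK $$ (i, p i))"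
        by (rule prod.cong) (auto simp: pl)
      ultimately show ?thesis by (simp add: ac_simps)
    qed
    then have "(\<Sum>p\<in>?P. ?t (\<lambda>i. if i < k then pick K (p i) else i))
      = (\<Sum>p\<in>?P. signof p * (\<Prod>i = 0..<k. ?AK $$ (i, p i)) * det ?BK)" by (intro sum.cong) auto
    also have "\<dots> = det ?AK * det ?BK" unfolding det_def'[of ?AK k, simplified] by (simp add: sum_distrib_right)
    finally show "(\<Sum>p\<in>?P. ?t (\<lambda>i. if i < k then pick K (p i) else i)) = det ?AK * det ?BK" .
  qed
  finally show ?thesis .
qed

lemma set_ksubsets: "set (ksubsets n k) = {K. K \<subseteq> {0..<n} \<and> card K = k}"
  by (auto simp: ksubsets_def subseqs_powset image_iff)

lemma distinct_ksubsets: "distinct (ksubsets n k)"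
  unfolding ksubsets_def by (rule distinct_filter) (rule distinct_set_subseqs, simp)

lemma length_ksubsets: "length (ksubsets n k) = n choose k"
proof -
  have "length (ksubsets n k) = card (set (ksubsets n k))" by (simp add: distinct_card distinct_ksubsets)
  then show ?thesis unfolding set_ksubsets by (simp add: n_subsets)
qed

lemma ksubsets_nth:
  assumes "i < n choose k" shows "ksubsets n k ! i \<subseteq> {0..<n}" "card (ksubsets n k ! i) = k"
    "finite (ksubsets n k ! i)"
proof -
  have "ksubsets n k ! i \<in> {K. K \<subseteq> {0..<n} \<and> card K = k}"
    unfolding set_ksubsets[symmetric] using assms by (simp add: length_ksubsets)
  then show "ksubsets n k ! i \<subseteq> {0..<n}" "card (ksubsets n k ! i) = k" "finite (ksubsets n k ! i)"
    using finite_subset[of "ksubsets n k ! i" "{0..<n}"] by auto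
qed

lemma sum_ksubsets: "(\<Sum>l\<in>{0..<n choose k}. g (ksubsets n k ! l)) = (\<Sum>K | K \<subseteq> {0..<n} \<and> card K = k. g K)"
  by (rule sum.reindex_bij_betw) (use bij_betw_nth[OF distinct_ksubsets[of n k] refl refl]
      in \<open>simp add: length_ksubsets set_ksubsets lessThan_atLeast0\<close>)

lemma submatrix_eq_mat:
  assumes "A \<in> carrier_mat m n" "I \<subseteq> {0..<m}" "J \<subseteq> {0..<n}" 
  shows "submatrix A I J = mat (card I) (card J) (\<lambda>(i, j). A $$ (pick I i, pick J j))"
proof -
  have "{i. i < m \<and> i \<in> I} = I" "{i. i < n \<and> i \<in> J} = J" using assms by auto
  then show ?thesis using assms by (auto simp: submatrix_def)
qed

lemma pick_less: "I \<subseteq> {0..<n} \<Longrightarrow> i < card I \<Longrightarrow> pick I i < n"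
  using pick_in_set_le[of i I] by auto

lemma ext_mat_carrier [simp]: "A \<in> carrier_mat m n \<Longrightarrow> ext_mat k A \<in> carrier_mat (m choose k) (n choose k)"
  by (auto simp: ext_mat_def length_ksubsets)

text \<open>Entrywise this is the Cauchy-Binet formula for a minor of \<open>A * B\<close>. It makes exterior powers
  functorial, hence defined on representations and on their isomorphism classes.\<close>

lemma ext_mat_mult:
  assumes A: "A \<in> carrier_mat m n" and B: "B \<in> carrier_mat n p"
  shows "ext_mat k (A * B) = ext_mat k A * ext_mat k B"
proof (rule eq_matI)
  fix i j assume "i < dim_row (ext_mat k A * ext_mat k B)" "j < dim_col (ext_mat k A * ext_mat k B)"
  then have i: "i < m choose k" and j: "j < p choose k" using A B by (auto simp: ext_mat_def length_ksubsets)
  define I J where "I = ksubsets m k ! i" and "J = ksubsets p k ! j"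
  have I: "I \<subseteq> {0..<m}" "card I = k" and J: "J \<subseteq> {0..<p}" "card J = k"
    using ksubsets_nth[OF i] ksubsets_nth[OF j] by (auto simp: I_def J_def)
  have pI: "pick I a < m" if "a < k" for a using pick_less[OF I(1)] I that by simp
  have pJ: "pick J a < p" if "a < k" for a using pick_less[OF J(1)] J that by simp
  let ?A = "mat k n (\<lambda>(a, b). A $$ (pick I a, b))" and ?B = "mat n k (\<lambda>(a, b). B $$ (a, pick J b))"
  have "ext_mat k (A * B) $$ (i, j) = det (submatrix (A * B) I J)"
    using A B i j by (simp add: ext_mat_def length_ksubsets I_def J_def)
  also have "submatrix (A * B) I J = mat k k (\<lambda>(a, b). (A * B) $$ (pick I a, pick J b))"
    using I J A B by (subst submatrix_eq_mat[where m=m and n=p]) auto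
  also have "\<dots> = ?A * ?B"
    using A B pI pJ by (intro eq_matI) (auto simp: scalar_prod_def)
  also have "det (?A * ?B) = (\<Sum>K | K \<subseteq> {0..<n} \<and> card K = k.
      det (mat k k (\<lambda>(i, j). ?A $$ (i, pick K j))) * det (mat k k (\<lambda>(i, j). ?B $$ (pick K i, j))))"
    by (rule Cauchy_Binet[where n=n]) auto
  also have "\<dots> = (\<Sum>K | K \<subseteq> {0..<n} \<and> card K = k. det (submatrix A I K) * det (submatrix B K J))"
  proof (rule sum.cong[OF refl])
    fix K assume "K \<in> {K. K \<subseteq> {0..<n} \<and> card K = k}"
    then have K: "K \<subseteq> {0..<n}" "card K = k" by auto
    have pK: "pick K a < n" if "a < k" for a using pick_less[OF K(1)] K that by simp
    have "mat k k (\<lambda>(i, j). ?A $$ (i, pick K j)) = submatrix A I K"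
      unfolding submatrix_eq_mat[OF A I(1) K(1)] I(2) K(2) by (rule eq_matI) (auto simp: pK)
    moreover have "mat k k (\<lambda>(i, j). ?B $$ (pick K i, j)) = submatrix B K J"
      unfolding submatrix_eq_mat[OF B K(1) J(1)] J(2) K(2) by (rule eq_matI) (auto simp: pK)
    ultimately show "det (mat k k (\<lambda>(i, j). ?A $$ (i, pick K j))) * det (mat k k (\<lambda>(i, j). ?B $$ (pick K i, j)))
      = det (submatrix A I K) * det (submatrix B K J)" by simp
  qed
  also have "\<dots> = (\<Sum>l\<in>{0..<n choose k}. det (submatrix A I (ksubsets n k ! l)) * det (submatrix B (ksubsets n k ! l) J))"
    by (rule sum_ksubsets[symmetric])
  also have "\<dots> = (ext_mat k A * ext_mat k B) $$ (i, j)"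
    using A B i j by (simp add: ext_mat_def length_ksubsets I_def J_def scalar_prod_def)
  finally show "ext_mat k (A * B) $$ (i, j) = (ext_mat k A * ext_mat k B) $$ (i, j)" .
qed (use A B in \<open>auto simp: ext_mat_def length_ksubsets\<close>)

text \<open>If \<open>I \<noteq> J\<close> have the same size, some row of the \<open>(I, J)\<close> minor of a diagonal matrix vanishes.\<close>

lemma ext_mat_diagonal:
  "ext_mat k (mat n n (\<lambda>(i, j). if i = j then d i else 0))
    = mat (n choose k) (n choose k) (\<lambda>(i, j). if i = j then \<Prod>a\<in>ksubsets n k ! i. d a else 0)"
    (is "ext_mat k ?D = _")
proof (rule eq_matI)
  fix i j assume "i < dim_row (mat (n choose k) (n choose k) (\<lambda>(i, j). if i = j then \<Prod>a\<in>ksubsets n k ! i. d a else 0))"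
    "j < dim_col (mat (n choose k) (n choose k) (\<lambda>(i, j). if i = j then \<Prod>a\<in>ksubsets n k ! i. d a else 0))"
  then have i: "i < n choose k" and j: "j < n choose k" by auto
  define I J where "I = ksubsets n k ! i" and "J = ksubsets n k ! j"
  have I: "I \<subseteq> {0..<n}" "card I = k" "finite I" and J: "J \<subseteq> {0..<n}" "card J = k" "finite J"
    using ksubsets_nth[OF i] ksubsets_nth[OF j] by (auto simp: I_def J_def)
  have pI: "pick I a < n" if "a < k" for a using pick_less[OF I(1)] I that by simp
  have pJ: "pick J a < n" if "a < k" for a using pick_less[OF J(1)] J that by simp
  have bij: "bij_betw (pick I) {0..<k} I"
  proof -
    have "inj_on (pick I) {0..<k}"
      by (rule inj_on_inverseI[where g="\<lambda>x. card {a \<in> I. a < x}"]) (use I card_pick_le in auto)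
    moreover have "pick I ` {0..<k} \<subseteq> I" using pick_in_set_le I by auto
    ultimately show ?thesis using I by (metis bij_betw_def card_atLeastLessThan card_image card_subset_eq diff_zero)
  qed
  have bij': "bij_betw (pick J) {0..<k} J"
  proof -
    have "inj_on (pick J) {0..<k}"
      by (rule inj_on_inverseI[where g="\<lambda>x. card {a \<in> J. a < x}"]) (use J card_pick_le in auto)
    moreover have "pick J ` {0..<k} \<subseteq> J" using pick_in_set_le J by auto
    ultimately show ?thesis using J by (metis bij_betw_def card_atLeastLessThan card_image card_subset_eq diff_zero)
  qed
  have sub: "ext_mat k ?D $$ (i, j) = det (mat k k (\<lambda>(a, b). ?D $$ (pick I a, pick J b)))"
    using i j I J by (subst submatrix_eq_mat[where m=n and n=n, symmetric, of ?D I J, unfolded I(2) J(2)])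
      (auto simp: ext_mat_def length_ksubsets I_def J_def)
  show "ext_mat k ?D $$ (i, j) = mat (n choose k) (n choose k) (\<lambda>(i, j). if i = j then \<Prod>a\<in>ksubsets n k ! i. d a else 0) $$ (i, j)"
  proof (cases "i = j")
    case True
    then have IJ: "I = J" by (simp add: I_def J_def)
    let ?M = "mat k k (\<lambda>(a, b). ?D $$ (pick I a, pick J b))"
    have "upper_triangular ?M"
      using pJ inj_onD[OF bij_betw_imp_inj_on[OF bij']] unfolding IJ
      by (fastforce simp: upper_triangular_def)
    then have "det ?M = prod_list (diag_mat ?M)" by (intro det_upper_triangular[where n=k]) auto
    also have "\<dots> = (\<Prod>a\<in>{0..<k}. d (pick I a))"
      by (simp add: diag_mat_def prod.list_conv_set_nth IJ pJ atLeast0LessThan)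
    also have "\<dots> = (\<Prod>a\<in>I. d a)" by (rule prod.reindex_bij_betw[OF bij])
    finally show ?thesis using sub i True by (simp add: I_def)
  next
    case False
    have "I \<noteq> J" using False i j distinct_ksubsets[of n k] by (simp add: I_def J_def nth_eq_iff_index_eq length_ksubsets)
    then obtain x where x: "x \<in> I" "x \<notin> J" using I J by (metis card_subset_eq subsetI)
    then obtain a where a: "a < k" "pick I a = x"
      using bij by (metis atLeastLessThan_iff bij_betw_imp_surj_on imageE)
    let ?M = "mat k k (\<lambda>(a, b). ?D $$ (pick I a, pick J b))"
    have "?M $$ (a, b) = 0" if "b < k" for b
    proof -
      have "pick J b \<in> J" using that bij' by (auto simp: bij_betw_def)
      then show ?thesis using x a that pI pJ by auto
    qed
    then have "(\<Prod>i = 0..<k. ?M $$ (i, p i)) = 0" if "p permutes {0..<k}" for p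
      using a(1) permutes_in_image[OF that, of a] by (intro prod_zero bexI[of _ a]) auto
    then have "det ?M = 0" by (subst det_def'[where n=k]) (auto intro!: sum.neutral)
    then show ?thesis using sub i j False by simp
  qed
qed (auto simp: ext_mat_def length_ksubsets)

section \<open>Kronecker products and diagonal matrices\<close>

text \<open>The index convention of Kronecker products: \<open>l\<close> stands for the pair of its quotient and remainder.\<close>

lemma sum_div_mod:
  fixes g :: "nat \<Rightarrow> nat \<Rightarrow> 'a::comm_monoid_add"
  shows "(\<Sum>l\<in>{0..<n * q}. g (l div q) (l mod q)) = (\<Sum>a\<in>{0..<n}. \<Sum>b\<in>{0..<q}. g a b)"
proof -
  have lt: "a * q + b < n * q" if "a < n" "b < q" for a b
    using mult_le_mono1[of "Suc a" n q] that by simp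
  have "(\<Sum>l\<in>{0..<n * q}. g (l div q) (l mod q)) = (\<Sum>(a, b)\<in>{0..<n} \<times> {0..<q}. g a b)"
    by (rule sum.reindex_bij_witness[where i="\<lambda>(a, b). a * q + b" and j="\<lambda>l. (l div q, l mod q)"])
      (auto simp: less_mult_imp_div_less lt intro!: mod_less_divisor gr0I)
  then show ?thesis by (simp add: sum.cartesian_product)
qed

lemma kronecker_carrier [simp]:
  "A \<in> carrier_mat m n \<Longrightarrow> B \<in> carrier_mat p q \<Longrightarrow> kronecker A B \<in> carrier_mat (m * p) (n * q)"
  by (auto simp: kronecker_def)

lemma div_mod_less: assumes "i < m * (p::nat)" shows "i div p < m" "i mod p < p"
  using assms by (auto simp: less_mult_imp_div_less intro!: mod_less_divisor gr0I)

lemma kronecker_mult: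
  assumes A: "A \<in> carrier_mat m n" and C: "C \<in> carrier_mat n s"
    and B: "B \<in> carrier_mat p q" and D: "D \<in> carrier_mat q t"
  shows "kronecker (A * C) (B * D) = kronecker A B * kronecker C D"
proof (rule eq_matI)
  fix i j assume "i < dim_row (kronecker A B * kronecker C D)" "j < dim_col (kronecker A B * kronecker C D)"
  then have ij: "i < m * p" "j < s * t" using A B C D by (auto simp: kronecker_def)
  note dm = div_mod_less[OF ij(1)] div_mod_less[OF ij(2)]
  have "(kronecker A B * kronecker C D) $$ (i, j) = (\<Sum>l\<in>{0..<n * q}.
      (A $$ (i div p, l div q) * C $$ (l div q, j div t)) * (B $$ (i mod p, l mod q) * D $$ (l mod q, j mod t)))"
    using A B C D ij by (auto simp: kronecker_def scalar_prod_def ac_simps intro!: sum.cong)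
  also have "\<dots> = (\<Sum>a\<in>{0..<n}. \<Sum>b\<in>{0..<q}.
      (A $$ (i div p, a) * C $$ (a, j div t)) * (B $$ (i mod p, b) * D $$ (b, j mod t)))"
    by (rule sum_div_mod)
  also have "\<dots> = kronecker (A * C) (B * D) $$ (i, j)"
    using A B C D ij dm by (simp add: kronecker_def scalar_prod_def sum_product)
  finally show "kronecker (A * C) (B * D) $$ (i, j) = (kronecker A B * kronecker C D) $$ (i, j)" by simp
qed (use A B C D in \<open>auto simp: kronecker_def\<close>)

definition diag_of :: "'k::field list \<Rightarrow> 'k mat"
  where "diag_of ds = mat (length ds) (length ds) (\<lambda>(i, j). if i = j then ds ! i else 0)"

lemma diag_of_carrier [simp]: "length ds = n \<Longrightarrow> diag_of ds \<in> carrier_mat n n"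
  by (auto simp: diag_of_def)

lemma diag_of_append: "four_block_mat (diag_of xs) (0\<^sub>m (length xs) (length ys)) (0\<^sub>m (length ys) (length xs)) (diag_of ys)
   = diag_of (xs @ ys)"
  by (rule eq_matI) (auto simp: diag_of_def nth_append)

lemma diag_of_ones: "diag_of (replicate n 1) = 1\<^sub>m n"
  by (rule eq_matI) (auto simp: diag_of_def)

lemma concat_map_nth:
  assumes "i < length xs * length ys"
  shows "concat (map (\<lambda>x. map (f x) ys) xs) ! i = f (xs ! (i div length ys)) (ys ! (i mod length ys))"
  using assms
proof (induction xs arbitrary: i)
  case (Cons x xs)
  show ?case
  proof (cases "i < length ys")
    case False
    then have "i - length ys < length xs * length ys" "length ys > 0" using Cons.prems by auto
    moreover have "i div length ys = Suc ((i - length ys) div length ys)" "i mod length ys = (i - length ys) mod length ys"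
      using False calculation(2) by (auto simp: le_div_geq le_mod_geq)
    ultimately show ?thesis using Cons.IH False by (simp add: nth_append)
  qed (simp add: nth_append)
qed simp

lemma length_concat_map: "length (concat (map (\<lambda>x. map (f x) ys) xs)) = length xs * length ys"
  by (induction xs) auto

lemma kronecker_diag_of:
  "kronecker (diag_of xs) (diag_of ys) = diag_of (concat (map (\<lambda>x. map (\<lambda>y. x * y) ys) xs))"
  (is "_ = diag_of ?c")
proof (rule eq_matI)
  fix i j assume "i < dim_row (diag_of ?c)" "j < dim_col (diag_of ?c)"
  then have ij: "i < length xs * length ys" "j < length xs * length ys"
    unfolding diag_of_def by (simp_all only: dim_row_mat dim_col_mat length_concat_map)
  note dm = div_mod_less[OF ij(1)] div_mod_less[OF ij(2)]
  have "i = j \<longleftrightarrow> i div length ys = j div length ys \<and> i mod length ys = j mod length ys"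
    by (metis div_mod_decomp)
  then show "kronecker (diag_of xs) (diag_of ys) $$ (i, j) = diag_of ?c $$ (i, j)"
    using ij dm concat_map_nth[OF ij(1), of "\<lambda>x y. x * y"]
    unfolding diag_of_def kronecker_def by (auto simp: length_concat_map)
qed (auto simp: diag_of_def kronecker_def length_concat_map)

lemma ext_mat_diag_of:
  "ext_mat k (diag_of ds) = diag_of (map (\<lambda>I. \<Prod>a\<in>I. ds ! a) (ksubsets (length ds) k))"
  unfolding diag_of_def ext_mat_diagonal by (rule eq_matI) (auto simp: length_ksubsets)

lemma ext_mat_one: "ext_mat k (1\<^sub>m n) = 1\<^sub>m (n choose k)"
proof -
  have *: "(\<Prod>a\<in>I. replicate n (1::'a) ! a) = 1" if "I \<in> set (ksubsets n k)" for I
    using that unfolding set_ksubsets by (intro prod.neutral) auto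
  have "map (\<lambda>I. \<Prod>a\<in>I. replicate n (1::'a) ! a) (ksubsets n k) = replicate (n choose k) 1"
    using * by (auto simp: list_eq_iff_nth_eq length_ksubsets)
  then show ?thesis using ext_mat_diag_of[of k "replicate n (1::'a)"] by (simp add: diag_of_ones)
qed

lemma kronecker_one: "kronecker (1\<^sub>m m) (1\<^sub>m n) = (1\<^sub>m (m * n) :: 'a::field mat)"
proof -
  have "concat (map (\<lambda>x. map (\<lambda>y. x * y) (replicate n (1::'a))) (replicate m 1)) = replicate (m * n) 1"
    by (induction m) (auto simp: replicate_add)
  then show ?thesis using kronecker_diag_of[of "replicate m (1::'a)" "replicate n 1"] by (simp add: diag_of_ones)
qed

section \<open>Operations on matrix representations\<close>

lemma rep_isoI:
  assumes "rep_dim V = n" "rep_dim W = n" "P \<in> carrier_mat n n" "Q \<in> carrier_mat n n" "P * Q = 1\<^sub>m n" "Q * P = 1\<^sub>m n"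
    "\<And>g. g \<in> carrier G \<Longrightarrow> P * snd V g = snd W g * P"
  shows "rep_iso G V W"
proof -
  have "invertible_mat P" using assms by (auto simp: invertible_mat_def inverts_mat_def)
  then show ?thesis using assms by (auto simp: rep_iso_def)
qed

text \<open>Isomorphism is stated with an invertible matrix; the inverse is made explicit here so that the
  operations on representations can be applied to both matrices.\<close>

lemma rep_isoE:
  assumes "rep_iso G V W"
  obtains n P Q where "rep_dim V = n" "rep_dim W = n" "P \<in> carrier_mat n n" "Q \<in> carrier_mat n n"
    "P * Q = 1\<^sub>m n" "Q * P = 1\<^sub>m n" "\<And>g. g \<in> carrier G \<Longrightarrow> P * snd V g = snd W g * P"
proof -
  obtain P where P: "P \<in> carrier_mat (rep_dim V) (rep_dim V)" "invertible_mat P"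
    "\<And>g. g \<in> carrier G \<Longrightarrow> P * snd V g = snd W g * P" and d: "rep_dim V = rep_dim W"
    using assms by (auto simp: rep_iso_def)
  obtain Q where Q: "P * Q = 1\<^sub>m (dim_row P)" "Q * P = 1\<^sub>m (dim_row Q)"
    using P(2) by (auto simp: invertible_mat_def inverts_mat_def)
  have "dim_col Q = rep_dim V" using arg_cong[OF Q(1), of dim_col] P(1) by simp
  moreover have "dim_row Q = rep_dim V" using arg_cong[OF Q(2), of dim_col] P(1) by simp
  ultimately have "Q \<in> carrier_mat (rep_dim V) (rep_dim V)" by auto
  then show ?thesis using Q P(1) by (intro that[of "rep_dim V" P Q] P(3)) (simp_all add: d)
qed

lemma repsD:
  assumes "V \<in> reps G"
  shows "g \<in> carrier G \<Longrightarrow> snd V g \<in> carrier_mat (rep_dim V) (rep_dim V)"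
    "snd V \<one>\<^bsub>G\<^esub> = 1\<^sub>m (rep_dim V)"
    "g \<in> carrier G \<Longrightarrow> h \<in> carrier G \<Longrightarrow> snd V (g \<otimes>\<^bsub>G\<^esub> h) = snd V g * snd V h"
  using assms by (auto simp: reps_def rep_dim_def)

lemma repsI:
  assumes "\<And>g. g \<in> carrier G \<Longrightarrow> snd V g \<in> carrier_mat (rep_dim V) (rep_dim V)"
    "snd V \<one>\<^bsub>G\<^esub> = 1\<^sub>m (rep_dim V)"
    "\<And>g h. g \<in> carrier G \<Longrightarrow> h \<in> carrier G \<Longrightarrow> snd V (g \<otimes>\<^bsub>G\<^esub> h) = snd V g * snd V h"
  shows "V \<in> reps G"
  using assms by (cases V) (auto simp: reps_def rep_dim_def)

lemma rep_iso_refl: "V \<in> reps G \<Longrightarrow> rep_iso G V V"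
  by (rule rep_isoI[of V "rep_dim V" V "1\<^sub>m (rep_dim V)" "1\<^sub>m (rep_dim V)"]) (auto dest: repsD(1))

lemma rep_iso_sym:
  assumes "rep_iso G V W" "V \<in> reps G" "W \<in> reps G"
  shows "rep_iso G W V"
  using assms(1)
proof (rule rep_isoE)
  fix n P Q assume *: "rep_dim V = n" "rep_dim W = n" "P \<in> carrier_mat n n" "Q \<in> carrier_mat n n"
    "P * Q = 1\<^sub>m n" "Q * P = 1\<^sub>m n" "\<And>g. g \<in> carrier G \<Longrightarrow> P * snd V g = snd W g * P"
  show ?thesis
  proof (rule rep_isoI[OF *(2,1,4,3,6,5)])
    fix g assume g: "g \<in> carrier G"
    have c: "snd V g \<in> carrier_mat n n" "snd W g \<in> carrier_mat n n"
      using repsD(1)[OF assms(2) g] repsD(1)[OF assms(3) g] * by auto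
    have "Q * snd W g = Q * snd W g * (P * Q)" using c *(3,4,5) by simp
    also have "\<dots> = Q * (snd W g * P) * Q" using c *(3,4) by (simp add: assoc_mult_mat[of _ n n _ n _ n])
    also have "\<dots> = Q * P * snd V g * Q"
      unfolding *(7)[OF g, symmetric] using c *(3,4) by (simp add: assoc_mult_mat[of _ n n _ n _ n])
    finally show "Q * snd W g = snd V g * Q" using c *(3,4,6) by simp
  qed
qed

lemma rep_iso_trans:
  assumes "rep_iso G U V" "rep_iso G V W" "U \<in> reps G" "V \<in> reps G" "W \<in> reps G"
  shows "rep_iso G U W"
  using assms(1)
proof (rule rep_isoE)
  fix n P Q assume 1: "rep_dim U = n" "rep_dim V = n" "P \<in> carrier_mat n n" "Q \<in> carrier_mat n n"
    "P * Q = 1\<^sub>m n" "Q * P = 1\<^sub>m n" "\<And>g. g \<in> carrier G \<Longrightarrow> P * snd U g = snd V g * P"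
  show ?thesis using assms(2)
  proof (rule rep_isoE)
    fix n' P' Q' assume "rep_dim V = n'" "rep_dim W = n'" "P' \<in> carrier_mat n' n'" "Q' \<in> carrier_mat n' n'"
      "P' * Q' = 1\<^sub>m n'" "Q' * P' = 1\<^sub>m n'" "\<And>g. g \<in> carrier G \<Longrightarrow> P' * snd V g = snd W g * P'"
    then have 2: "rep_dim W = n" "P' \<in> carrier_mat n n" "Q' \<in> carrier_mat n n"
      "P' * Q' = 1\<^sub>m n" "Q' * P' = 1\<^sub>m n" "\<And>g. g \<in> carrier G \<Longrightarrow> P' * snd V g = snd W g * P'"
      using 1 by auto
    show ?thesis
    proof (rule rep_isoI[OF 1(1) 2(1), of "P' * P" "Q * Q'"])
      have "P' * P * (Q * Q') = P' * (P * Q) * Q'" using 1(3,4) 2(2,3) by (simp add: assoc_mult_mat[of _ n n _ n _ n])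
      then show "P' * P * (Q * Q') = 1\<^sub>m n" using 1(5) 2(2,4) by simp
      have "Q * Q' * (P' * P) = Q * (Q' * P') * P" using 1(3,4) 2(2,3) by (simp add: assoc_mult_mat[of _ n n _ n _ n])
      then show "Q * Q' * (P' * P) = 1\<^sub>m n" using 1(4,6) 2(5) by simp
      fix g assume g: "g \<in> carrier G"
      have c: "snd U g \<in> carrier_mat n n" "snd V g \<in> carrier_mat n n" "snd W g \<in> carrier_mat n n"
        using repsD(1)[OF assms(3) g] repsD(1)[OF assms(4) g] repsD(1)[OF assms(5) g] 1 2 by auto
      have "P' * P * snd U g = P' * (P * snd U g)" using c 1(3) 2(2) by (simp add: assoc_mult_mat[of _ n n _ n _ n])
      also have "\<dots> = P' * snd V g * P" unfolding 1(7)[OF g] using c 1(3) 2(2) by (simp add: assoc_mult_mat[of _ n n _ n _ n])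
      also have "\<dots> = snd W g * (P' * P)" unfolding 2(6)[OF g] using c 1(3) 2(2) by (simp add: assoc_mult_mat[of _ n n _ n _ n])
      finally show "P' * P * snd U g = snd W g * (P' * P)" .
    qed (use 1 2 in auto)
  qed
qed

lemma rep_dims [simp]:
  "rep_dim (dsum_rep V W) = rep_dim V + rep_dim W"
  "rep_dim (tensor_rep V W) = rep_dim V * rep_dim W"
  "rep_dim (ext_rep k V) = rep_dim V choose k"
  "rep_dim (zero_rep) = 0" "rep_dim triv_rep = 1"
  by (auto simp: dsum_rep_def tensor_rep_def ext_rep_def zero_rep_def triv_rep_def rep_dim_def)

lemma zero_rep_in [simp]: "zero_rep \<in> reps G" and triv_rep_in [simp]: "triv_rep \<in> reps G"
  by (auto intro!: repsI simp: zero_rep_def triv_rep_def rep_dim_def)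

lemma block_diag_mult:
  assumes "A \<in> carrier_mat m m" "A' \<in> carrier_mat m m" "B \<in> carrier_mat n n" "B' \<in> carrier_mat n n"
  shows "four_block_mat A (0\<^sub>m m n) (0\<^sub>m n m) B * four_block_mat A' (0\<^sub>m m n) (0\<^sub>m n m) B'
    = four_block_mat (A * A') (0\<^sub>m m n) (0\<^sub>m n m) (B * B' :: 'a::field mat)"
  using assms by (subst mult_four_block_mat[where ?nr1.0=m and ?n1.0=m and ?n2.0=n and ?nr2.0=n and ?nc1.0=m and ?nc2.0=n]) auto

lemma dsum_rep_in [simp]:
  assumes "V \<in> reps G" "W \<in> reps G" shows "dsum_rep V W \<in> reps G"
proof (rule repsI)
  fix g h assume "g \<in> carrier G" "h \<in> carrier G"
  then show "snd (dsum_rep V W) (g \<otimes>\<^bsub>G\<^esub> h) = snd (dsum_rep V W) g * snd (dsum_rep V W) h"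
    using repsD[OF assms(1)] repsD[OF assms(2)] by (simp add: dsum_rep_def block_diag_mult)
qed (use repsD[OF assms(1)] repsD[OF assms(2)] in \<open>auto simp: dsum_rep_def rep_dim_def\<close>)

lemma tensor_rep_in [simp]:
  assumes "V \<in> reps G" "W \<in> reps G" shows "tensor_rep V W \<in> reps G"
proof (rule repsI)
  fix g h assume gh: "g \<in> carrier G" "h \<in> carrier G"
  show "snd (tensor_rep V W) (g \<otimes>\<^bsub>G\<^esub> h) = snd (tensor_rep V W) g * snd (tensor_rep V W) h"
    using repsD(3)[OF assms(1) gh] repsD(3)[OF assms(2) gh]
      kronecker_mult[OF repsD(1)[OF assms(1) gh(1)] repsD(1)[OF assms(1) gh(2)]
       repsD(1)[OF assms(2) gh(1)] repsD(1)[OF assms(2) gh(2)]]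
    by (simp add: tensor_rep_def)
next
  fix g assume g: "g \<in> carrier G"
  show "snd (tensor_rep V W) g \<in> carrier_mat (rep_dim (tensor_rep V W)) (rep_dim (tensor_rep V W))"
    using kronecker_carrier[OF repsD(1)[OF assms(1) g] repsD(1)[OF assms(2) g]]
    unfolding rep_dims by (simp add: tensor_rep_def)
next
  show "snd (tensor_rep V W) \<one>\<^bsub>G\<^esub> = 1\<^sub>m (rep_dim (tensor_rep V W))"
    using repsD(2)[OF assms(1)] repsD(2)[OF assms(2)] unfolding rep_dims
    by (simp add: tensor_rep_def kronecker_one)
qed

lemma ext_rep_in [simp]:
  assumes "V \<in> reps G" shows "ext_rep k V \<in> reps G"
proof (rule repsI)
  fix g h assume gh: "g \<in> carrier G" "h \<in> carrier G"
  show "snd (ext_rep k V) (g \<otimes>\<^bsub>G\<^esub> h) = snd (ext_rep k V) g * snd (ext_rep k V) h"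
    using repsD(3)[OF assms(1) gh] ext_mat_mult[OF repsD(1)[OF assms(1) gh(1)] repsD(1)[OF assms(1) gh(2)]]
    by (simp add: ext_rep_def)
next
  fix g assume g: "g \<in> carrier G"
  show "snd (ext_rep k V) g \<in> carrier_mat (rep_dim (ext_rep k V)) (rep_dim (ext_rep k V))"
    using ext_mat_carrier[OF repsD(1)[OF assms(1) g]]
    unfolding rep_dims by (simp add: ext_rep_def)
next
  show "snd (ext_rep k V) \<one>\<^bsub>G\<^esub> = 1\<^sub>m (rep_dim (ext_rep k V))"
    using repsD(2)[OF assms(1)] unfolding rep_dims
    by (simp add: ext_rep_def ext_mat_one)
qed

lemma dsum_rep_cong:
  assumes "rep_iso G V V'" "rep_iso G W W'" "V \<in> reps G" "V' \<in> reps G" "W \<in> reps G" "W' \<in> reps G"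
  shows "rep_iso G (dsum_rep V W) (dsum_rep V' W')"
  using assms(1)
proof (rule rep_isoE)
  fix n P Q assume 1: "rep_dim V = n" "rep_dim V' = n" "P \<in> carrier_mat n n" "Q \<in> carrier_mat n n"
    "P * Q = 1\<^sub>m n" "Q * P = 1\<^sub>m n" "\<And>g. g \<in> carrier G \<Longrightarrow> P * snd V g = snd V' g * P"
  show ?thesis using assms(2)
  proof (rule rep_isoE)
    fix m R S assume 2: "rep_dim W = m" "rep_dim W' = m" "R \<in> carrier_mat m m" "S \<in> carrier_mat m m"
      "R * S = 1\<^sub>m m" "S * R = 1\<^sub>m m" "\<And>g. g \<in> carrier G \<Longrightarrow> R * snd W g = snd W' g * R"
    let ?B = "\<lambda>A B. four_block_mat A (0\<^sub>m n m) (0\<^sub>m m n) B"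
    show ?thesis
    proof (rule rep_isoI[of _ "n + m" _ "?B P R" "?B Q S"])
      fix g assume g: "g \<in> carrier G"
      have "snd V g \<in> carrier_mat n n" "snd V' g \<in> carrier_mat n n" "snd W g \<in> carrier_mat m m" "snd W' g \<in> carrier_mat m m"
        using repsD(1)[OF assms(3) g] repsD(1)[OF assms(4) g] repsD(1)[OF assms(5) g] repsD(1)[OF assms(6) g] 1 2 by auto
      then show "?B P R * snd (dsum_rep V W) g = snd (dsum_rep V' W') g * ?B P R"
        using 1 2 g by (simp add: dsum_rep_def block_diag_mult)
    qed (use 1 2 in \<open>auto simp: block_diag_mult\<close>)
  qed
qed

lemma tensor_rep_cong:
  assumes "rep_iso G V V'" "rep_iso G W W'" "V \<in> reps G" "V' \<in> reps G" "W \<in> reps G" "W' \<in> reps G"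
  shows "rep_iso G (tensor_rep V W) (tensor_rep V' W')"
  using assms(1)
proof (rule rep_isoE)
  fix n P Q assume 1: "rep_dim V = n" "rep_dim V' = n" "P \<in> carrier_mat n n" "Q \<in> carrier_mat n n"
    "P * Q = 1\<^sub>m n" "Q * P = 1\<^sub>m n" "\<And>g. g \<in> carrier G \<Longrightarrow> P * snd V g = snd V' g * P"
  show ?thesis using assms(2)
  proof (rule rep_isoE)
    fix m R S assume 2: "rep_dim W = m" "rep_dim W' = m" "R \<in> carrier_mat m m" "S \<in> carrier_mat m m"
      "R * S = 1\<^sub>m m" "S * R = 1\<^sub>m m" "\<And>g. g \<in> carrier G \<Longrightarrow> R * snd W g = snd W' g * R"
    show ?thesis
    proof (rule rep_isoI[of _ "n * m" _ "kronecker P R" "kronecker Q S"])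
      fix g assume g: "g \<in> carrier G"
      have c: "snd V g \<in> carrier_mat n n" "snd V' g \<in> carrier_mat n n" "snd W g \<in> carrier_mat m m" "snd W' g \<in> carrier_mat m m"
        using repsD(1)[OF assms(3) g] repsD(1)[OF assms(4) g] repsD(1)[OF assms(5) g] repsD(1)[OF assms(6) g] 1 2 by auto
      show "kronecker P R * snd (tensor_rep V W) g = snd (tensor_rep V' W') g * kronecker P R"
        unfolding tensor_rep_def snd_conv kronecker_mult[OF 1(3) c(1) 2(3) c(3), symmetric]
          kronecker_mult[OF c(2) 1(3) c(4) 2(3), symmetric] using 1(7) 2(7) g by simp
    next
      show "kronecker P R * kronecker Q S = 1\<^sub>m (n * m)"
        unfolding kronecker_mult[OF 1(3,4) 2(3,4), symmetric] 1 2 by (rule kronecker_one)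
      show "kronecker Q S * kronecker P R = 1\<^sub>m (n * m)"
        unfolding kronecker_mult[OF 1(4,3) 2(4,3), symmetric] 1 2 by (rule kronecker_one)
    qed (use 1 2 in \<open>auto simp: rep_dims simp del: One_nat_def\<close>)
  qed
qed

lemma ext_rep_cong:
  assumes "rep_iso G V V'" "V \<in> reps G" "V' \<in> reps G"
  shows "rep_iso G (ext_rep k V) (ext_rep k V')"
  using assms(1)
proof (rule rep_isoE)
  fix n P Q assume 1: "rep_dim V = n" "rep_dim V' = n" "P \<in> carrier_mat n n" "Q \<in> carrier_mat n n"
    "P * Q = 1\<^sub>m n" "Q * P = 1\<^sub>m n" "\<And>g. g \<in> carrier G \<Longrightarrow> P * snd V g = snd V' g * P"
  show ?thesis
  proof (rule rep_isoI[of _ "n choose k" _ "ext_mat k P" "ext_mat k Q"])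
    fix g assume g: "g \<in> carrier G"
    have c: "snd V g \<in> carrier_mat n n" "snd V' g \<in> carrier_mat n n"
      using repsD(1)[OF assms(2) g] repsD(1)[OF assms(3) g] 1 by auto
    show "ext_mat k P * snd (ext_rep k V) g = snd (ext_rep k V') g * ext_mat k P"
      unfolding ext_rep_def snd_conv ext_mat_mult[OF 1(3) c(1), symmetric]
          ext_mat_mult[OF c(2) 1(3), symmetric] using 1(7) g by simp
  next
    show "ext_mat k P * ext_mat k Q = 1\<^sub>m (n choose k)" "ext_mat k Q * ext_mat k P = 1\<^sub>m (n choose k)"
      using ext_mat_mult[OF 1(3,4), of k] ext_mat_mult[OF 1(4,3), of k] 1 by (simp_all add: ext_mat_one)
  qed (use 1 in auto)
qed

section \<open>Simultaneous diagonalization of commuting involutions\<close>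

text \<open>A common eigenvector of all but one of the involutions, say \<open>v\<close>, can be replaced by \<open>v + A v\<close> for
  the remaining involution \<open>A\<close>, which is fixed by \<open>A\<close>; if this vector vanishes, \<open>v\<close> itself is an
  eigenvector of \<open>A\<close> for \<open>-1\<close>.\<close>

lemma common_eigenvector:
  fixes A :: "'i \<Rightarrow> 'k::field mat"
  assumes fin: "finite I" and A: "\<And>i. i \<in> I \<Longrightarrow> A i \<in> carrier_mat n n"
    and inv: "\<And>i. i \<in> I \<Longrightarrow> A i * A i = 1\<^sub>m n"
    and comm: "\<And>i j. i \<in> I \<Longrightarrow> j \<in> I \<Longrightarrow> A i * A j = A j * A i"
    and n: "n > 0"
  shows "\<exists>v s. v \<in> carrier_vec n \<and> v \<noteq> 0\<^sub>v n \<and>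
    (\<forall>i\<in>I. (s i = (1::int) \<or> s i = -1) \<and> A i *\<^sub>v v = of_int (s i) \<cdot>\<^sub>v v)"
  using assms
proof (induction I)
  case empty
  have "unit_vec n 0 $ 0 \<noteq> (0\<^sub>v n :: 'k vec) $ 0" using n by simp
  then have "unit_vec n 0 \<noteq> (0\<^sub>v n :: 'k vec)" by metis
  then show ?case using unit_vec_carrier by blast
next
  case (insert x F)
  have "\<exists>v s. v \<in> carrier_vec n \<and> v \<noteq> 0\<^sub>v n \<and>
    (\<forall>i\<in>F. (s i = (1::int) \<or> s i = -1) \<and> A i *\<^sub>v v = of_int (s i) \<cdot>\<^sub>v v)"
    by (rule insert.IH) (simp_all add: insert.prems)
  then obtain v s where v: "v \<in> carrier_vec n" "v \<noteq> 0\<^sub>v n"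
    and s: "\<And>i. i \<in> F \<Longrightarrow> (s i = (1::int) \<or> s i = -1) \<and> A i *\<^sub>v v = of_int (s i) \<cdot>\<^sub>v v"
    by blast
  have Ax: "A x \<in> carrier_mat n n" "A x * A x = 1\<^sub>m n" using insert.prems by auto
  have Av: "A x *\<^sub>v v \<in> carrier_vec n" using Ax v by auto
  show ?case
  proof (cases "v + A x *\<^sub>v v = 0\<^sub>v n")
    case True
    have "A x *\<^sub>v v = - v"
    proof (rule eq_vecI)
      fix i assume "i < dim_vec (- v)"
      then have "i < n" using v by auto
      then have "(v + A x *\<^sub>v v) $ i = 0" using True by simp
      then show "(A x *\<^sub>v v) $ i = (- v) $ i"
        using \<open>i < n\<close> v Av Ax(1) by (simp add: eq_neg_iff_add_eq_0 add.commute del: index_mult_mat_vec)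
    qed (use v Ax in auto)
    then have "A x *\<^sub>v v = of_int (-1) \<cdot>\<^sub>v v" using v by auto
    then show ?thesis using v s insert.hyps(2)
      by (intro exI[of _ v] exI[of _ "s(x := -1)"]) auto
  next
    case False
    let ?u = "v + A x *\<^sub>v v"
    have "A x *\<^sub>v ?u = A x *\<^sub>v v + A x *\<^sub>v (A x *\<^sub>v v)" using v Ax Av by (simp add: mult_add_distrib_mat_vec)
    also have "A x *\<^sub>v (A x *\<^sub>v v) = v" using v Ax by (metis assoc_mult_mat_vec one_mult_mat_vec)
    finally have ux: "A x *\<^sub>v ?u = ?u" using v Av by (simp add: comm_add_vec)
    have ui: "A i *\<^sub>v ?u = of_int (s i) \<cdot>\<^sub>v ?u" if i: "i \<in> F" for i
    proof -
      have Ai: "A i \<in> carrier_mat n n" using insert.prems i by auto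
      have "A i *\<^sub>v (A x *\<^sub>v v) = A x *\<^sub>v (A i *\<^sub>v v)"
        using insert.prems(3)[of i x] i v Ai Ax by (metis assoc_mult_mat_vec insertCI)
      also have "\<dots> = of_int (s i) \<cdot>\<^sub>v (A x *\<^sub>v v)" using s[OF i] v Ax by (simp add: mult_mat_vec)
      finally show ?thesis using s[OF i] v Av Ai
        by (simp add: mult_add_distrib_mat_vec smult_add_distrib_vec)
    qed
    show ?thesis
      by (rule exI[of _ ?u], rule exI[of _ "s(x := 1)"])
        (use ux ui s insert.hyps(2) False v Av in auto)
  qed
qed

text \<open>A linear form with the same eigenvalues as \<open>v\<close> and not vanishing on \<open>v\<close>, obtained from any form
  \<open>w\<close> with \<open>w \<bullet> v \<noteq> 0\<close> by projecting to the eigenspace of one transposed involution after the other.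
  Its kernel is an invariant complement of \<open>v\<close>. This is the point where the characteristic matters.\<close>

lemma dual_eigenvector:
  fixes A :: "'i \<Rightarrow> 'k::field mat"
  assumes fin: "finite I" and A: "\<And>i. i \<in> I \<Longrightarrow> A i \<in> carrier_mat n n"
    and inv: "\<And>i. i \<in> I \<Longrightarrow> A i * A i = 1\<^sub>m n"
    and comm: "\<And>i j. i \<in> I \<Longrightarrow> j \<in> I \<Longrightarrow> A i * A j = A j * A i"
    and two: "(2::'k) \<noteq> 0" and v: "v \<in> carrier_vec n" "v \<noteq> 0\<^sub>v n"
    and s: "\<And>i. i \<in> I \<Longrightarrow> (s i = (1::int) \<or> s i = -1) \<and> A i *\<^sub>v v = of_int (s i) \<cdot>\<^sub>v v"
  shows "\<exists>w. w \<in> carrier_vec n \<and> w \<bullet> v = 1 \<and> (\<forall>i\<in>I. transpose_mat (A i) *\<^sub>v w = of_int (s i) \<cdot>\<^sub>v w)"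
proof -
  have "\<exists>w. w \<in> carrier_vec n \<and> w \<bullet> v \<noteq> 0 \<and> (\<forall>i\<in>I. transpose_mat (A i) *\<^sub>v w = of_int (s i) \<cdot>\<^sub>v w)"
    using fin A inv comm s
  proof (induction I)
    case empty
    obtain i where "i < n" "v $ i \<noteq> 0" using v by (metis eq_vecI carrier_vecD index_zero_vec)
    then have "unit_vec n i \<bullet> v \<noteq> 0" using v by simp
    then show ?case using unit_vec_carrier by blast
  next
    case (insert x F)
    have "\<exists>w. w \<in> carrier_vec n \<and> w \<bullet> v \<noteq> 0 \<and> (\<forall>i\<in>F. transpose_mat (A i) *\<^sub>v w = of_int (s i) \<cdot>\<^sub>v w)"
      by (rule insert.IH) (simp_all add: insert.prems)
    then obtain w where w: "w \<in> carrier_vec n" "w \<bullet> v \<noteq> 0"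
      and wF: "\<And>i. i \<in> F \<Longrightarrow> transpose_mat (A i) *\<^sub>v w = of_int (s i) \<cdot>\<^sub>v w"
      by blast
    have Ax: "A x \<in> carrier_mat n n" "A x * A x = 1\<^sub>m n" "A x *\<^sub>v v = of_int (s x) \<cdot>\<^sub>v v"
      using insert.prems(1,2,4)[of x] by auto
    have sx: "(of_int (s x) * of_int (s x) :: 'k) = 1"
      using insert.prems(4)[of x] by auto
    let ?T = "transpose_mat (A x)"
    have T: "?T \<in> carrier_mat n n" using Ax by simp
    have TT: "?T * ?T = 1\<^sub>m n" using transpose_mult[OF Ax(1) Ax(1)] Ax(2) by simp
    have Tw: "?T *\<^sub>v w \<in> carrier_vec n" using T w by auto
    (* Twice the projection of w to the eigenspace of the transpose of A x for the eigenvalue s x;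
       its pairing with v is twice that of w. *)
    let ?u = "w + of_int (s x) \<cdot>\<^sub>v (?T *\<^sub>v w)"
    have u: "?u \<in> carrier_vec n" using w Tw by auto
    have "?u \<bullet> v = w \<bullet> v + of_int (s x) * ((?T *\<^sub>v w) \<bullet> v)"
      using w Tw v by (simp add: add_scalar_prod_distrib[of _ n])
    also have "(?T *\<^sub>v w) \<bullet> v = w \<bullet> (A x *\<^sub>v v)"
      using transpose_vec_mult_scalar[OF Ax(1) v(1) w(1)] .
    also have "\<dots> = of_int (s x) * (w \<bullet> v)" using Ax(3) w v by simp
    also have "of_int (s x) * (of_int (s x) * (w \<bullet> v)) = w \<bullet> v" using sx by (simp add: mult.assoc[symmetric])
    finally have "?u \<bullet> v = 2 * (w \<bullet> v)" by simp
    then have unz: "?u \<bullet> v \<noteq> 0" using two w by simp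
    have "?T *\<^sub>v ?u = ?T *\<^sub>v w + of_int (s x) \<cdot>\<^sub>v (?T *\<^sub>v (?T *\<^sub>v w))"
      using T w Tw by (simp add: mult_add_distrib_mat_vec mult_mat_vec)
    also have "?T *\<^sub>v (?T *\<^sub>v w) = w" using T w TT by (metis assoc_mult_mat_vec one_mult_mat_vec)
    also have "?T *\<^sub>v w + of_int (s x) \<cdot>\<^sub>v w = of_int (s x) \<cdot>\<^sub>v ?u"
      using w Tw sx by (simp add: smult_add_distrib_vec smult_smult_assoc comm_add_vec)
    finally have ux: "?T *\<^sub>v ?u = of_int (s x) \<cdot>\<^sub>v ?u" .
    have ui: "transpose_mat (A i) *\<^sub>v ?u = of_int (s i) \<cdot>\<^sub>v ?u" if i: "i \<in> F" for i
    proof -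
      let ?S = "transpose_mat (A i)"
      have Ai: "A i \<in> carrier_mat n n" using insert.prems i by auto
      then have S: "?S \<in> carrier_mat n n" by simp
      have "?S * ?T = ?T * ?S"
        using insert.prems(3)[of i x] i transpose_mult[OF Ai Ax(1)] transpose_mult[OF Ax(1) Ai] by simp
      then have "?S *\<^sub>v (?T *\<^sub>v w) = ?T *\<^sub>v (?S *\<^sub>v w)"
        using S T w by (metis assoc_mult_mat_vec)
      also have "\<dots> = of_int (s i) \<cdot>\<^sub>v (?T *\<^sub>v w)" using wF[OF i] w T by (simp add: mult_mat_vec)
      finally have *: "?S *\<^sub>v (?T *\<^sub>v w) = of_int (s i) \<cdot>\<^sub>v (?T *\<^sub>v w)" .
      have "?S *\<^sub>v ?u = ?S *\<^sub>v w + of_int (s x) \<cdot>\<^sub>v (?S *\<^sub>v (?T *\<^sub>v w))"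
        using S w Tw by (simp add: mult_add_distrib_mat_vec mult_mat_vec)
      then show ?thesis unfolding * wF[OF i] using w Tw
        by (simp add: smult_add_distrib_vec smult_smult_assoc mult.commute)
    qed
    show ?case using u unz ux ui by (intro exI[of _ ?u]) auto
  qed
  then obtain w where w: "w \<in> carrier_vec n" "w \<bullet> v \<noteq> 0"
      "\<And>i. i \<in> I \<Longrightarrow> transpose_mat (A i) *\<^sub>v w = of_int (s i) \<cdot>\<^sub>v w" by blast
  let ?w = "(1 / (w \<bullet> v)) \<cdot>\<^sub>v w"
  have "transpose_mat (A i) *\<^sub>v ?w = of_int (s i) \<cdot>\<^sub>v ?w" if i: "i \<in> I" for i
  proof -
    have "transpose_mat (A i) \<in> carrier_mat n n" using A[OF i] by simp
    from mult_mat_vec[OF this w(1)] show ?thesis by (simp add: w(3)[OF i] smult_smult_assoc mult.commute)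
  qed
  then show ?thesis using w(1,2) v by (intro exI[of _ ?w]) auto
qed

text \<open>A basis that consists of \<open>v\<close> and a basis of the kernel of \<open>w\<close>, together with its dual basis.\<close>

lemma complementary_basis:
  fixes v w :: "'k::field vec"
  assumes v: "v \<in> carrier_vec n" and w: "w \<in> carrier_vec n" and wv: "w \<bullet> v = 1"
  obtains P Q where "P \<in> carrier_mat n n" "Q \<in> carrier_mat n n" "P * Q = 1\<^sub>m n" "Q * P = 1\<^sub>m n"
    "col P 0 = v" "row Q 0 = w" "n > 0"
proof -
  have sum1: "(\<Sum>l\<in>{0..<n}. w $ l * v $ l) = 1" using wv v w by (simp add: scalar_prod_def)
  then obtain i where i: "i < n" "w $ i * v $ i \<noteq> 0"
    by (metis (no_types, lifting) atLeastLessThan_iff sum.neutral zero_neq_one)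
  then have wi: "w $ i \<noteq> 0" by auto
  have n: "n > 0" using i by simp
  (* The vectors e_l - (w_l / w_i) e_i with l different from i form a basis of the kernel of w.
     The transposition s of 0 and i makes room for v in column 0. *)
  define s where "s = (\<lambda>l::nat. if l = 0 then i else if l = i then 0 else l)"
  have s: "s l < n" if "l < n" for l using that i by (auto simp: s_def)
  have s_inj: "s a = s b \<longleftrightarrow> a = b" for a b by (auto simp: s_def)
  have s_ne: "s l \<noteq> i" if "l \<noteq> 0" for l using that by (auto simp: s_def)
  define p where "p = (\<lambda>a b. if b = 0 then v $ a
    else (if a = s b then 1 else 0) - (if a = i then w $ (s b) / w $ i else 0))"
  define q where "q = (\<lambda>a b. if a = 0 then w $ b else (if b = s a then 1 else 0) - v $ (s a) * w $ b)"
  define P where "P = mat n n (\<lambda>(a, b). p a b)"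
  define Q where "Q = mat n n (\<lambda>(a, b). q a b)"
  have PQ: "P \<in> carrier_mat n n" "Q \<in> carrier_mat n n" by (auto simp: P_def Q_def)
  have wp: "(\<Sum>l\<in>{0..<n}. w $ l * p l b) = (if b = 0 then 1 else 0)" if b: "b < n" for b
  proof (cases "b = 0")
    case False
    have "(\<Sum>l\<in>{0..<n}. w $ l * p l b)
      = (\<Sum>l\<in>{0..<n}. (if l = s b then w $ l else 0) - (if l = i then w $ l * (w $ (s b) / w $ i) else 0))"
      using False by (intro sum.cong) (auto simp: p_def algebra_simps)
    also have "\<dots> = w $ (s b) - w $ i * (w $ (s b) / w $ i)"
      using s[OF b] i by (simp add: sum_subtractf)
    finally show ?thesis using wi False by simp
  qed (use sum1 in \<open>simp add: p_def\<close>)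
  have "(Q * P) $$ (a, b) = (if a = b then 1 else 0)" if ab: "a < n" "b < n" for a b
  proof -
    have e: "(Q * P) $$ (a, b) = (\<Sum>l\<in>{0..<n}. q a l * p l b)"
      using ab by (simp add: P_def Q_def scalar_prod_def)
    show ?thesis
    proof (cases "a = 0")
      case True
      then show ?thesis unfolding e using wp[OF ab(2)] by (simp add: q_def)
    next
      case False
      have "(\<Sum>l\<in>{0..<n}. q a l * p l b)
        = (\<Sum>l\<in>{0..<n}. (if l = s a then p l b else 0) - v $ (s a) * (w $ l * p l b))"
        using False by (intro sum.cong) (auto simp: q_def algebra_simps)
      also have "\<dots> = p (s a) b - v $ (s a) * (if b = 0 then 1 else 0)"
        using s[OF ab(1)] wp[OF ab(2)] by (simp add: sum_subtractf sum_distrib_left[symmetric])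
      also have "\<dots> = (if a = b then 1 else 0)"
        using False s_ne[OF False] by (auto simp: p_def s_inj)
      finally show ?thesis unfolding e .
    qed
  qed
  then have QP: "Q * P = 1\<^sub>m n" using PQ by (intro eq_matI) auto
  have "P * Q = 1\<^sub>m n" by (rule mat_mult_left_right_inverse[OF PQ(2,1) QP])
  moreover have "col P 0 = v" "row Q 0 = w"
    using v w n by (auto simp: P_def Q_def p_def q_def intro!: eq_vecI)
  ultimately show ?thesis using that[OF PQ] QP n by blast
qed

definition sign_char :: "('g, 'm) monoid_scheme \<Rightarrow> ('g \<Rightarrow> int) \<Rightarrow> bool"
  where "sign_char G s \<longleftrightarrow> (\<forall>g\<in>carrier G. s g = 1 \<or> s g = -1) \<and>
    (\<forall>g\<in>carrier G. \<forall>h\<in>carrier G. s (g \<otimes>\<^bsub>G\<^esub> h) = s g * s h)"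

text \<open>Characters are integer-valued functions, so that the same list makes sense over every field.\<close>

definition diag_rep :: "('g \<Rightarrow> int) list \<Rightarrow> ('g, 'k::field) rep"
  where "diag_rep cs = (length cs, \<lambda>g. diag_of (map (\<lambda>c. of_int (c g)) cs))"

lemma dim_diag_rep [simp]: "rep_dim (diag_rep cs) = length cs"
  by (simp add: diag_rep_def rep_dim_def)

lemma sign_char_one:
  assumes "sign_char G s" "group G" shows "s \<one>\<^bsub>G\<^esub> = 1"
proof -
  interpret group G by fact
  have "s (\<one>\<^bsub>G\<^esub> \<otimes>\<^bsub>G\<^esub> \<one>\<^bsub>G\<^esub>) = s \<one>\<^bsub>G\<^esub> * s \<one>\<^bsub>G\<^esub>" "s \<one>\<^bsub>G\<^esub> = 1 \<or> s \<one>\<^bsub>G\<^esub> = -1"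
    using assms(1) unfolding sign_char_def by blast+
  then show ?thesis by auto
qed

lemma diag_of_mult: "length xs = length ys \<Longrightarrow> diag_of xs * diag_of ys = diag_of (map2 (*) xs ys)"
  by (rule eq_matI) (auto simp: diag_of_def scalar_prod_def if_distrib[of "\<lambda>x. x * _"] cong: if_cong)

lemma diag_rep_in:
  assumes "\<forall>c\<in>set cs. sign_char G c" "group G" shows "(diag_rep cs :: ('g, 'b::field) rep) \<in> reps G"
proof (rule repsI)
  fix g h assume gh: "g \<in> carrier G" "h \<in> carrier G"
  have "map (\<lambda>c. of_int (c (g \<otimes>\<^bsub>G\<^esub> h)) :: 'b) cs = map2 (*) (map (\<lambda>c. of_int (c g)) cs) (map (\<lambda>c. of_int (c h)) cs)"
  proof (rule nth_equalityI)
    fix i assume "i < length (map (\<lambda>c. of_int (c (g \<otimes>\<^bsub>G\<^esub> h)) :: 'b) cs)"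
    then have i: "i < length cs" by simp
    then have "(cs ! i) (g \<otimes>\<^bsub>G\<^esub> h) = (cs ! i) g * (cs ! i) h"
      using assms(1) gh nth_mem[OF i] by (auto simp: sign_char_def)
    then show "map (\<lambda>c. of_int (c (g \<otimes>\<^bsub>G\<^esub> h)) :: 'b) cs ! i =
      map2 (*) (map (\<lambda>c. of_int (c g)) cs) (map (\<lambda>c. of_int (c h)) cs) ! i"
      using i by simp
  qed simp
  then show "snd (diag_rep cs) (g \<otimes>\<^bsub>G\<^esub> h) = snd (diag_rep cs) g * (snd (diag_rep cs) h :: 'b mat)"
    by (simp add: diag_rep_def diag_of_mult)
next
  have "map (\<lambda>c. of_int (c \<one>\<^bsub>G\<^esub>) :: 'b) cs = replicate (length cs) 1"
    by (rule nth_equalityI) (simp_all add: sign_char_one[OF assms(1)[rule_format, OF nth_mem] assms(2)])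
  then show "snd (diag_rep cs) \<one>\<^bsub>G\<^esub> = (1\<^sub>m (rep_dim (diag_rep cs :: ('g, 'b) rep)) :: 'b mat)"
    unfolding dim_diag_rep by (simp add: diag_rep_def diag_of_ones)
qed (auto simp: diag_rep_def rep_dim_def)

text \<open>In a basis adapted to a common eigenvector and an invariant complement, every matrix of \<open>V\<close> is
  block diagonal with a first block of size one.\<close>

lemma split_off_char:
  fixes V :: "('g, 'k::field) rep"
  assumes G: "comm_group G" "finite (carrier G)" "\<And>g. g \<in> carrier G \<Longrightarrow> g \<otimes>\<^bsub>G\<^esub> g = \<one>\<^bsub>G\<^esub>"
    and two: "(2::'k) \<noteq> 0" and V: "V \<in> reps G" and d: "rep_dim V = Suc m"
  obtains s W where "sign_char G s" "W \<in> reps G" "rep_dim W = m" "rep_iso G V (dsum_rep (diag_rep [s]) W)"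
proof -
  interpret comm_group G by fact
  let ?n = "Suc m"
  have A: "snd V g \<in> carrier_mat ?n ?n" if "g \<in> carrier G" for g using repsD(1)[OF V that] d by simp
  have A1: "snd V g * snd V g = 1\<^sub>m ?n" if "g \<in> carrier G" for g
    using repsD(2)[OF V] repsD(3)[OF V that that] G(3)[OF that] d by simp
  have A2: "snd V g * snd V h = snd V h * snd V g" if "g \<in> carrier G" "h \<in> carrier G" for g h
    using repsD(3)[OF V that] repsD(3)[OF V that(2,1)] m_comm[OF that] by simp
  obtain v s where v: "v \<in> carrier_vec ?n" "v \<noteq> 0\<^sub>v ?n" and
    s: "\<And>g. g \<in> carrier G \<Longrightarrow> (s g = (1::int) \<or> s g = -1) \<and> snd V g *\<^sub>v v = of_int (s g) \<cdot>\<^sub>v v"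
    using common_eigenvector[OF G(2), of "snd V" ?n, OF A A1 A2] by blast
  obtain w where w: "w \<in> carrier_vec ?n" "w \<bullet> v = 1" and
    ws: "\<And>g. g \<in> carrier G \<Longrightarrow> transpose_mat (snd V g) *\<^sub>v w = of_int (s g) \<cdot>\<^sub>v w"
    using dual_eigenvector[OF G(2), of "snd V" ?n, OF A A1 A2 two v s] by blast
  obtain P Q where PQ: "P \<in> carrier_mat ?n ?n" "Q \<in> carrier_mat ?n ?n" "P * Q = 1\<^sub>m ?n" "Q * P = 1\<^sub>m ?n"
    "col P 0 = v" "row Q 0 = w"
    using complementary_basis[OF v(1) w] by metis
  define M where "M = (\<lambda>g. Q * (snd V g * P))"
  have M: "M g \<in> carrier_mat ?n ?n" if "g \<in> carrier G" for g using A[OF that] PQ by (simp add: M_def)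
  have MM: "M (g \<otimes>\<^bsub>G\<^esub> h) = M g * M h" if gh: "g \<in> carrier G" "h \<in> carrier G" for g h
  proof -
    have "M g * M h = Q * (snd V g * ((P * Q) * (snd V h * P)))"
      using A[OF gh(1)] A[OF gh(2)] PQ(1,2) unfolding M_def
      by (simp add: assoc_mult_mat[of _ ?n ?n _ ?n _ ?n])
    then show ?thesis using A[OF gh(1)] A[OF gh(2)] PQ(1,2) PQ(3) repsD(3)[OF V gh] unfolding M_def
      by (simp add: assoc_mult_mat[of _ ?n ?n _ ?n _ ?n])
  qed
  (* The first column of M g comes from the eigenvector v, its first row from the eigenform w. *)
  have colM: "col (M g) 0 = of_int (s g) \<cdot>\<^sub>v unit_vec ?n 0" if g: "g \<in> carrier G" for g
  proof -
    have "col (M g) 0 = Q *\<^sub>v (snd V g *\<^sub>v col P 0)"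
      using A[OF g] PQ(1,2) unfolding M_def by (subst col_mult2[where n="?n" and nr="?n" and nc="?n"], auto)+
    also have "\<dots> = of_int (s g) \<cdot>\<^sub>v (Q *\<^sub>v col P 0)" using s[OF g] PQ v by (simp add: mult_mat_vec)
    also have "Q *\<^sub>v col P 0 = col (Q * P) 0" using PQ(1,2) by (subst col_mult2[where n="?n" and nr="?n" and nc="?n"]) auto
    finally show ?thesis using PQ by simp
  qed
  have rowM: "row (M g) 0 = of_int (s g) \<cdot>\<^sub>v unit_vec ?n 0" if g: "g \<in> carrier G" for g
  proof -
    let ?t = transpose_mat
    have t: "?t P \<in> carrier_mat ?n ?n" "?t Q \<in> carrier_mat ?n ?n" "?t (snd V g) \<in> carrier_mat ?n ?n"
      using PQ A[OF g] by auto
    have "?t (M g) = ?t P * (?t (snd V g) * ?t Q)"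
      unfolding M_def using A[OF g] PQ t
      by (simp add: transpose_mult[of _ ?n ?n _ ?n] assoc_mult_mat[of _ ?n ?n _ ?n _ ?n])
    then have "row (M g) 0 = col (?t P * (?t (snd V g) * ?t Q)) 0" using M[OF g] by (metis Matrix.col_transpose carrier_matD(1) zero_less_Suc)
    also have "\<dots> = ?t P *\<^sub>v (?t (snd V g) *\<^sub>v col (?t Q) 0)"
      using t by (subst col_mult2[where n="?n" and nr="?n" and nc="?n"], auto)+
    also have "\<dots> = of_int (s g) \<cdot>\<^sub>v (?t P *\<^sub>v col (?t Q) 0)" using ws[OF g] PQ w t by (simp add: mult_mat_vec)
    also have "?t P *\<^sub>v col (?t Q) 0 = col (?t P * ?t Q) 0" using t by (subst col_mult2[where n="?n" and nr="?n" and nc="?n"]) auto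
    also have "?t P * ?t Q = 1\<^sub>m ?n" using transpose_mult[OF PQ(2,1)] PQ(4) by simp
    finally show ?thesis by simp
  qed
  define N where "N = (\<lambda>g. mat m m (\<lambda>(a, b). M g $$ (Suc a, Suc b)))"
  have blk: "four_block_mat (diag_of [of_int (s g)]) (0\<^sub>m 1 m) (0\<^sub>m m 1) (N g) = M g" if g: "g \<in> carrier G" for g
  proof (rule eq_matI)
    fix a b assume "a < dim_row (M g)" "b < dim_col (M g)"
    then have ab: "a < ?n" "b < ?n" using M[OF g] by auto
    have c: "M g $$ (a, 0) = (if a = 0 then of_int (s g) else 0)"
      using arg_cong[OF colM[OF g], of "\<lambda>x. x $ a"] M[OF g] ab by auto
    have r: "M g $$ (0, b) = (if b = 0 then of_int (s g) else 0)"
      using arg_cong[OF rowM[OF g], of "\<lambda>x. x $ b"] M[OF g] ab by auto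
    show "four_block_mat (diag_of [of_int (s g)]) (0\<^sub>m 1 m) (0\<^sub>m m 1) (N g) $$ (a, b) = M g $$ (a, b)"
      using ab c r by (cases a; cases b) (auto simp: diag_of_def N_def)
  qed (use M[OF g] in \<open>auto simp: diag_of_def N_def\<close>)
  have Nc: "N g \<in> carrier_mat m m" for g by (simp add: N_def)
  have NN: "N (g \<otimes>\<^bsub>G\<^esub> h) = N g * N h" if gh: "g \<in> carrier G" "h \<in> carrier G" for g h
  proof (rule eq_matI)
    fix a b assume "a < dim_row (N g * N h)" "b < dim_col (N g * N h)"
    then have ab: "a < m" "b < m" using Nc[of g] Nc[of h] by auto
    have "M g $$ (Suc a, 0) = 0"
      using arg_cong[OF colM[OF gh(1)], of "\<lambda>x. x $ Suc a"] M[OF gh(1)] ab by auto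
    moreover have "N (g \<otimes>\<^bsub>G\<^esub> h) $$ (a, b) = (\<Sum>l\<in>{0..<Suc m}. M g $$ (Suc a, l) * M h $$ (l, Suc b))"
      using ab M[OF gh(1)] M[OF gh(2)] by (simp add: N_def MM[OF gh] scalar_prod_def del: sum.op_ivl_Suc)
    ultimately show "N (g \<otimes>\<^bsub>G\<^esub> h) $$ (a, b) = (N g * N h) $$ (a, b)"
      using ab by (simp add: N_def scalar_prod_def sum.atLeast0_lessThan_Suc_shift del: sum.op_ivl_Suc)
  qed (auto simp: N_def)
  have sc: "sign_char G s"
  proof -
    have "s (g \<otimes>\<^bsub>G\<^esub> h) = s g * s h" if gh: "g \<in> carrier G" "h \<in> carrier G" for g h
    proof -
      have "M x $$ (0, b) = (if b = 0 then of_int (s x) else 0)" if "x \<in> carrier G" "b < ?n" for x b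
        using arg_cong[OF rowM[OF that(1)], of "\<lambda>x. x $ b"] M[OF that(1)] that by auto
      note r = this
      have "of_int (s (g \<otimes>\<^bsub>G\<^esub> h)) = (M g * M h) $$ (0, 0)" using r[of "g \<otimes>\<^bsub>G\<^esub> h" 0] MM[OF gh] gh by simp
      also have "\<dots> = (\<Sum>l\<in>{0..<Suc m}. M g $$ (0, l) * M h $$ (l, 0))"
        using M[OF gh(1)] M[OF gh(2)] by (simp add: scalar_prod_def del: sum.op_ivl_Suc)
      also have "\<dots> = of_int (s g) * of_int (s h)"
        using r[OF gh(1)] r[OF gh(2), of 0] by (simp add: sum.atLeast0_lessThan_Suc_shift del: sum.op_ivl_Suc)
      finally have e: "of_int (s (g \<otimes>\<^bsub>G\<^esub> h)) = (of_int (s g * s h) :: 'k)" by simp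
      have "(1::'k) \<noteq> -1" using two by (metis add.inverse_inverse add_neg_numeral_special(8) one_add_one)
      moreover have "s (g \<otimes>\<^bsub>G\<^esub> h) \<in> {1, -1}" "s g \<in> {1, -1}" "s h \<in> {1, -1}" using s gh by auto
      ultimately show ?thesis using e by auto
    qed
    then show ?thesis using s by (auto simp: sign_char_def)
  qed
  define W :: "('g, 'k) rep" where "W = (m, N)"
  have W: "W \<in> reps G"
  proof (rule repsI)
    have "M \<one>\<^bsub>G\<^esub> = 1\<^sub>m ?n" using repsD(2)[OF V] d PQ by (simp add: M_def)
    then show "snd W \<one>\<^bsub>G\<^esub> = 1\<^sub>m (rep_dim W)" by (auto simp: W_def rep_dim_def N_def intro!: eq_matI)
  qed (auto simp: W_def rep_dim_def Nc NN)
  have "rep_iso G V (dsum_rep (diag_rep [s]) W)"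
  proof (rule rep_isoI[OF d _ PQ(2,1) PQ(4,3)])
    fix g assume g: "g \<in> carrier G"
    have "snd (dsum_rep (diag_rep [s]) W) g = M g"
      using blk[OF g] by (simp add: dsum_rep_def diag_rep_def W_def rep_dim_def)
    moreover have "M g * Q = Q * snd V g * (P * Q)"
      using A[OF g] PQ(1,2) unfolding M_def by (simp add: assoc_mult_mat[of _ ?n ?n _ ?n _ ?n])
    ultimately show "Q * snd V g = snd (dsum_rep (diag_rep [s]) W) g * Q"
      using PQ A[OF g] by simp
  qed (simp add: W_def, simp add: rep_dim_def)
  then show ?thesis using that[OF sc W] by (simp add: W_def rep_dim_def)
qed

lemma dsum_diag_rep: "dsum_rep (diag_rep xs) (diag_rep ys) = diag_rep (xs @ ys)"
  using diag_of_append[of "map (\<lambda>c. of_int (c _)) xs" "map (\<lambda>c. of_int (c _)) ys"]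
  by (auto simp: dsum_rep_def diag_rep_def rep_dim_def)

text \<open>Splitting off one character after the other.\<close>

theorem reps_diagonalizable:
  fixes V :: "('g, 'k::field) rep"
  assumes G: "comm_group G" "finite (carrier G)" "\<And>g. g \<in> carrier G \<Longrightarrow> g \<otimes>\<^bsub>G\<^esub> g = \<one>\<^bsub>G\<^esub>"
    and two: "(2::'k) \<noteq> 0" and V: "V \<in> reps G"
  shows "\<exists>cs. (\<forall>c\<in>set cs. sign_char G c) \<and> length cs = rep_dim V \<and> rep_iso G V (diag_rep cs)"
  using V
proof (induction "rep_dim V" arbitrary: V)
  case 0
  have "rep_iso G V (diag_rep [])"
    by (rule rep_isoI[of _ 0 _ "1\<^sub>m 0" "1\<^sub>m 0"])
      (use 0(1) repsD(1)[OF 0(2)] repsD(1)[OF 0(2), THEN carrier_matD(2)] in \<open>auto simp: diag_rep_def diag_of_def rep_dim_def intro!: eq_matI\<close>)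
  then show ?case using 0 by (intro exI[of _ "[]"]) auto
next
  case (Suc m)
  have grp: "group G" using G(1) by (simp add: comm_group_def)
  obtain s W where sW: "sign_char G s" "W \<in> reps G" "rep_dim W = m" "rep_iso G V (dsum_rep (diag_rep [s]) W)"
    using split_off_char[OF G two Suc.prems Suc.hyps(2)[symmetric]] by blast
  obtain cs where cs: "\<forall>c\<in>set cs. sign_char G c" "length cs = m" "rep_iso G W (diag_rep cs)"
    using Suc.hyps(1)[OF sW(3)[symmetric] sW(2)] sW(3) by auto
  have s1: "(diag_rep [s] :: ('g, 'k) rep) \<in> reps G" and c1: "(diag_rep cs :: ('g, 'k) rep) \<in> reps G" using sW(1) cs(1) grp by (auto intro!: diag_rep_in)
  have "rep_iso G (dsum_rep (diag_rep [s]) W) (dsum_rep (diag_rep [s]) (diag_rep cs))"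
    by (rule dsum_rep_cong[OF rep_iso_refl[OF s1] cs(3) s1 s1 sW(2) c1])
  then have "rep_iso G V (dsum_rep (diag_rep [s]) (diag_rep cs))"
    using rep_iso_trans[OF sW(4)] s1 c1 sW(2) Suc.prems by simp
  then have "rep_iso G V (diag_rep (s # cs))" by (simp add: dsum_diag_rep)
  then show ?case using sW(1) cs Suc.hyps(2) by (intro exI[of _ "s # cs"]) auto
qed

section \<open>Elements and characters of the elementary abelian 2-group\<close>

definition elt :: "nat \<Rightarrow> nat set \<Rightarrow> nat \<Rightarrow> int"
  where "elt r T = (\<lambda>i\<in>{1..r}. if i \<in> T then 1 else 0)"

lemma carrier_elem_ab_2: "carrier (elem_ab_2_group r) = elt r ` Pow {1..r}"
proof
  show "elt r ` Pow {1..r} \<subseteq> carrier (elem_ab_2_group r)"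
    by (auto simp: elem_ab_2_group_def elt_def carrier_integer_mod_group)
  show "carrier (elem_ab_2_group r) \<subseteq> elt r ` Pow {1..r}"
  proof
    fix g assume g: "g \<in> carrier (elem_ab_2_group r)"
    have gi: "g i = 0 \<or> g i = 1" if "i \<in> {1..r}" for i
    proof -
      have "g i \<in> {0..<2}" using g that by (auto simp: elem_ab_2_group_def carrier_integer_mod_group PiE_iff)
      then show ?thesis by auto
    qed
    have "g i = undefined" if "i \<notin> {1..r}" for i
      using g that by (auto simp: elem_ab_2_group_def PiE_iff extensional_def)
    then have "g = elt r {i \<in> {1..r}. g i = 1}"
      using gi by (fastforce simp: elt_def fun_eq_iff)
    then show "g \<in> elt r ` Pow {1..r}" by blast
  qed
qed

lemma elt_in [simp]: "elt r T \<in> carrier (elem_ab_2_group r)"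
proof -
  have "elt r T = elt r (T \<inter> {1..r})" by (auto simp: elt_def fun_eq_iff)
  then show ?thesis by (auto simp: carrier_elem_ab_2)
qed

lemma elt_mult: "elt r T \<otimes>\<^bsub>elem_ab_2_group r\<^esub> elt r U = elt r (T - U \<union> (U - T))"
  by (auto simp: elem_ab_2_group_def elt_def fun_eq_iff)

lemma elt_one: "\<one>\<^bsub>elem_ab_2_group r\<^esub> = elt r {}"
  by (auto simp: elem_ab_2_group_def elt_def fun_eq_iff)

lemma comm_group_elem_ab_2: "comm_group (elem_ab_2_group r)"
proof -
  have "group (elem_ab_2_group r)" unfolding elem_ab_2_group_def by simp
  then show ?thesis
    by (rule group.group_comm_groupI) (auto simp: carrier_elem_ab_2 elt_mult Un_commute)
qed

lemma finite_elem_ab_2: "finite (carrier (elem_ab_2_group r))"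
  by (simp add: carrier_elem_ab_2)

lemma square_elem_ab_2: "g \<in> carrier (elem_ab_2_group r) \<Longrightarrow> g \<otimes>\<^bsub>elem_ab_2_group r\<^esub> g = \<one>\<^bsub>elem_ab_2_group r\<^esub>"
  by (auto simp: carrier_elem_ab_2 elt_mult elt_one)

text \<open>The value at the element of \<open>T\<close> of the character of \<open>S\<close>; the pairing is symmetric in \<open>S\<close> and \<open>T\<close>.\<close>

definition subset_char :: "nat set \<Rightarrow> nat set \<Rightarrow> int"
  where "subset_char S T = (-1) ^ card (S \<inter> T)"

lemma subset_char_cases: "subset_char S T = 1 \<or> subset_char S T = -1"
  by (cases "even (card (S \<inter> T))") (auto simp: subset_char_def)

lemma subset_char_prod: "finite S \<Longrightarrow> subset_char S T = (\<Prod>i\<in>S. if i \<in> T then -1 else 1)"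
  by (simp add: subset_char_def prod.If_cases)

lemma subset_char_sym: "subset_char S T = subset_char T S"
  by (simp add: subset_char_def Int_commute)

lemma subset_char_prod': "finite T \<Longrightarrow> subset_char S T = (\<Prod>i\<in>T. if i \<in> S then -1 else 1)"
  by (subst subset_char_sym) (rule subset_char_prod)

lemma sum_prod_Pow:
  fixes f :: "'b \<Rightarrow> 'a::comm_semiring_1"
  shows "finite A \<Longrightarrow> (\<Prod>i\<in>A. 1 + f i) = (\<Sum>Y\<in>Pow A. \<Prod>i\<in>Y. f i)"
  using prod_add[of A f "\<lambda>_. 1"] by (simp add: add.commute)

text \<open>Both factors are products over the elements of \<open>T\<close>, so the sum over \<open>T\<close> is the product over \<open>A\<close> of
  the factors \<open>1 \<plusminus> 1\<close>, one of which is zero when \<open>S \<noteq> U\<close>.\<close>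

lemma subset_char_orthogonal:
  assumes A: "finite A" and S: "S \<subseteq> A" "U \<subseteq> A"
  shows "(\<Sum>T\<in>Pow A. subset_char S T * subset_char U T) = (if S = U then 2 ^ card A else 0)"
proof -
  let ?f = "\<lambda>i. (if i \<in> S then -1 else 1) * (if i \<in> U then -1 else (1::int))"
  have "(\<Sum>T\<in>Pow A. subset_char S T * subset_char U T) = (\<Sum>T\<in>Pow A. \<Prod>i\<in>T. ?f i)"
  proof (rule sum.cong[OF refl])
    fix T assume "T \<in> Pow A"
    then have "finite T" using A finite_subset by blast
    then show "subset_char S T * subset_char U T = (\<Prod>i\<in>T. ?f i)" by (simp only: subset_char_prod' prod.distrib)
  qed
  also have "\<dots> = (\<Prod>i\<in>A. 1 + ?f i)" by (simp only: sum_prod_Pow[OF A])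
  also have "\<dots> = (if S = U then 2 ^ card A else 0)"
  proof (cases "S = U")
    case True
    then have "(\<Prod>i\<in>A. 1 + ?f i) = (\<Prod>i\<in>A. 2)" by (intro prod.cong) auto
    then show ?thesis using True by simp
  next
    case False
    then obtain a where "a \<in> A" "(a \<in> S) \<noteq> (a \<in> U)" using S by blast
    then show ?thesis using False A by (auto intro!: prod_zero bexI[of _ a])
  qed
  finally show ?thesis .
qed

definition group_char :: "nat \<Rightarrow> nat set \<Rightarrow> (nat \<Rightarrow> int) \<Rightarrow> int"
  where "group_char r S g = subset_char S {i \<in> {1..r}. g i = 1}"

lemma group_char_elt [simp]: "S \<subseteq> {1..r} \<Longrightarrow> group_char r S (elt r T) = subset_char S T"
  unfolding group_char_def subset_char_def elt_def by (rule arg_cong[where f="\<lambda>x. (-1) ^ card x"]) auto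

lemma subset_char_symdiff: 
  assumes "finite S" shows "subset_char S (T - U \<union> (U - T)) = subset_char S T * subset_char S U"
  unfolding subset_char_prod[OF assms] prod.distrib[symmetric] by (rule prod.cong) auto

lemma sign_char_group_char: assumes S: "S \<subseteq> {1..r}" shows "sign_char (elem_ab_2_group r) (group_char r S)"
proof -
  have "finite S" using S finite_subset by blast
  then show ?thesis
    using S subset_char_cases by (auto simp: sign_char_def carrier_elem_ab_2 elt_mult subset_char_symdiff)
qed

text \<open>A sign character is determined by the set of coordinates on whose generator it is \<open>-1\<close>.\<close>

lemma sign_char_is_group_char:
  assumes s: "sign_char (elem_ab_2_group r) s"
  shows "\<exists>S\<subseteq>{1..r}. \<forall>g\<in>carrier (elem_ab_2_group r). s g = group_char r S g"
proof -
  let ?G = "elem_ab_2_group r"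
  interpret comm_group ?G by (rule comm_group_elem_ab_2)
  define S where "S = {i \<in> {1..r}. s (elt r {i}) = -1}"
  have S: "S \<subseteq> {1..r}" by (auto simp: S_def)
  have "s (elt r T) = subset_char S T" if "finite T" "T \<subseteq> {1..r}" for T
    using that
  proof (induction T)
    case empty
    show ?case using sign_char_one[OF s is_group] by (simp add: elt_one subset_char_def)
  next
    case (insert x F)
    have "elt r (insert x F) = elt r {x} \<otimes>\<^bsub>?G\<^esub> elt r F"
      using insert by (auto simp: elt_mult intro!: arg_cong[where f="elt r"])
    then have "s (elt r (insert x F)) = s (elt r {x}) * s (elt r F)" using s by (simp add: sign_char_def)
    moreover have "s (elt r {x}) = (if x \<in> S then -1 else 1)"
      using s insert.prems unfolding S_def sign_char_def by (metis (mono_tags, lifting) elt_in insert_subset mem_Collect_eq)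
    ultimately show ?case using insert by (simp add: subset_char_prod')
  qed
  then have "\<forall>g\<in>carrier ?G. s g = group_char r S g"
    using S by (auto simp: carrier_elem_ab_2 finite_subset[OF _ finite_atLeastAtMost])
  then show ?thesis using S by blast
qed

definition char_sum :: "nat \<Rightarrow> nat set list \<Rightarrow> (nat \<Rightarrow> int, 'k::field) rep"
  where "char_sum r Ss = diag_rep (map (group_char r) Ss)"

lemma dim_char_sum [simp]: "rep_dim (char_sum r Ss) = length Ss" by (simp add: char_sum_def)

lemma char_sum_in: "\<forall>S\<in>set Ss. S \<subseteq> {1..r} \<Longrightarrow> (char_sum r Ss :: (nat \<Rightarrow> int, 'k::field) rep) \<in> reps (elem_ab_2_group r)"
  unfolding char_sum_def by (rule diag_rep_in) (use sign_char_group_char comm_group_elem_ab_2 in \<open>auto simp: comm_group_def\<close>)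

lemma ex_char_sum:
  assumes two: "(2::'k::field) \<noteq> 0" and V: "(V :: (nat \<Rightarrow> int, 'k) rep) \<in> reps (elem_ab_2_group r)"
  shows "\<exists>Ss. (\<forall>S\<in>set Ss. S \<subseteq> {1..r}) \<and> rep_iso (elem_ab_2_group r) V (char_sum r Ss)"
proof -
  let ?G = "elem_ab_2_group r"
  obtain cs where cs: "\<forall>c\<in>set cs. sign_char ?G c" "length cs = rep_dim V" "rep_iso ?G V (diag_rep cs)"
    using reps_diagonalizable[OF comm_group_elem_ab_2 finite_elem_ab_2 square_elem_ab_2 two V] by blast
  have "\<forall>c\<in>set cs. \<exists>S\<subseteq>{1..r}. \<forall>g\<in>carrier ?G. c g = group_char r S g" using cs(1) sign_char_is_group_char by blast
  then obtain f where f: "\<And>c. c \<in> set cs \<Longrightarrow> f c \<subseteq> {1..r}" "\<And>c g. c \<in> set cs \<Longrightarrow> g \<in> carrier ?G \<Longrightarrow> c g = group_char r (f c) g"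
    by metis
  have eq: "snd (diag_rep cs :: (nat \<Rightarrow> int, 'k) rep) g = snd (char_sum r (map f cs)) g" if g: "g \<in> carrier ?G" for g
  proof -
    have "map (\<lambda>c. of_int (c g) :: 'k) cs = map (\<lambda>c. of_int (group_char r (f c) g)) cs"
      using f(2)[OF _ g] by (intro map_cong) auto
    then show ?thesis by (simp add: char_sum_def diag_rep_def comp_def del: map_eq_conv)
  qed
  from cs(3) have "rep_iso ?G V (char_sum r (map f cs))"
    using eq cs(2) by (simp add: rep_iso_def)
  then show ?thesis using f(1) by (intro exI[of _ "map f cs"]) auto
qed

lemma perm_diag_rep_iso:
  assumes "mset cs = mset ds"
  shows "rep_iso G (diag_rep cs :: ('g, 'k::field) rep) (diag_rep ds)"
proof -
  let ?n = "length ds"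
  have len: "length cs = ?n" using assms mset_eq_length by blast
  obtain p where p: "p permutes {..<length ds}" and pl: "permute_list p ds = cs"
    using mset_eq_permutation[OF assms] by blast
  have plt: "p i < ?n \<longleftrightarrow> i < ?n" for i using permutes_in_image[OF p, of i] by simp
  have cd: "cs ! i = ds ! (p i)" if "i < ?n" for i
    using permute_list_nth[OF p that] pl by simp
  have inj: "p i = p j \<longleftrightarrow> i = j" for i j using permutes_inj[OF p] by (simp add: inj_eq)
  define P :: "'k mat" where "P = mat ?n ?n (\<lambda>(a, b). if a = p b then 1 else 0)"
  define Q :: "'k mat" where "Q = mat ?n ?n (\<lambda>(a, b). if b = p a then 1 else 0)"
  have PQc: "P \<in> carrier_mat ?n ?n" "Q \<in> carrier_mat ?n ?n" by (auto simp: P_def Q_def)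
  have QP: "Q * P = 1\<^sub>m ?n"
    by (rule eq_matI) (auto simp: P_def Q_def scalar_prod_def plt inj if_distrib[of "\<lambda>x. x * _"] cong: if_cong)
  show ?thesis
  proof (rule rep_isoI[OF _ _ PQc mat_mult_left_right_inverse[OF PQc(2,1) QP] QP])
    fix g assume "g \<in> carrier G"
    show "P * snd (diag_rep cs) g = snd (diag_rep ds) g * P"
    proof (rule eq_matI)
      fix a b assume "a < dim_row (snd (diag_rep ds) g * P)" "b < dim_col (snd (diag_rep ds) g * P)"
      then have ab: "a < ?n" "b < ?n" by (auto simp: diag_rep_def diag_of_def P_def)
      have "(P * snd (diag_rep cs) g) $$ (a, b)
        = (\<Sum>l\<in>{0..<?n}. (if a = p l then 1 else 0) * (if l = b then of_int ((cs ! l) g) else 0))"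
        using ab len by (auto simp: P_def diag_rep_def diag_of_def scalar_prod_def intro!: sum.cong)
      also have "\<dots> = (\<Sum>l\<in>{0..<?n}. if l = b then (if a = p b then of_int ((cs ! b) g) else 0) else 0)"
        by (rule sum.cong) auto
      finally have 1: "(P * snd (diag_rep cs) g) $$ (a, b) = (if a = p b then of_int ((cs ! b) g) else 0)"
        using ab by simp
      have "(snd (diag_rep ds) g * P) $$ (a, b)
        = (\<Sum>l\<in>{0..<?n}. (if a = l then of_int ((ds ! a) g) else 0) * (if l = p b then 1 else 0))"
        using ab len by (auto simp: P_def diag_rep_def diag_of_def scalar_prod_def intro!: sum.cong)
      also have "\<dots> = (\<Sum>l\<in>{0..<?n}. if l = a then (if a = p b then of_int ((ds ! a) g) else 0) else 0)"
        by (rule sum.cong) auto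
      finally have 2: "(snd (diag_rep ds) g * P) $$ (a, b) = (if a = p b then of_int ((ds ! a) g) else 0)"
        using ab by simp
      show "(P * snd (diag_rep cs) g) $$ (a, b) = (snd (diag_rep ds) g * P) $$ (a, b)"
        unfolding 1 2 using ab cd by simp
    qed (auto simp: diag_rep_def diag_of_def P_def len)
  qed (simp_all add: len)
qed

section \<open>The integer-valued character of a representation\<close>

text \<open>Read off from the characteristic polynomial, which is visibly invariant under isomorphism. In positive
  characteristic the trace determines this multiplicity only modulo the characteristic.\<close>

definition neg_mult :: "nat \<Rightarrow> (nat \<Rightarrow> int, 'k::field) rep \<Rightarrow> nat set \<Rightarrow> nat"
  where "neg_mult r V T = order (-1) (char_poly (snd V (elt r T)))"

text \<open>The Brauer character: the trace of the diagonal matrix with the same eigenvalues \<open>\<plusminus>1\<close>, taken in \<open>\<int>\<close>.\<close>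

definition brauer_char :: "nat \<Rightarrow> (nat \<Rightarrow> int, 'k::field) rep \<Rightarrow> nat set \<Rightarrow> int"
  where "brauer_char r V T = int (rep_dim V) - 2 * int (neg_mult r V T)"

lemma neg_mult_iso:
  assumes "rep_iso (elem_ab_2_group r) V W" "V \<in> reps (elem_ab_2_group r)" "W \<in> reps (elem_ab_2_group r)"
  shows "neg_mult r V T = neg_mult r W T"
  using assms(1)
proof (rule rep_isoE)
  fix n P Q assume *: "rep_dim V = n" "rep_dim W = n" "P \<in> carrier_mat n n" "Q \<in> carrier_mat n n"
    "P * Q = 1\<^sub>m n" "Q * P = 1\<^sub>m n" "\<And>g. g \<in> carrier (elem_ab_2_group r) \<Longrightarrow> P * snd V g = snd W g * P"
  let ?g = "elt r T"
  have c: "snd V ?g \<in> carrier_mat n n" "snd W ?g \<in> carrier_mat n n"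
    using repsD(1)[OF assms(2) elt_in] repsD(1)[OF assms(3) elt_in] * by auto
  have "snd W ?g = snd W ?g * (P * Q)" using c(2) *(5) by simp
  also have "\<dots> = snd W ?g * P * Q" using c *(3,4) by (simp add: assoc_mult_mat[of _ n n _ n _ n])
  also have "\<dots> = P * snd V ?g * Q" unfolding *(7)[OF elt_in] ..
  finally have "similar_mat (snd W ?g) (snd V ?g)"
    using c *(3-6) by (intro similar_matI[of _ _ P Q n]) auto
  then show ?thesis unfolding neg_mult_def using char_poly_similar by metis
qed

lemma brauer_char_iso:
  assumes "rep_iso (elem_ab_2_group r) V W" "V \<in> reps (elem_ab_2_group r)" "W \<in> reps (elem_ab_2_group r)"
  shows "brauer_char r V T = brauer_char r W T" "rep_dim V = rep_dim W"
  using neg_mult_iso[OF assms] assms(1) by (auto simp: brauer_char_def rep_iso_def)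

lemma char_poly_diag_of: "char_poly (diag_of ds) = (\<Prod>d\<leftarrow>ds. [:- d, 1:])"
proof -
  have "diag_of ds \<in> carrier_mat (length ds) (length ds)" by simp
  moreover have "upper_triangular (diag_of ds)" by (auto simp: diag_of_def upper_triangular_def)
  ultimately have "char_poly (diag_of ds) = (\<Prod>a\<leftarrow>diag_mat (diag_of ds). [:- a, 1:])"
    by (rule char_poly_upper_triangular)
  moreover have "diag_mat (diag_of ds) = ds" by (rule nth_equalityI) (auto simp: diag_mat_def diag_of_def)
  ultimately show ?thesis by simp
qed

lemma order_prod_linear:
  "order a (\<Prod>d\<leftarrow>ds. [:- d, 1:]) = length (filter (\<lambda>d. d = a) (ds :: 'k::field list))"
proof (induction ds)
  case (Cons d ds)
  have "(\<Prod>d\<leftarrow>ds. [:- d, 1:]) \<noteq> 0" by (auto simp: prod_list_zero_iff)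
  moreover have "order a [:- d, 1:] = (if d = a then 1 else 0)"
    using order_power_n_n[of a 1] by (auto intro!: order_0I)
  ultimately show ?case using Cons by (simp add: order_mult del: mult_pCons_left)
qed (simp add: order_0I)

lemma neg_mult_diag_rep:
  assumes two: "(2::'k::field) \<noteq> 0" and c: "\<forall>c\<in>set cs. c (elt r T) = 1 \<or> c (elt r T) = -1"
  shows "neg_mult r (diag_rep cs :: (nat \<Rightarrow> int, 'k) rep) T = length (filter (\<lambda>c. c (elt r T) = -1) cs)"
proof -
  have one: "(1::'k) \<noteq> -1" using two by (metis add.inverse_inverse add_neg_numeral_special(8) one_add_one)
  have "neg_mult r (diag_rep cs :: (nat \<Rightarrow> int, 'k) rep) T
    = length (filter (\<lambda>c. (of_int (c (elt r T)) :: 'k) = -1) cs)"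
    using order_prod_linear[of "-1" "map (\<lambda>c. of_int (c (elt r T)) :: 'k) cs"]
    by (simp add: neg_mult_def diag_rep_def char_poly_diag_of filter_map comp_def)
  also have "filter (\<lambda>c. (of_int (c (elt r T)) :: 'k) = -1) cs = filter (\<lambda>c. c (elt r T) = -1) cs"
    using c one by (intro filter_cong refl) (metis of_int_1 of_int_minus)
  finally show ?thesis .
qed

lemma sum_list_signs:
  "\<forall>c\<in>set cs. f c = (1::int) \<or> f c = -1 \<Longrightarrow> (\<Sum>c\<leftarrow>cs. f c) = int (length cs) - 2 * int (length (filter (\<lambda>c. f c = -1) cs))"
proof (induction cs)
  case (Cons a cs)
  have "f a = 1 \<or> f a = -1" using Cons.prems by simp
  then show ?case using Cons.IH Cons.prems by auto
qed simp

lemma brauer_char_diag_rep: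
  assumes two: "(2::'k::field) \<noteq> 0" and c: "\<forall>c\<in>set cs. c (elt r T) = 1 \<or> c (elt r T) = -1"
  shows "brauer_char r (diag_rep cs :: (nat \<Rightarrow> int, 'k) rep) T = (\<Sum>c\<leftarrow>cs. c (elt r T))"
  using sum_list_signs[of cs "\<lambda>c. c (elt r T)", OF c] neg_mult_diag_rep[where cs=cs and T=T and r=r, OF two c] by (simp add: brauer_char_def)

lemma group_char_list: "\<forall>S\<in>set Ss. S \<subseteq> {1..r} \<Longrightarrow> \<forall>c\<in>set (map (group_char r) Ss). c (elt r T) = 1 \<or> c (elt r T) = -1"
proof
  fix c assume "\<forall>S\<in>set Ss. S \<subseteq> {1..r}" "c \<in> set (map (group_char r) Ss)"
  then obtain S where "S \<subseteq> {1..r}" "c = group_char r S" by auto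
  then show "c (elt r T) = 1 \<or> c (elt r T) = -1" using subset_char_cases[of S T] by simp
qed

lemma brauer_char_char_sum:
  assumes two: "(2::'k::field) \<noteq> 0" and S: "\<forall>S\<in>set Ss. S \<subseteq> {1..r}"
  shows "brauer_char r (char_sum r Ss :: (nat \<Rightarrow> int, 'k) rep) T = (\<Sum>S\<leftarrow>Ss. subset_char S T)"
proof -
  have "brauer_char r (char_sum r Ss :: (nat \<Rightarrow> int, 'k) rep) T = (\<Sum>c\<leftarrow>map (group_char r) Ss. c (elt r T))"
    unfolding char_sum_def by (rule brauer_char_diag_rep[where cs="map (group_char r) Ss" and T=T and r=r, OF two group_char_list[OF S]])
  also have "\<dots> = (\<Sum>S\<leftarrow>Ss. subset_char S T)" using S by (induction Ss) auto
  finally show ?thesis .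
qed

text \<open>The multiplicity of a character in a sum of characters, by orthogonality.\<close>

lemma sum_list_count:
  assumes A: "finite A" and S: "\<forall>S\<in>set Ss. S \<subseteq> A" and U: "U \<subseteq> A"
  shows "(\<Sum>T\<in>Pow A. subset_char U T * (\<Sum>S\<leftarrow>Ss. subset_char S T)) = 2 ^ card A * int (count (mset Ss) U)"
  using S
proof (induction Ss)
  case (Cons S Ss)
  have "(\<Sum>T\<in>Pow A. subset_char U T * (\<Sum>S\<leftarrow>S # Ss. subset_char S T))
      = (\<Sum>T\<in>Pow A. subset_char U T * subset_char S T) + (\<Sum>T\<in>Pow A. subset_char U T * (\<Sum>S\<leftarrow>Ss. subset_char S T))"
    by (simp add: distrib_left sum.distrib)
  then show ?case using Cons subset_char_orthogonal[OF A U, of S] by (auto simp: algebra_simps)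
qed simp

text \<open>Orthogonality recovers the multiplicity of each character, and diagonal representations with the same
  characters in a different order are isomorphic through a permutation matrix.\<close>

lemma brauer_char_eq_imp_iso:
  assumes two: "(2::'k::field) \<noteq> 0"
    and V: "(V :: (nat \<Rightarrow> int, 'k) rep) \<in> reps (elem_ab_2_group r)" and W: "W \<in> reps (elem_ab_2_group r)"
    and eq: "\<And>T. brauer_char r V T = brauer_char r W T"
  shows "rep_iso (elem_ab_2_group r) V W"
proof -
  let ?G = "elem_ab_2_group r"
  obtain Ss where Ss: "\<forall>S\<in>set Ss. S \<subseteq> {1..r}" "rep_iso ?G V (char_sum r Ss)" using ex_char_sum[OF two V] by blast
  obtain Us where Us: "\<forall>S\<in>set Us. S \<subseteq> {1..r}" "rep_iso ?G W (char_sum r Us)" using ex_char_sum[OF two W] by blast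
  note cS = char_sum_in[OF Ss(1), where ?'k='k] and cU = char_sum_in[OF Us(1), where ?'k='k]
  have e: "(\<Sum>S\<leftarrow>Ss. subset_char S T) = (\<Sum>S\<leftarrow>Us. subset_char S T)" for T
    using eq[of T] brauer_char_iso(1)[OF Ss(2) V cS] brauer_char_iso(1)[OF Us(2) W cU] brauer_char_char_sum[OF two Ss(1)] brauer_char_char_sum[OF two Us(1)]
    by metis
  have "count (mset Ss) U = count (mset Us) U" for U
  proof (cases "U \<subseteq> {1..r}")
    case True
    have "2 ^ card {1..r} * int (count (mset Ss) U) = 2 ^ card {1..r} * int (count (mset Us) U)"
      using sum_list_count[OF _ Ss(1) True] sum_list_count[OF _ Us(1) True] e by simp
    then show ?thesis by simp
  next
    case False
    then have "U \<notin> set Ss" "U \<notin> set Us" using Ss(1) Us(1) by auto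
    then show ?thesis by (metis count_mset_0_iff)
  qed
  then have "mset Ss = mset Us" by (rule multiset_eqI)
  then have "rep_iso ?G (char_sum r Ss :: (nat \<Rightarrow> int, 'k) rep) (char_sum r Us)"
    unfolding char_sum_def by (intro perm_diag_rep_iso) simp
  then show ?thesis
    using rep_iso_trans[OF Ss(2) _ V cS cU] rep_iso_trans[OF _ rep_iso_sym[OF Us(2) W cU] V cU W] by blast
qed

lemma brauer_char_dsum:
  assumes two: "(2::'k::field) \<noteq> 0"
    and V: "(V :: (nat \<Rightarrow> int, 'k) rep) \<in> reps (elem_ab_2_group r)" and W: "W \<in> reps (elem_ab_2_group r)"
  shows "brauer_char r (dsum_rep V W) T = brauer_char r V T + brauer_char r W T"
proof -
  let ?G = "elem_ab_2_group r"
  obtain Ss where Ss: "\<forall>S\<in>set Ss. S \<subseteq> {1..r}" "rep_iso ?G V (char_sum r Ss)" using ex_char_sum[OF two V] by blast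
  obtain Us where Us: "\<forall>S\<in>set Us. S \<subseteq> {1..r}" "rep_iso ?G W (char_sum r Us)" using ex_char_sum[OF two W] by blast
  note cS = char_sum_in[OF Ss(1), where ?'k='k] and cU = char_sum_in[OF Us(1), where ?'k='k]
  have SU: "\<forall>S\<in>set (Ss @ Us). S \<subseteq> {1..r}" using Ss Us by auto
  have "dsum_rep (char_sum r Ss) (char_sum r Us) = (char_sum r (Ss @ Us) :: (nat \<Rightarrow> int, 'k) rep)"
    by (simp add: char_sum_def dsum_diag_rep)
  then have "brauer_char r (dsum_rep V W) T = brauer_char r (char_sum r (Ss @ Us) :: (nat \<Rightarrow> int, 'k) rep) T"
    using brauer_char_iso(1)[OF dsum_rep_cong[OF Ss(2) Us(2) V cS W cU]] V W cS cU char_sum_in[OF SU, where ?'k='k] by simp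
  then show ?thesis
    using brauer_char_iso(1)[OF Ss(2) V cS] brauer_char_iso(1)[OF Us(2) W cU] brauer_char_char_sum[OF two Ss(1)] brauer_char_char_sum[OF two Us(1)]
      brauer_char_char_sum[OF two SU] by simp
qed

lemma tensor_diag_rep:
  "tensor_rep (diag_rep cs) (diag_rep ds) = diag_rep (concat (map (\<lambda>c. map (\<lambda>d g. c g * d g) ds) cs))"
proof -
  have "concat (map (\<lambda>x. map (\<lambda>y. x * y) (map (\<lambda>d. of_int (d g)) ds)) (map (\<lambda>c. of_int (c g)) cs))
    = (map (\<lambda>c. of_int (c g)) (concat (map (\<lambda>c. map (\<lambda>d g. c g * d g) ds) cs)) :: 'b list)" for g
    by (induction cs) (simp_all add: comp_def)
  then show ?thesis
    by (simp only: tensor_rep_def diag_rep_def rep_dim_def fst_conv snd_conv length_concat_map kronecker_diag_of)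
qed

lemma brauer_char_tensor:
  assumes two: "(2::'k::field) \<noteq> 0"
    and V: "(V :: (nat \<Rightarrow> int, 'k) rep) \<in> reps (elem_ab_2_group r)" and W: "W \<in> reps (elem_ab_2_group r)"
  shows "brauer_char r (tensor_rep V W) T = brauer_char r V T * brauer_char r W T"
proof -
  let ?G = "elem_ab_2_group r"
  obtain Ss where Ss: "\<forall>S\<in>set Ss. S \<subseteq> {1..r}" "rep_iso ?G V (char_sum r Ss)" using ex_char_sum[OF two V] by blast
  obtain Us where Us: "\<forall>S\<in>set Us. S \<subseteq> {1..r}" "rep_iso ?G W (char_sum r Us)" using ex_char_sum[OF two W] by blast
  note cS = char_sum_in[OF Ss(1), where ?'k='k] and cU = char_sum_in[OF Us(1), where ?'k='k]
  let ?cs = "map (group_char r) Ss" and ?ds = "map (group_char r) Us"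
  let ?cd = "concat (map (\<lambda>c. map (\<lambda>d g. c g * d g) ?ds) ?cs)"
  have sg: "\<forall>c\<in>set ?cd. c (elt r T) = 1 \<or> c (elt r T) = -1"
  proof
    fix c assume "c \<in> set ?cd"
    then obtain a b where ab: "a \<in> set ?cs" "b \<in> set ?ds" "c = (\<lambda>g. a g * b g)" by auto
    have "a (elt r T) = 1 \<or> a (elt r T) = -1" "b (elt r T) = 1 \<or> b (elt r T) = -1"
      using group_char_list[OF Ss(1)] group_char_list[OF Us(1)] ab(1,2) by blast+
    then show "c (elt r T) = 1 \<or> c (elt r T) = -1" unfolding ab(3) by auto
  qed
  have "brauer_char r (tensor_rep V W) T = brauer_char r (diag_rep ?cd :: (nat \<Rightarrow> int, 'k) rep) T"
    using brauer_char_iso(1)[OF tensor_rep_cong[OF Ss(2) Us(2) V cS W cU] tensor_rep_in[OF V W] tensor_rep_in[OF cS cU]]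
    by (simp add: char_sum_def tensor_diag_rep)
  also have "\<dots> = (\<Sum>c\<leftarrow>?cd. c (elt r T))" by (rule brauer_char_diag_rep[where cs="?cd" and T=T and r=r, OF two sg])
  also have "\<dots> = (\<Sum>S\<leftarrow>Ss. subset_char S T) * (\<Sum>S\<leftarrow>Us. subset_char S T)"
  proof -
    have "(\<Sum>U\<leftarrow>Us. group_char r S (elt r T) * group_char r U (elt r T)) = subset_char S T * (\<Sum>S\<leftarrow>Us. subset_char S T)"
      if "S \<subseteq> {1..r}" for S
      using Us(1) that by (induction Us) (auto simp: algebra_simps)
    then show ?thesis using Ss(1) by (induction Ss) (auto simp: algebra_simps comp_def)
  qed
  finally show ?thesis
    using brauer_char_iso(1)[OF Ss(2) V cS] brauer_char_iso(1)[OF Us(2) W cU] brauer_char_char_sum[OF two Ss(1)] brauer_char_char_sum[OF two Us(1)] by simp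
qed

text \<open>\<open>(1 + t)\<^sup>p (1 - t)\<^sup>q\<close> for eigenvalues \<open>1\<close> and \<open>-1\<close> of multiplicities \<open>p\<close> and \<open>q\<close>. Its coefficients are
  the elementary symmetric functions of the eigenvalues.\<close>

definition lambda_series :: "nat \<Rightarrow> (nat \<Rightarrow> int, 'k::field) rep \<Rightarrow> nat set \<Rightarrow> int fps"
  where "lambda_series r V T = (1 + fps_X) ^ (rep_dim V - neg_mult r V T) * (1 - fps_X) ^ neg_mult r V T"

lemma fps_const_prod: "fps_const (\<Prod>a\<in>I. c a :: int) = (\<Prod>a\<in>I. fps_const (c a))"
  by (induction I rule: infinite_finite_induct) (auto simp flip: fps_const_mult)

lemma elem_sym_series:
  assumes A: "finite A"
  shows "fps_nth (\<Prod>a\<in>A. 1 + fps_const (c a) * fps_X) k = (\<Sum>I | I \<subseteq> A \<and> card I = k. \<Prod>a\<in>I. c a :: int)"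
proof -
  have "(\<Prod>a\<in>A. 1 + fps_const (c a) * fps_X) = (\<Sum>I\<in>Pow A. \<Prod>a\<in>I. fps_const (c a) * fps_X)"
    by (rule sum_prod_Pow[OF A])
  also have "\<dots> = (\<Sum>I\<in>Pow A. fps_const (\<Prod>a\<in>I. c a) * fps_X ^ card I)"
    by (rule sum.cong) (auto simp: prod.distrib fps_const_prod)
  finally have "fps_nth (\<Prod>a\<in>A. 1 + fps_const (c a) * fps_X) k
      = (\<Sum>I\<in>Pow A. (\<Prod>a\<in>I. c a) * (if k = card I then 1 else 0))"
    by (simp add: fps_sum_nth fps_X_power_nth)
  also have "\<dots> = (\<Sum>I | I \<subseteq> A \<and> card I = k. \<Prod>a\<in>I. c a)"
    using A by (intro sum.mono_neutral_cong_right) auto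
  finally show ?thesis .
qed

lemma prod_signs_series:
  fixes xs :: "int list"
  assumes "\<And>x. x \<in> set xs \<Longrightarrow> x = 1 \<or> x = -1"
  shows "(\<Prod>a\<in>{0..<length xs}. 1 + fps_const (xs ! a) * fps_X)
    = (1 + fps_X) ^ (length xs - length (filter (\<lambda>x. x = -1) xs)) * (1 - fps_X :: int fps) ^ length (filter (\<lambda>x. x = -1) xs)"
  using assms
proof (induction xs)
  case (Cons x xs)
  have "(\<Prod>a\<in>{0..<length (x # xs)}. 1 + fps_const ((x # xs) ! a) * fps_X)
      = (1 + fps_const x * fps_X) * (\<Prod>a\<in>{0..<length xs}. 1 + fps_const (xs ! a) * fps_X)"
    by (simp add: prod.atLeast0_lessThan_Suc_shift del: prod.op_ivl_Suc)
  also have "(\<Prod>a\<in>{0..<length xs}. 1 + fps_const (xs ! a) * fps_X)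
    = (1 + fps_X) ^ (length xs - length (filter (\<lambda>x. x = -1) xs)) * (1 - fps_X :: int fps) ^ length (filter (\<lambda>x. x = -1) xs)"
    using Cons by simp
  finally have fin: "(\<Prod>a\<in>{0..<length (x # xs)}. 1 + fps_const ((x # xs) ! a) * fps_X)
    = (1 + fps_const x * fps_X) * ((1 + fps_X) ^ (length xs - length (filter (\<lambda>x. x = -1) xs)) * (1 - fps_X :: int fps) ^ length (filter (\<lambda>x. x = -1) xs))" .
  show ?case
  proof (cases "x = -1")
    case True
    have e: "1 + fps_const x * fps_X = (1 - fps_X :: int fps)"
      by (simp add: True flip: fps_const_neg)
    have "length (filter (\<lambda>x. x = -1) (x # xs)) = Suc (length (filter (\<lambda>x. x = -1) xs))" using True by simp
    then show ?thesis unfolding fin e by (simp only: length_Cons diff_Suc_Suc power_Suc ac_simps)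
  next
    case False
    have e: "1 + fps_const x * fps_X = (1 + fps_X :: int fps)"
      using False Cons.prems[of x] by simp
    have "length (x # xs) - length (filter (\<lambda>x. x = -1) (x # xs)) = Suc (length xs - length (filter (\<lambda>x. x = -1) xs))"
      using False length_filter_le[of "\<lambda>x. x = -1" xs] by (simp add: Suc_diff_le)
    moreover have "length (filter (\<lambda>x. x = -1) (x # xs)) = length (filter (\<lambda>x. x = -1) xs)" using False by simp
    ultimately show ?thesis unfolding fin e by (simp only: power_Suc ac_simps)
  qed
qed simp

lemma ext_diag_rep:
  "ext_rep k (diag_rep cs) = diag_rep (map (\<lambda>I g. \<Prod>a\<in>I. (cs ! a) g) (ksubsets (length cs) k))"
proof -
  have "ext_mat k (diag_of (map (\<lambda>c. of_int (c g)) cs)) = (diag_of (map (\<lambda>I. of_int (\<Prod>a\<in>I. (cs ! a) g)) (ksubsets (length cs) k)) :: 'b mat)" for g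
  proof -
    have "map (\<lambda>I. \<Prod>a\<in>I. map (\<lambda>c. of_int (c g)) cs ! a) (ksubsets (length cs) k)
      = (map (\<lambda>I. of_int (\<Prod>a\<in>I. (cs ! a) g)) (ksubsets (length cs) k) :: 'b list)"
      by (rule map_cong) (auto simp: set_ksubsets intro!: prod.cong)
    then show ?thesis by (simp add: ext_mat_diag_of del: map_eq_conv)
  qed
  then show ?thesis
    by (simp add: ext_rep_def diag_rep_def rep_dim_def length_ksubsets comp_def)
qed

text \<open>The eigenvalues of the \<open>k\<close>th exterior power are the products of \<open>k\<close> eigenvalues at distinct indices, so
  the value is an elementary symmetric function of signs.\<close>

lemma brauer_char_ext:
  assumes two: "(2::'k::field) \<noteq> 0"
    and V: "(V :: (nat \<Rightarrow> int, 'k) rep) \<in> reps (elem_ab_2_group r)"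
  shows "brauer_char r (ext_rep k V) T = fps_nth (lambda_series r V T) k"
proof -
  let ?G = "elem_ab_2_group r"
  obtain Ss where Ss: "\<forall>S\<in>set Ss. S \<subseteq> {1..r}" "rep_iso ?G V (char_sum r Ss)" using ex_char_sum[OF two V] by blast
  note cS = char_sum_in[OF Ss(1), where ?'k='k]
  let ?cs = "map (group_char r) Ss" and ?n = "length Ss"
  let ?xs = "map (\<lambda>c. c (elt r T)) ?cs"
  let ?es = "map (\<lambda>I g. \<Prod>a\<in>I. (?cs ! a) g) (ksubsets ?n k)"
  have pm: "(\<Prod>a\<in>I. f a) = 1 \<or> (\<Prod>a\<in>I. f a) = (-1::int)" if "\<And>a. a \<in> I \<Longrightarrow> f a = 1 \<or> f a = -1" for I :: "nat set" and f
    using that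
  proof (induction I rule: infinite_finite_induct)
    case (insert x F)
    then have "f x = 1 \<or> f x = -1" "prod f F = 1 \<or> prod f F = -1" by simp_all
    then show ?case using insert.hyps by auto
  qed auto
  have sg: "\<forall>c\<in>set ?es. c (elt r T) = 1 \<or> c (elt r T) = -1"
  proof
    fix c assume c: "c \<in> set ?es"
    obtain I where I: "I \<subseteq> {0..<?n}" "c = (\<lambda>g. \<Prod>a\<in>I. (?cs ! a) g)" using c by (auto simp: set_ksubsets)
    have "(?cs ! a) (elt r T) = 1 \<or> (?cs ! a) (elt r T) = -1" if "a \<in> I" for a
    proof -
      have "?cs ! a \<in> set ?cs" using that I(1) by (intro nth_mem) auto
      then show ?thesis using group_char_list[OF Ss(1)] by blast
    qed
    then show "c (elt r T) = 1 \<or> c (elt r T) = -1" unfolding I(2) by (rule pm)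
  qed
  have "brauer_char r (ext_rep k V) T = brauer_char r (diag_rep ?es :: (nat \<Rightarrow> int, 'k) rep) T"
    using brauer_char_iso(1)[OF ext_rep_cong[OF Ss(2) V cS] ext_rep_in[OF V] ext_rep_in[OF cS]] by (simp add: char_sum_def ext_diag_rep)
  also have "\<dots> = (\<Sum>c\<leftarrow>?es. c (elt r T))" by (rule brauer_char_diag_rep[where cs="?es" and T=T and r=r, OF two sg])
  also have "\<dots> = (\<Sum>I\<leftarrow>ksubsets ?n k. \<Prod>a\<in>I. (?cs ! a) (elt r T))" by (simp add: comp_def)
  also have "\<dots> = (\<Sum>I | I \<subseteq> {0..<?n} \<and> card I = k. \<Prod>a\<in>I. (?cs ! a) (elt r T))"
    by (simp add: sum_list_distinct_conv_sum_set distinct_ksubsets set_ksubsets)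
  also have "\<dots> = (\<Sum>I | I \<subseteq> {0..<?n} \<and> card I = k. \<Prod>a\<in>I. ?xs ! a)"
    by (intro sum.cong refl prod.cong) auto
  also have "\<dots> = fps_nth (\<Prod>a\<in>{0..<length ?xs}. 1 + fps_const (?xs ! a) * fps_X) k"
    by (simp add: elem_sym_series del: nth_map)
  also have "(\<Prod>a\<in>{0..<length ?xs}. 1 + fps_const (?xs ! a) * fps_X)
    = (1 + fps_X) ^ (length ?xs - length (filter (\<lambda>x. x = -1) ?xs)) * (1 - fps_X :: int fps) ^ length (filter (\<lambda>x. x = -1) ?xs)"
    by (rule prod_signs_series) (use group_char_list[OF Ss(1)] in auto)
  also have "length (filter (\<lambda>x. x = -1) ?xs) = neg_mult r V T"
    using neg_mult_diag_rep[where cs="map (group_char r) Ss" and T=T and r=r, OF two group_char_list[OF Ss(1)]] neg_mult_iso[OF Ss(2) V cS]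
    by (simp add: char_sum_def filter_map comp_def)
  also have "length ?xs = rep_dim V" using brauer_char_iso(2)[OF Ss(2) V cS] by simp
  finally show ?thesis by (simp add: lambda_series_def)
qed

lemma neg_mult_le:
  assumes two: "(2::'k::field) \<noteq> 0" and V: "(V :: (nat \<Rightarrow> int, 'k) rep) \<in> reps (elem_ab_2_group r)"
  shows "neg_mult r V T \<le> rep_dim V"
proof -
  obtain Ss where Ss: "\<forall>S\<in>set Ss. S \<subseteq> {1..r}" "rep_iso (elem_ab_2_group r) V (char_sum r Ss)" using ex_char_sum[OF two V] by blast
  note cS = char_sum_in[OF Ss(1), where ?'k='k]
  show ?thesis
    using neg_mult_diag_rep[where cs="map (group_char r) Ss" and T=T and r=r, OF two group_char_list[OF Ss(1)]] neg_mult_iso[OF Ss(2) V cS] brauer_char_iso(2)[OF Ss(2) V cS]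
      length_filter_le[of "\<lambda>c. c (elt r T) = -1" "map (group_char r) Ss"]
    by (simp add: char_sum_def)
qed

lemma brauer_char_empty:
  assumes "V \<in> reps (elem_ab_2_group r)" and two: "(2::'k::field) \<noteq> 0"
  shows "brauer_char r (V :: (nat \<Rightarrow> int, 'k) rep) {} = int (rep_dim V)"
proof -
  obtain Ss where Ss: "\<forall>S\<in>set Ss. S \<subseteq> {1..r}" "rep_iso (elem_ab_2_group r) V (char_sum r Ss)" using ex_char_sum[OF two assms(1)] by blast
  note cS = char_sum_in[OF Ss(1), where ?'k='k]
  have "brauer_char r V {} = (\<Sum>S\<leftarrow>Ss. subset_char S {})" using brauer_char_iso(1)[OF Ss(2) assms(1) cS] brauer_char_char_sum[OF two Ss(1)] by metis
  also have "\<dots> = int (length Ss)" by (induction Ss) (auto simp: subset_char_def)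
  finally show ?thesis using brauer_char_iso(2)[OF Ss(2) assms(1) cS] by simp
qed

section \<open>Powers of two in the coefficients of quotients of lambda series\<close>

lemma one_plus_X_power_nth: "n < k \<Longrightarrow> fps_nth ((1 + fps_X :: int fps) ^ n) k = 0"
proof (induction n arbitrary: k)
  case (Suc n)
  have "(1 + fps_X :: int fps) ^ Suc n = (1 + fps_X) ^ n + fps_X * (1 + fps_X) ^ n"
    by (simp only: power_Suc distrib_right mult_1)
  then have "fps_nth ((1 + fps_X :: int fps) ^ Suc n) k
    = fps_nth ((1 + fps_X) ^ n) k + (if k = 0 then 0 else fps_nth ((1 + fps_X) ^ n) (k - 1))"
    by (simp only: fps_add_nth fps_X_mult_nth)
  then show ?case using Suc.IH[of k] Suc.IH[of "k - 1"] Suc.prems by auto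
qed simp

lemma fps_nth_two: "fps_nth (2 * f :: int fps) k = 2 * fps_nth f k"
  by (simp only: mult_2 fps_add_nth)

text \<open>The inverses of \<open>1 + t\<close> and \<open>1 - t\<close>.\<close>

definition geo_neg :: "int fps" where "geo_neg = Abs_fps (\<lambda>n. (-1) ^ n)"
definition geo_pos :: "int fps" where "geo_pos = Abs_fps (\<lambda>n. 1)"

lemma geo_neg: "(1 + fps_X) * geo_neg = 1"
proof (rule fps_ext)
  fix n show "fps_nth ((1 + fps_X) * geo_neg) n = fps_nth 1 n"
    by (cases n) (simp_all add: geo_neg_def distrib_right)
qed

lemma geo_pos: "(1 - fps_X) * geo_pos = 1"
proof (rule fps_ext)
  fix n show "fps_nth ((1 - fps_X) * geo_pos) n = fps_nth 1 n"
    by (cases n) (simp_all add: geo_pos_def left_diff_distrib)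
qed

text \<open>For \<open>x\<close> of augmentation zero, the series \<open>\<Sum>\<^sub>n \<lambda>\<^sup>n(x) t\<^sup>n\<close> at a group element should have this property:
  adding \<open>k - 1\<close> to \<open>x\<close> multiplies the series by \<open>(1 + t)\<^bsup>k-1\<^esup>\<close>, so the coefficient in
  question is the value of \<open>\<gamma>\<^sup>k(x)\<close>.\<close>

definition two_divs :: "int fps \<Rightarrow> bool"
  where "two_divs g \<longleftrightarrow> (\<forall>k\<ge>1. 2 ^ k dvd fps_nth ((1 + fps_X) ^ (k - 1) * g) k)"

lemma two_divs_1: "two_divs 1"
  by (auto simp: two_divs_def one_plus_X_power_nth)

text \<open>The summand \<open>2 t/(1 + t) g\<close> gains a factor 2 and lowers both \<open>k\<close> and the power of \<open>1 + t\<close> by one.\<close>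

lemma two_divs_shift:
  assumes D: "k \<ge> 2 \<Longrightarrow> 2 ^ (k - 1) dvd fps_nth ((1 + fps_X) ^ (k - 2) * g) (k - 1)" and k: "k \<ge> 1"
  shows "2 ^ k dvd 2 * fps_nth ((1 + fps_X) ^ (k - 1) * (fps_X * geo_neg * g)) k"
proof -
  have *: "(1 + fps_X) ^ (k - 1) * (fps_X * geo_neg * g) = fps_X * ((1 + fps_X) ^ (k - 1) * geo_neg * g)"
    by (simp add: ac_simps)
  show ?thesis
  proof (cases "k \<ge> 2")
    case True
    then have "k - 1 = Suc (k - 2)" by simp
    then have "(1 + fps_X) ^ (k - 1) * geo_neg * g = (1 + fps_X) ^ (k - 2) * g * ((1 + fps_X) * geo_neg)"
      by (simp only: power_Suc ac_simps)
    then have e: "(1 + fps_X) ^ (k - 1) * geo_neg * g = (1 + fps_X) ^ (k - 2) * g"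
      by (simp only: geo_neg mult_1_right)
    have "fps_nth ((1 + fps_X) ^ (k - 1) * (fps_X * geo_neg * g)) k = fps_nth ((1 + fps_X) ^ (k - 2) * g) (k - 1)"
      unfolding * e fps_X_mult_nth using k by simp
    moreover have "(2::int) ^ k = 2 * 2 ^ (k - 1)" using k by (cases k) auto
    ultimately show ?thesis using D[OF True] by simp
  next
    case False
    then have "k = 1" using k by simp
    then show ?thesis by simp
  qed
qed

text \<open>Multiplication by \<open>(1 - t)/(1 + t) = 1 - 2 t/(1 + t)\<close>.\<close>

lemma two_divs_down:
  assumes g: "two_divs g" shows "two_divs ((1 - fps_X) * geo_neg * g)"
  unfolding two_divs_def
proof (intro allI impI)
  fix k :: nat assume k: "1 \<le> k"
  have e: "(1 - fps_X) * geo_neg = 1 - 2 * fps_X * geo_neg"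
    using geo_neg by (simp add: algebra_simps)
  have "(1 + fps_X) ^ (k - 1) * ((1 - fps_X) * geo_neg * g)
    = (1 + fps_X) ^ (k - 1) * g - 2 * ((1 + fps_X) ^ (k - 1) * (fps_X * geo_neg * g))"
    unfolding e by (simp add: algebra_simps)
  then have "fps_nth ((1 + fps_X) ^ (k - 1) * ((1 - fps_X) * geo_neg * g)) k
    = fps_nth ((1 + fps_X) ^ (k - 1) * g) k - 2 * fps_nth ((1 + fps_X) ^ (k - 1) * (fps_X * geo_neg * g)) k"
    by (simp only: fps_sub_nth fps_nth_two)
  moreover have "2 ^ k dvd 2 * fps_nth ((1 + fps_X) ^ (k - 1) * (fps_X * geo_neg * g)) k"
  proof (rule two_divs_shift[OF _ k])
    assume "k \<ge> 2"
    then have "k - 1 \<ge> 1" "k - 1 - 1 = k - 2" by auto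
    then show "2 ^ (k - 1) dvd fps_nth ((1 + fps_X) ^ (k - 2) * g) (k - 1)"
      using g unfolding two_divs_def by metis
  qed
  moreover have "2 ^ k dvd fps_nth ((1 + fps_X) ^ (k - 1) * g) k" using g k by (simp add: two_divs_def)
  ultimately show "2 ^ k dvd fps_nth ((1 + fps_X) ^ (k - 1) * ((1 - fps_X) * geo_neg * g)) k" by simp
qed

text \<open>Division by \<open>(1 - t)/(1 + t)\<close>: with \<open>h = g (1 + t)/(1 - t)\<close> one has \<open>h = g + 2 t/(1 + t) h\<close>, which
  settles coefficient \<open>k\<close> of \<open>h\<close> by the preceding one.\<close>

lemma two_divs_up:
  assumes g: "two_divs g" shows "two_divs ((1 + fps_X) * geo_pos * g)"
proof -
  let ?h = "(1 + fps_X) * geo_pos * g"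
  have e: "(1 - fps_X) * geo_neg * ?h = g"
    using geo_neg geo_pos by (metis (no_types, opaque_lifting) mult.assoc mult.commute mult_1)
  have f: "(1 - fps_X) * geo_neg = 1 - 2 * fps_X * geo_neg"
    using geo_neg by (simp add: algebra_simps)
  have "2 ^ k dvd fps_nth ((1 + fps_X) ^ (k - 1) * ?h) k" if "k \<ge> 1" for k
    using that
  proof (induction k rule: less_induct)
    case (less k)
    have "(1 + fps_X) ^ (k - 1) * ?h
      = (1 + fps_X) ^ (k - 1) * ((1 - fps_X) * geo_neg * ?h) + 2 * ((1 + fps_X) ^ (k - 1) * (fps_X * geo_neg * ?h))"
      unfolding f by (simp add: algebra_simps)
    then have "fps_nth ((1 + fps_X) ^ (k - 1) * ?h) k
      = fps_nth ((1 + fps_X) ^ (k - 1) * g) k + 2 * fps_nth ((1 + fps_X) ^ (k - 1) * (fps_X * geo_neg * ?h)) k"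
      unfolding e by (simp only: fps_add_nth fps_nth_two)
    moreover have "2 ^ k dvd 2 * fps_nth ((1 + fps_X) ^ (k - 1) * (fps_X * geo_neg * ?h)) k"
    proof (rule two_divs_shift[OF _ less.prems])
      assume k: "k \<ge> 2"
      then have "k - 1 < k" "k - 1 \<ge> 1" "k - 1 - 1 = k - 2" by auto
      then show "2 ^ (k - 1) dvd fps_nth ((1 + fps_X) ^ (k - 2) * ?h) (k - 1)"
        using less.IH by metis
    qed
    moreover have "2 ^ k dvd fps_nth ((1 + fps_X) ^ (k - 1) * g) k" using g less.prems by (simp add: two_divs_def)
    ultimately show ?case by simp
  qed
  then show ?thesis by (simp add: two_divs_def)
qed

lemma two_divs_power:
  "two_divs (((1 - fps_X) * geo_neg) ^ n)" "two_divs (((1 + fps_X) * geo_pos) ^ n)"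
proof (induction n)
  case (Suc n)
  show "two_divs (((1 - fps_X) * geo_neg) ^ Suc n)" using two_divs_down[OF Suc(1)] by (simp only: power_Suc)
  show "two_divs (((1 + fps_X) * geo_pos) ^ Suc n)" using two_divs_up[OF Suc(2)] by (simp only: power_Suc)
qed (simp_all add: two_divs_1)

lemma int_fps_nonzero: "(1 + fps_X :: int fps) \<noteq> 0" "(1 - fps_X :: int fps) \<noteq> 0"
  using geo_neg geo_pos by auto

text \<open>Here \<open>L\<close> is the lambda series of a virtual representation \<open>V - W\<close> of dimension \<open>k - 1\<close>, so it is
  \<open>(1 + t)\<^bsup>k-1\<^esup>\<close> times an integral power of \<open>(1 - t)/(1 + t)\<close>, whose exponent \<open>q' - q\<close> may
  have either sign.\<close>

lemma gamma_series_dvd: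
  fixes L :: "int fps"
  assumes eq: "(1 + fps_X) ^ p * (1 - fps_X) ^ q * L = (1 + fps_X) ^ p' * (1 - fps_X) ^ q'"
    and d: "p' + q' = p + q + (k - 1)" and k: "k \<ge> 1"
  shows "2 ^ k dvd fps_nth L k" "q = q' \<Longrightarrow> fps_nth L k = 0"
proof -
  let ?a = "1 + fps_X :: int fps" and ?b = "1 - fps_X :: int fps"
  have nz: "?a ^ p * ?b ^ q \<noteq> 0" using int_fps_nonzero by simp
  have "\<exists>g. two_divs g \<and> L = ?a ^ (k - 1) * g"
  proof (cases "q' \<ge> q")
    case True
    define c where "c = q' - q"
    have pq: "q' = q + c" "p + (k - 1) = p' + c" using True d by (auto simp: c_def)
    have "?a ^ p * ?b ^ q * (?a ^ (k - 1) * (?b * geo_neg) ^ c) = ?a ^ (p + (k - 1)) * ?b ^ (q + c) * geo_neg ^ c"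
      by (simp only: power_add power_mult_distrib ac_simps)
    also have "\<dots> = ?a ^ p' * ?b ^ q' * (?a * geo_neg) ^ c"
      unfolding pq by (simp only: power_add power_mult_distrib ac_simps)
    also have "\<dots> = ?a ^ p * ?b ^ q * L" using eq by (simp add: geo_neg)
    finally have "L = ?a ^ (k - 1) * (?b * geo_neg) ^ c" using nz by (metis mult_left_cancel)
    then show ?thesis using two_divs_power(1) by blast
  next
    case False
    define c where "c = q - q'"
    have pq: "q = q' + c" "p' = p + (k - 1) + c" using False d by (auto simp: c_def)
    have "?a ^ p * ?b ^ q * (?a ^ (k - 1) * (?a * geo_pos) ^ c) = ?a ^ (p + (k - 1) + c) * ?b ^ q' * (?b * geo_pos) ^ c"
      unfolding pq(1) by (simp only: power_add power_mult_distrib ac_simps)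
    also have "\<dots> = ?a ^ p * ?b ^ q * L" using eq by (simp add: geo_pos pq(2))
    finally have "L = ?a ^ (k - 1) * (?a * geo_pos) ^ c" using nz by (metis mult_left_cancel)
    then show ?thesis using two_divs_power(2) by blast
  qed
  then show "2 ^ k dvd fps_nth L k" using k by (auto simp: two_divs_def)
  show "fps_nth L k = 0" if q: "q = q'"
  proof -
    have "p' = p + (k - 1)" using d q by simp
    then have "?a ^ p * ?b ^ q * L = ?a ^ p * ?b ^ q * ?a ^ (k - 1)" using eq q by (simp add: power_add ac_simps)
    then have "L = ?a ^ (k - 1)" using nz by (metis mult_left_cancel)
    then show ?thesis using k by (simp add: one_plus_X_power_nth)
  qed
qed

section \<open>The representation ring as a ring of functions\<close>

text \<open>A structure whose operations are carried to ring operations by a jointly injective family of maps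
  satisfies the ring laws because the targets do. One map is separate since it may have another
  target type.\<close>

lemma cring_by_homs:
  fixes R :: "('a, 'b) ring_scheme" and h :: "'i \<Rightarrow> 'a \<Rightarrow> 'c::comm_ring_1" and h' :: "'a \<Rightarrow> 'd::comm_ring_1"
  assumes closed: "\<zero>\<^bsub>R\<^esub> \<in> carrier R" "\<one>\<^bsub>R\<^esub> \<in> carrier R"
      "\<And>x y. x \<in> carrier R \<Longrightarrow> y \<in> carrier R \<Longrightarrow> x \<oplus>\<^bsub>R\<^esub> y \<in> carrier R"
      "\<And>x y. x \<in> carrier R \<Longrightarrow> y \<in> carrier R \<Longrightarrow> x \<otimes>\<^bsub>R\<^esub> y \<in> carrier R"
    and neg: "\<And>x. x \<in> carrier R \<Longrightarrow> \<exists>y\<in>carrier R. y \<oplus>\<^bsub>R\<^esub> x = \<zero>\<^bsub>R\<^esub>"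
    and h: "\<And>i. h i \<zero>\<^bsub>R\<^esub> = 0" "\<And>i. h i \<one>\<^bsub>R\<^esub> = 1"
      "\<And>i x y. x \<in> carrier R \<Longrightarrow> y \<in> carrier R \<Longrightarrow> h i (x \<oplus>\<^bsub>R\<^esub> y) = h i x + h i y"
      "\<And>i x y. x \<in> carrier R \<Longrightarrow> y \<in> carrier R \<Longrightarrow> h i (x \<otimes>\<^bsub>R\<^esub> y) = h i x * h i y"
    and h': "h' \<zero>\<^bsub>R\<^esub> = 0" "h' \<one>\<^bsub>R\<^esub> = 1"
      "\<And>x y. x \<in> carrier R \<Longrightarrow> y \<in> carrier R \<Longrightarrow> h' (x \<oplus>\<^bsub>R\<^esub> y) = h' x + h' y"
      "\<And>x y. x \<in> carrier R \<Longrightarrow> y \<in> carrier R \<Longrightarrow> h' (x \<otimes>\<^bsub>R\<^esub> y) = h' x * h' y"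
    and inj: "\<And>x y. x \<in> carrier R \<Longrightarrow> y \<in> carrier R \<Longrightarrow> (\<And>i. h i x = h i y) \<Longrightarrow> h' x = h' y \<Longrightarrow> x = y"
  shows "cring R"
proof (rule cringI)
  show "abelian_group R"
    by (rule abelian_groupI) (auto simp: closed h h' ac_simps neg intro!: inj)
  show "comm_monoid R"
    by (rule comm_monoidI) (auto simp: closed h h' ac_simps intro!: inj)
  fix x y z assume "x \<in> carrier R" "y \<in> carrier R" "z \<in> carrier R"
  then show "(x \<oplus>\<^bsub>R\<^esub> y) \<otimes>\<^bsub>R\<^esub> z = x \<otimes>\<^bsub>R\<^esub> z \<oplus>\<^bsub>R\<^esub> y \<otimes>\<^bsub>R\<^esub> z"
    by (intro inj) (auto simp: closed h h' algebra_simps)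
qed

text \<open>The field enters only through the type of the representations, so it is fixed by a type token.\<close>

locale elem_ab_2_reps =
  fixes r :: nat and field_type :: "'k::field itself"
  assumes two: "(2::'k) \<noteq> 0"
begin

abbreviation "G \<equiv> elem_ab_2_group r"
abbreviation RP :: "(nat \<Rightarrow> int, 'k) rep set" where "RP \<equiv> reps G"
abbreviation PR :: "(nat \<Rightarrow> int, 'k) vrep ring" where "PR \<equiv> plain_rep_ring G"
abbreviation K :: "(nat \<Rightarrow> int, 'k) vrep aug_lambda_ring" where "K \<equiv> rep_ring G"

text \<open>A common summand \<open>U\<close> cancels in the characters. Conversely, representations with equal characters
  are isomorphic, so the zero representation serves as \<open>U\<close>.\<close>

lemma vrep_rel_iff:
  "((V, W), (V', W')) \<in> vrep_rel G \<longleftrightarrow> V \<in> RP \<and> W \<in> RP \<and> V' \<in> RP \<and> W' \<in> RP \<and>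
    (\<forall>T. brauer_char r V T - brauer_char r W T = brauer_char r V' T - brauer_char r W' T)"
proof -
  have "(\<exists>U\<in>RP. rep_iso G (dsum_rep (dsum_rep V W') U) (dsum_rep (dsum_rep V' W) U)) \<longleftrightarrow>
    (\<forall>T. brauer_char r V T - brauer_char r W T = brauer_char r V' T - brauer_char r W' T)"
    if R: "V \<in> RP" "W \<in> RP" "V' \<in> RP" "W' \<in> RP"
  proof
    assume "\<exists>U\<in>RP. rep_iso G (dsum_rep (dsum_rep V W') U) (dsum_rep (dsum_rep V' W) U)"
    then obtain U where U: "U \<in> RP" "rep_iso G (dsum_rep (dsum_rep V W') U) (dsum_rep (dsum_rep V' W) U)" by blast
    show "\<forall>T. brauer_char r V T - brauer_char r W T = brauer_char r V' T - brauer_char r W' T"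
    proof
      fix T
      have "brauer_char r (dsum_rep (dsum_rep V W') U) T = brauer_char r (dsum_rep (dsum_rep V' W) U) T"
        using brauer_char_iso(1)[OF U(2)] R U(1) by simp
      then show "brauer_char r V T - brauer_char r W T = brauer_char r V' T - brauer_char r W' T"
        using R U(1) by (simp add: brauer_char_dsum[OF two])
    qed
  next
    assume eq: "\<forall>T. brauer_char r V T - brauer_char r W T = brauer_char r V' T - brauer_char r W' T"
    have "brauer_char r (dsum_rep (dsum_rep V W') zero_rep) T = brauer_char r (dsum_rep (dsum_rep V' W) zero_rep) T" for T
      using eq[rule_format, of T] R by (simp add: brauer_char_dsum[OF two])
    then have "rep_iso G (dsum_rep (dsum_rep V W') zero_rep) (dsum_rep (dsum_rep V' W) zero_rep)"
      using R by (intro brauer_char_eq_imp_iso[OF two]) auto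
    then show "\<exists>U\<in>RP. rep_iso G (dsum_rep (dsum_rep V W') U) (dsum_rep (dsum_rep V' W) U)"
      using zero_rep_in by blast
  qed
  then show ?thesis by (auto simp: vrep_rel_def)
qed

lemma vrep_iff:
  assumes "V \<in> RP" "W \<in> RP"
  shows "(V', W') \<in> vrep G V W \<longleftrightarrow> V' \<in> RP \<and> W' \<in> RP \<and> (\<forall>T. brauer_char r V' T - brauer_char r W' T = brauer_char r V T - brauer_char r W T)"
  using assms by (auto simp: vrep_def vrep_rel_iff)

text \<open>All pairs \<open>(V, W)\<close> in a class have the same difference of characters, so the choice does not matter.\<close>

definition ev :: "nat set \<Rightarrow> (nat \<Rightarrow> int, 'k) vrep \<Rightarrow> int"
  where "ev T x = (case SOME p. p \<in> x of (V, W) \<Rightarrow> brauer_char r V T - brauer_char r W T)"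

lemma ev_vrep: 
  assumes "V \<in> RP" "W \<in> RP" shows "ev T (vrep G V W) = brauer_char r V T - brauer_char r W T"
proof -
  have "(V, W) \<in> vrep G V W" using assms by (simp add: vrep_iff)
  then have "(SOME p. p \<in> vrep G V W) \<in> vrep G V W" by (rule someI)
  then show ?thesis using assms unfolding ev_def by (cases "SOME p. p \<in> vrep G V W") (auto simp: vrep_iff)
qed

lemma vrep_eqI:
  assumes "V \<in> RP" "W \<in> RP" "V' \<in> RP" "W' \<in> RP" "\<And>T. brauer_char r V T - brauer_char r W T = brauer_char r V' T - brauer_char r W' T"
  shows "vrep G V W = vrep G V' W'"
proof -
  have "p \<in> vrep G V W \<longleftrightarrow> p \<in> vrep G V' W'" for p
    using assms by (cases p) (auto simp: vrep_iff)
  then show ?thesis by blast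
qed

lemma carrier_PR: "carrier PR = {vrep G V W |V W. V \<in> RP \<and> W \<in> RP}"
  by (auto simp: plain_rep_ring_def quotient_def vrep_def)

lemma carrierE:
  assumes "x \<in> carrier PR"
  obtains V W where "V \<in> RP" "W \<in> RP" "x = vrep G V W"
  using assms by (auto simp: carrier_PR)

lemma ev_inj:
  assumes "x \<in> carrier PR" "y \<in> carrier PR" "\<And>T. ev T x = ev T y" shows "x = y"
  using assms(1)
proof (rule carrierE)
  fix V W assume x: "V \<in> RP" "W \<in> RP" "x = vrep G V W"
  show ?thesis using assms(2)
  proof (rule carrierE)
    fix V' W' assume y: "V' \<in> RP" "W' \<in> RP" "y = vrep G V' W'"
    have "brauer_char r V T - brauer_char r W T = brauer_char r V' T - brauer_char r W' T" for T
      using assms(3)[of T] x y by (simp add: ev_vrep)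
    then show ?thesis unfolding x(3) y(3) by (rule vrep_eqI[OF x(1,2) y(1,2)])
  qed
qed

text \<open>The operations of the representation ring are unions over all pairs of representatives.\<close>

lemma UN_const_class:
  assumes "V \<in> RP" "W \<in> RP" "V' \<in> RP" "W' \<in> RP"
    "\<And>A B A' B'. (A, B) \<in> vrep G V W \<Longrightarrow> (A', B') \<in> vrep G V' W' \<Longrightarrow> F A B A' B' = c"
  shows "(\<Union>(A, B)\<in>vrep G V W. \<Union>(A', B')\<in>vrep G V' W'. F A B A' B') = c"
proof -
  have ne: "vrep G V W \<noteq> {}" "vrep G V' W' \<noteq> {}"
    using vrep_iff[of V W V W] vrep_iff[of V' W' V' W'] assms(1-4) by blast+
  have "(\<Union>(A', B')\<in>vrep G V' W'. F A B A' B') = c" if "(A, B) \<in> vrep G V W" for A B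
    by (rule SUP_eq_const[OF ne(2)]) (auto simp: assms(5)[OF that])
  note inner = this
  show ?thesis
  proof (rule SUP_eq_const[OF ne(1)])
    fix p assume "p \<in> vrep G V W"
    then show "(case p of (A, B) \<Rightarrow> \<Union>(A', B')\<in>vrep G V' W'. F A B A' B') = c"
      using inner by (cases p) (simp only: prod.case)
  qed
qed

lemma add_PR:
  assumes R: "V \<in> RP" "W \<in> RP" "V' \<in> RP" "W' \<in> RP"
  shows "vrep G V W \<oplus>\<^bsub>PR\<^esub> vrep G V' W' = vrep G (dsum_rep V V') (dsum_rep W W')"
  unfolding plain_rep_ring_def ring.simps
proof (rule UN_const_class[OF R])
  fix A B A' B' assume "(A, B) \<in> vrep G V W" "(A', B') \<in> vrep G V' W'"
  then have *: "A \<in> RP" "B \<in> RP" "A' \<in> RP" "B' \<in> RP" "\<And>T. brauer_char r A T - brauer_char r B T = brauer_char r V T - brauer_char r W T"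
    "\<And>T. brauer_char r A' T - brauer_char r B' T = brauer_char r V' T - brauer_char r W' T" using R by (auto simp: vrep_iff)
  show "vrep G (dsum_rep A A') (dsum_rep B B') = vrep G (dsum_rep V V') (dsum_rep W W')"
  proof (rule vrep_eqI)
    fix T show "brauer_char r (dsum_rep A A') T - brauer_char r (dsum_rep B B') T = brauer_char r (dsum_rep V V') T - brauer_char r (dsum_rep W W') T"
      using *(5)[of T] *(6)[of T] *(1-4) R by (simp add: brauer_char_dsum[OF two])
  qed (use *(1-4) R in auto)
qed

lemma mult_PR:
  assumes R: "V \<in> RP" "W \<in> RP" "V' \<in> RP" "W' \<in> RP"
  shows "vrep G V W \<otimes>\<^bsub>PR\<^esub> vrep G V' W' = vrep G (dsum_rep (tensor_rep V V') (tensor_rep W W'))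
    (dsum_rep (tensor_rep V W') (tensor_rep W V'))"
  unfolding plain_rep_ring_def ring.simps monoid.simps
proof (rule UN_const_class[OF R])
  fix A B A' B' assume "(A, B) \<in> vrep G V W" "(A', B') \<in> vrep G V' W'"
  then have *: "A \<in> RP" "B \<in> RP" "A' \<in> RP" "B' \<in> RP" "\<And>T. brauer_char r A T - brauer_char r B T = brauer_char r V T - brauer_char r W T"
    "\<And>T. brauer_char r A' T - brauer_char r B' T = brauer_char r V' T - brauer_char r W' T" using R by (auto simp: vrep_iff)
  show "vrep G (dsum_rep (tensor_rep A A') (tensor_rep B B')) (dsum_rep (tensor_rep A B') (tensor_rep B A')) =
    vrep G (dsum_rep (tensor_rep V V') (tensor_rep W W')) (dsum_rep (tensor_rep V W') (tensor_rep W V'))"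
  proof (rule vrep_eqI)
    fix T
    have "(brauer_char r A T - brauer_char r B T) * (brauer_char r A' T - brauer_char r B' T) = (brauer_char r V T - brauer_char r W T) * (brauer_char r V' T - brauer_char r W' T)"
      using *(5)[of T] *(6)[of T] by simp
    then show "brauer_char r (dsum_rep (tensor_rep A A') (tensor_rep B B')) T - brauer_char r (dsum_rep (tensor_rep A B') (tensor_rep B A')) T =
       brauer_char r (dsum_rep (tensor_rep V V') (tensor_rep W W')) T - brauer_char r (dsum_rep (tensor_rep V W') (tensor_rep W V')) T"
      using *(1-4) R by (simp add: brauer_char_dsum[OF two] brauer_char_tensor[OF two] algebra_simps)
  qed (use *(1-4) R in auto)
qed

lemma vrep_in: "V \<in> RP \<Longrightarrow> W \<in> RP \<Longrightarrow> vrep G V W \<in> carrier PR"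
  unfolding carrier_PR by blast

lemma PR_ops:
  assumes "x \<in> carrier PR" "y \<in> carrier PR"
  shows PR_add_closed: "x \<oplus>\<^bsub>PR\<^esub> y \<in> carrier PR" and PR_mult_closed: "x \<otimes>\<^bsub>PR\<^esub> y \<in> carrier PR"
    and ev_add: "ev T (x \<oplus>\<^bsub>PR\<^esub> y) = ev T x + ev T y" and ev_mult: "ev T (x \<otimes>\<^bsub>PR\<^esub> y) = ev T x * ev T y"
proof -
  obtain V W where x: "V \<in> RP" "W \<in> RP" "x = vrep G V W" using assms(1) by (rule carrierE)
  obtain V' W' where y: "V' \<in> RP" "W' \<in> RP" "y = vrep G V' W'" using assms(2) by (rule carrierE)
  note R = x(1,2) y(1,2)
  show "x \<oplus>\<^bsub>PR\<^esub> y \<in> carrier PR" "x \<otimes>\<^bsub>PR\<^esub> y \<in> carrier PR"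
    unfolding x(3) y(3) add_PR[OF R] mult_PR[OF R] using R by (simp_all add: vrep_in)
  show "ev T (x \<oplus>\<^bsub>PR\<^esub> y) = ev T x + ev T y"
    unfolding x(3) y(3) add_PR[OF R] using R by (simp add: ev_vrep brauer_char_dsum[OF two])
  show "ev T (x \<otimes>\<^bsub>PR\<^esub> y) = ev T x * ev T y"
    unfolding x(3) y(3) mult_PR[OF R] using R
    by (simp add: ev_vrep brauer_char_dsum[OF two] brauer_char_tensor[OF two] algebra_simps)
qed

lemma brauer_char_zero [simp]: "brauer_char r (zero_rep :: (nat \<Rightarrow> int, 'k) rep) T = 0"
proof -
  have "zero_rep = (char_sum r [] :: (nat \<Rightarrow> int, 'k) rep)"
    by (auto simp: zero_rep_def char_sum_def diag_rep_def diag_of_def intro!: eq_matI)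
  then show ?thesis using brauer_char_char_sum[OF two, of "[]" r T] by simp
qed

lemma brauer_char_triv [simp]: "brauer_char r (triv_rep :: (nat \<Rightarrow> int, 'k) rep) T = 1"
proof -
  have "triv_rep = (char_sum r [{}] :: (nat \<Rightarrow> int, 'k) rep)"
    by (auto simp: triv_rep_def char_sum_def diag_rep_def diag_of_def group_char_def subset_char_def intro!: eq_matI)
  then show ?thesis using brauer_char_char_sum[OF two, of "[{}]" r T] by (simp add: subset_char_def)
qed

lemma PR_consts: "\<zero>\<^bsub>PR\<^esub> \<in> carrier PR" "\<one>\<^bsub>PR\<^esub> \<in> carrier PR" "ev T \<zero>\<^bsub>PR\<^esub> = 0" "ev T \<one>\<^bsub>PR\<^esub> = 1"
proof -
  have "\<zero>\<^bsub>PR\<^esub> = vrep G zero_rep zero_rep" "\<one>\<^bsub>PR\<^esub> = vrep G triv_rep zero_rep"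
    by (simp_all add: plain_rep_ring_def rep_class_def)
  then show "\<zero>\<^bsub>PR\<^esub> \<in> carrier PR" "\<one>\<^bsub>PR\<^esub> \<in> carrier PR" "ev T \<zero>\<^bsub>PR\<^esub> = 0" "ev T \<one>\<^bsub>PR\<^esub> = 1"
    by (simp_all add: vrep_in ev_vrep)
qed

lemma PR_neg:
  assumes "x \<in> carrier PR" shows "\<exists>y\<in>carrier PR. \<forall>T. ev T y = - ev T x"
  using assms
proof (rule carrierE)
  fix V W assume x: "V \<in> RP" "W \<in> RP" "x = vrep G V W"
  then show ?thesis by (intro bexI[of _ "vrep G W V"]) (auto simp: ev_vrep vrep_in)
qed

lemma cring_PR: "cring PR"
proof (rule cring_by_homs[where h=ev and h'="ev {}"])
  fix x assume x: "x \<in> carrier PR"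
  then obtain y where "y \<in> carrier PR" "\<forall>T. ev T y = - ev T x" using PR_neg by blast
  then show "\<exists>y\<in>carrier PR. y \<oplus>\<^bsub>PR\<^esub> x = \<zero>\<^bsub>PR\<^esub>"
    using x by (intro bexI[of _ y] ev_inj) (auto simp: ev_add PR_consts PR_add_closed PR_mult_closed)
next
  fix x y assume "x \<in> carrier PR" "y \<in> carrier PR" "\<And>T. ev T x = ev T y"
  then show "x = y" by (rule ev_inj)
qed (simp_all add: PR_consts PR_add_closed PR_mult_closed ev_add ev_mult)

lemma K_simps [simp]: "carrier K = carrier PR" "monoid.mult K = monoid.mult PR" "add K = add PR" "one K = one PR" "zero K = zero PR"
  "lam K = rep_lam G" "aug K = rep_aug"
  by (simp_all add: rep_ring_def ring.defs aug_lambda_ring.defs)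

lemma cring_K: "cring K"
proof -
  interpret PR: cring PR by (rule cring_PR)
  show ?thesis
  proof (rule cring_by_homs[where h=ev and h'="ev {}"])
    fix x y assume "x \<in> carrier K" "y \<in> carrier K" "\<And>T. ev T x = ev T y"
    then show "x = y" by (intro ev_inj) simp_all
  qed (simp_all add: PR_consts ev_add ev_mult PR.add.l_inv_ex)
qed

sublocale K: cring K by (rule cring_K)

lemma ev_minus: "x \<in> carrier PR \<Longrightarrow> y \<in> carrier PR \<Longrightarrow> ev T (x \<ominus>\<^bsub>K\<^esub> y) = ev T x - ev T y"
proof -
  assume x: "x \<in> carrier PR" and y: "y \<in> carrier PR"
  have n: "\<ominus>\<^bsub>K\<^esub> y \<in> carrier PR" using K.a_inv_closed[of y] y by simp
  have "y \<oplus>\<^bsub>PR\<^esub> \<ominus>\<^bsub>K\<^esub> y = \<zero>\<^bsub>PR\<^esub>" using K.r_neg[of y] y by simp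
  then have "ev T y + ev T (\<ominus>\<^bsub>K\<^esub> y) = 0" using ev_add[OF y n, of T] by (simp add: PR_consts)
  then show ?thesis using ev_add[OF x n, of T] by (simp add: a_minus_def)
qed

lemma ev_finsum:
  assumes "finite A" "\<And>i. i \<in> A \<Longrightarrow> f i \<in> carrier PR"
  shows "finsum PR f A \<in> carrier PR" "ev T (finsum PR f A) = (\<Sum>i\<in>A. ev T (f i))"
proof -
  interpret PR: cring PR by (rule cring_PR)
  show "finsum PR f A \<in> carrier PR" using assms by (intro PR.finsum_closed) auto
  show "ev T (finsum PR f A) = (\<Sum>i\<in>A. ev T (f i))"
    using assms
  proof (induction A)
    case (insert x F)
    then have "f \<in> F \<rightarrow> carrier PR" "f x \<in> carrier PR" by auto
    then show ?case using insert by (simp add: PR.finsum_insert ev_add)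
  qed (simp add: PR_consts)
qed

section \<open>Lambda operations and gamma operations\<close>

lemma ev_rep_class: "V \<in> RP \<Longrightarrow> rep_class G V \<in> carrier PR" "V \<in> RP \<Longrightarrow> ev T (rep_class G V) = brauer_char r V T"
  by (simp_all add: rep_class_def vrep_in ev_vrep)

text \<open>At each \<open>T\<close>, the defining equations \<open>\<Sum>\<^sub>i \<lambda>\<^sup>i(W) l\<^sub>m\<^sub>-\<^sub>i = \<lambda>\<^sup>m(V)\<close> of the lambda operations on \<open>V - W\<close>
  say that the series of \<open>l\<close> is the quotient of the lambda series of \<open>V\<close> and \<open>W\<close>.\<close>

lemma lam_cond_iff:
  assumes l: "\<And>m. l m \<in> carrier PR" and R: "V \<in> RP" "W \<in> RP"
  shows "(\<forall>m. finsum PR (\<lambda>i. rep_class G (ext_rep i W) \<otimes>\<^bsub>PR\<^esub> l (m - i)) {..m} = rep_class G (ext_rep m V)) \<longleftrightarrow>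
    (\<forall>T. lambda_series r W T * Abs_fps (\<lambda>m. ev T (l m)) = lambda_series r V T)"
proof -
  let ?F = "\<lambda>m. finsum PR (\<lambda>i. rep_class G (ext_rep i W) \<otimes>\<^bsub>PR\<^esub> l (m - i)) {..m}"
  have c: "rep_class G (ext_rep i W) \<otimes>\<^bsub>PR\<^esub> l j \<in> carrier PR" for i j
    using R l by (intro PR_mult_closed ev_rep_class) auto
  have F: "?F m \<in> carrier PR" for m using c by (intro ev_finsum) auto
  have evF: "ev T (?F m) = fps_nth (lambda_series r W T * Abs_fps (\<lambda>m. ev T (l m))) m" for m T
  proof -
    have "ev T (?F m) = (\<Sum>i\<in>{..m}. ev T (rep_class G (ext_rep i W) \<otimes>\<^bsub>PR\<^esub> l (m - i)))"
      using c by (intro ev_finsum) auto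
    also have "\<dots> = (\<Sum>i\<in>{..m}. fps_nth (lambda_series r W T) i * ev T (l (m - i)))"
      using R l by (intro sum.cong) (auto simp: ev_mult ev_rep_class brauer_char_ext[OF two])
    finally show ?thesis by (simp add: fps_mult_nth atMost_atLeast0)
  qed
  have V: "rep_class G (ext_rep m V) \<in> carrier PR" "ev T (rep_class G (ext_rep m V)) = fps_nth (lambda_series r V T) m" for m T
    using R by (simp_all add: ev_rep_class brauer_char_ext[OF two])
  show ?thesis
  proof
    assume *: "\<forall>m. ?F m = rep_class G (ext_rep m V)"
    show "\<forall>T. lambda_series r W T * Abs_fps (\<lambda>m. ev T (l m)) = lambda_series r V T"
    proof (intro allI fps_ext)
      fix T m show "fps_nth (lambda_series r W T * Abs_fps (\<lambda>m. ev T (l m))) m = fps_nth (lambda_series r V T) m"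
        unfolding evF[symmetric] * [rule_format] V(2) ..
    qed
  next
    assume *: "\<forall>T. lambda_series r W T * Abs_fps (\<lambda>m. ev T (l m)) = lambda_series r V T"
    show "\<forall>m. ?F m = rep_class G (ext_rep m V)"
    proof
      fix m show "?F m = rep_class G (ext_rep m V)"
        by (rule ev_inj[OF F V(1)]) (simp only: evF V(2) *)
    qed
  qed
qed

lemma lambda_series_0: "fps_nth (lambda_series r V T) 0 = 1"
  by (simp add: lambda_series_def fps_power_zeroth)

lemma lambda_series_nonzero: "lambda_series r V T \<noteq> 0"
  using lambda_series_0[of V T] by auto

lemma lambda_series_1: 
  assumes "V \<in> RP" shows "fps_nth (lambda_series r V T) 1 = brauer_char r V T"
proof -
  have 0: "fps_nth ((1 + fps_X :: int fps) ^ n) 0 = 1" "fps_nth ((1 - fps_X :: int fps) ^ n) 0 = 1" for n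
    by (simp_all add: fps_power_zeroth)
  have p: "fps_nth ((1 + fps_X :: int fps) ^ n) 1 = int n" for n
  proof (induction n)
    case (Suc n)
    have "(1 + fps_X :: int fps) ^ Suc n = (1 + fps_X) ^ n + fps_X * (1 + fps_X) ^ n"
      by (simp only: power_Suc distrib_right mult_1)
    then show ?case using Suc 0 by (simp only: fps_add_nth fps_X_mult_nth) simp
  qed simp
  have q: "fps_nth ((1 - fps_X :: int fps) ^ n) 1 = - int n" for n
  proof (induction n)
    case (Suc n)
    have "(1 - fps_X :: int fps) ^ Suc n = (1 - fps_X) ^ n - fps_X * (1 - fps_X) ^ n"
      by (simp only: power_Suc left_diff_distrib mult_1)
    then show ?case using Suc 0 by (simp only: fps_sub_nth fps_X_mult_nth) simp
  qed simp
  have "fps_nth (A * B) 1 = fps_nth A 0 * fps_nth B 1 + fps_nth A 1 * fps_nth B 0" for A B :: "int fps"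
    by (simp add: fps_mult_nth)
  then have "fps_nth (lambda_series r V T) 1 = - int (neg_mult r V T) + int (rep_dim V - neg_mult r V T)"
    unfolding lambda_series_def by (simp only: 0 p q)
  then show ?thesis using neg_mult_le[OF two assms, of T] by (simp add: brauer_char_def)
qed

text \<open>The quotient of lambda series depends only on the class of \<open>V - W\<close>: equal characters, also at the
  identity, give equal sums of multiplicities of both eigenvalues.\<close>

lemma lambda_series_cross:
  assumes R: "V \<in> RP" "W \<in> RP" and VW': "(V', W') \<in> vrep G V W"
  shows "lambda_series r V T * lambda_series r W' T = lambda_series r V' T * lambda_series r W T"
proof -
  have R': "V' \<in> RP" "W' \<in> RP" and e: "\<And>T. brauer_char r V' T - brauer_char r W' T = brauer_char r V T - brauer_char r W T"
    using VW' R by (auto simp: vrep_iff)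
  note le = neg_mult_le[OF two R(1), of T] neg_mult_le[OF two R(2), of T]
    neg_mult_le[OF two R'(1), of T] neg_mult_le[OF two R'(2), of T]
  have d: "rep_dim V + rep_dim W' = rep_dim V' + rep_dim W"
    using e[of "{}"] R R' by (simp add: brauer_char_empty[OF _ two])
  have n: "neg_mult r V T + neg_mult r W' T = neg_mult r V' T + neg_mult r W T"
    using e[of T] d by (simp add: brauer_char_def)
  have p: "(rep_dim V - neg_mult r V T) + (rep_dim W' - neg_mult r W' T)
    = (rep_dim V' - neg_mult r V' T) + (rep_dim W - neg_mult r W T)"
    using d n le by linarith
  have "lambda_series r V T * lambda_series r W' T = (1 + fps_X) ^ ((rep_dim V - neg_mult r V T) + (rep_dim W' - neg_mult r W' T))
    * (1 - fps_X) ^ (neg_mult r V T + neg_mult r W' T)"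
    unfolding lambda_series_def power_add by (simp only: ac_simps)
  also have "\<dots> = lambda_series r V' T * lambda_series r W T"
    unfolding p n unfolding lambda_series_def power_add by (simp only: ac_simps)
  finally show ?thesis .
qed

text \<open>The equations can be solved recursively in the representation ring since \<open>\<lambda>\<^sup>0(W) = 1\<close>.\<close>

lemma lam_solution_ex:
  assumes R: "V \<in> RP" "W \<in> RP"
  shows "\<exists>l. (\<forall>m. l m \<in> carrier PR) \<and> (\<forall>T. lambda_series r W T * Abs_fps (\<lambda>m. ev T (l m)) = lambda_series r V T)"
proof -
  let ?w = "\<lambda>T. lambda_series r W T"
  (* The inverse of the lambda series of W. *)
  define z where "z = (\<lambda>T. geo_neg ^ (rep_dim W - neg_mult r W T) * geo_pos ^ neg_mult r W T)"
  have "?w T * z T = ((1 + fps_X) * geo_neg) ^ (rep_dim W - neg_mult r W T) * ((1 - fps_X) * geo_pos) ^ neg_mult r W T" for T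
    unfolding lambda_series_def z_def power_mult_distrib by (simp only: ac_simps)
  then have wz: "?w T * z T = 1" for T unfolding geo_neg geo_pos by simp
  define c where "c = (\<lambda>T. z T * lambda_series r V T)"
  have wc: "?w T * c T = lambda_series r V T" for T
    unfolding c_def mult.assoc[symmetric] wz by simp
  have "\<exists>x\<in>carrier PR. \<forall>T. ev T x = fps_nth (c T) m" for m
  proof (induction m rule: less_induct)
    case (less m)
    then obtain y where y: "\<And>j. j < m \<Longrightarrow> y j \<in> carrier PR" "\<And>j T. j < m \<Longrightarrow> ev T (y j) = fps_nth (c T) j"
      by metis
    let ?t = "\<lambda>i. rep_class G (ext_rep i W) \<otimes>\<^bsub>PR\<^esub> y (m - i)"
    have t: "?t i \<in> carrier PR" if "i \<in> {1..m}" for i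
      using that R y by (intro PR_mult_closed ev_rep_class) auto
    note fs = ev_finsum[of "{1..m}" ?t, OF _ t, simplified]
    let ?x = "rep_class G (ext_rep m V) \<ominus>\<^bsub>K\<^esub> finsum PR ?t {1..m}"
    have Vm: "rep_class G (ext_rep m V) \<in> carrier PR" using R by (intro ev_rep_class) auto
    have "ev T ?x = fps_nth (c T) m" for T
    proof -
      have "ev T (finsum PR ?t {1..m}) = (\<Sum>i\<in>{1..m}. ev T (?t i))" using t by (intro ev_finsum) auto
      also have "\<dots> = (\<Sum>i\<in>{1..m}. fps_nth (?w T) i * fps_nth (c T) (m - i))"
        using R y by (intro sum.cong) (auto simp: ev_mult ev_rep_class brauer_char_ext[OF two])
      finally have s: "ev T (finsum PR ?t {1..m}) = (\<Sum>i\<in>{1..m}. fps_nth (?w T) i * fps_nth (c T) (m - i))" .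
      have "fps_nth (lambda_series r V T) m = (\<Sum>i\<in>{0..m}. fps_nth (?w T) i * fps_nth (c T) (m - i))"
        unfolding wc[symmetric] by (rule fps_mult_nth)
      also have "\<dots> = fps_nth (c T) m + (\<Sum>i\<in>{1..m}. fps_nth (?w T) i * fps_nth (c T) (m - i))"
        by (subst sum.atLeast_Suc_atMost) (simp_all add: lambda_series_0)
      finally have "fps_nth (lambda_series r V T) m = fps_nth (c T) m + ev T (finsum PR ?t {1..m})" unfolding s .
      moreover have "ev T (rep_class G (ext_rep m V)) = fps_nth (lambda_series r V T) m"
        using R by (simp add: ev_rep_class brauer_char_ext[OF two])
      ultimately show ?thesis using ev_minus[OF Vm fs(1)] by simp
    qed
    moreover have "?x \<in> carrier PR" using K.minus_closed[of "rep_class G (ext_rep m V)" "finsum PR ?t {1..m}"] Vm fs(1) by simp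
    ultimately show ?case by blast
  qed
  then obtain l where l: "\<And>m. l m \<in> carrier PR" "\<And>m T. ev T (l m) = fps_nth (c T) m" by metis
  have "Abs_fps (\<lambda>m. ev T (l m)) = c T" for T by (rule fps_ext) (simp add: l)
  then show ?thesis using l(1) wc by (intro exI[of _ l]) simp
qed

text \<open>The lambda operations are defined by a definite description; a solution exists, serves all pairs in the
  class at once, and is unique because its values at every \<open>T\<close> are the coefficients of a quotient of series.\<close>

lemma rep_lam_spec:
  assumes R: "V \<in> RP" "W \<in> RP"
  shows "rep_lam G n (vrep G V W) \<in> carrier PR"
    "lambda_series r W T * Abs_fps (\<lambda>n. ev T (rep_lam G n (vrep G V W))) = lambda_series r V T"
proof -
  let ?x = "vrep G V W"
  define Sol where "Sol = (\<lambda>l :: nat \<Rightarrow> (nat \<Rightarrow> int, 'k) vrep. (\<forall>m. l m \<in> carrier PR) \<and>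
    (\<forall>(V, W)\<in>?x. \<forall>m. finsum PR (\<lambda>i. rep_class G (ext_rep i W) \<otimes>\<^bsub>PR\<^esub> l (m - i)) {..m} = rep_class G (ext_rep m V)))"
  have self: "(V, W) \<in> ?x" using R by (simp add: vrep_iff)
  have SolD: "lambda_series r W T * Abs_fps (\<lambda>m. ev T (l m)) = lambda_series r V T" if "Sol l" for l T
    using that self lam_cond_iff[of l V W] R unfolding Sol_def by blast
  obtain l where l: "\<And>m. l m \<in> carrier PR" "\<And>T. lambda_series r W T * Abs_fps (\<lambda>m. ev T (l m)) = lambda_series r V T"
    using lam_solution_ex[OF R] by blast
  have "Sol l" unfolding Sol_def
  proof (intro conjI allI ballI l(1))
    fix p assume p: "p \<in> ?x"
    obtain V' W' where p': "p = (V', W')" by (cases p)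
    have R': "V' \<in> RP" "W' \<in> RP" using p R unfolding p' by (auto simp: vrep_iff)
    have wl: "lambda_series r W' T * Abs_fps (\<lambda>m. ev T (l m)) = lambda_series r V' T" for T
    proof -
      have "lambda_series r W T * (lambda_series r W' T * Abs_fps (\<lambda>m. ev T (l m)))
        = lambda_series r W' T * (lambda_series r W T * Abs_fps (\<lambda>m. ev T (l m)))" by (simp only: ac_simps)
      also have "\<dots> = lambda_series r W T * lambda_series r V' T"
        unfolding l(2) using lambda_series_cross[OF R, of V' W' T] p unfolding p' by (simp only: ac_simps)
      finally show ?thesis using lambda_series_nonzero[of W T] by (metis mult_left_cancel)
    qed
    have "\<forall>m. finsum PR (\<lambda>i. rep_class G (ext_rep i W') \<otimes>\<^bsub>PR\<^esub> l (m - i)) {..m} = rep_class G (ext_rep m V')"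
      by (rule iffD2[OF lam_cond_iff[OF l(1) R']]) (intro allI wl)
    then show "case p of (V, W) \<Rightarrow> \<forall>m. finsum PR (\<lambda>i. rep_class G (ext_rep i W) \<otimes>\<^bsub>PR\<^esub> l (m - i)) {..m} = rep_class G (ext_rep m V)"
      unfolding p' by simp
  qed
  (* Uniqueness: power series over the integers have no zero divisors. *)
  moreover have "l1 = l2" if s: "Sol l1" "Sol l2" for l1 l2
  proof
    fix m
    have "Abs_fps (\<lambda>m. ev T (l1 m)) = Abs_fps (\<lambda>m. ev T (l2 m))" for T
      using SolD[OF s(1), of T] SolD[OF s(2), of T] lambda_series_nonzero[of W T] by (metis mult_left_cancel)
    then have "ev T (l1 m) = ev T (l2 m)" for T by (metis fps_nth_Abs_fps)
    then show "l1 m = l2 m" using s unfolding Sol_def by (intro ev_inj) auto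
  qed
  ultimately have ex1: "\<exists>!l. Sol l" by blast
  have eq: "(\<lambda>n. rep_lam G n ?x) = (THE l. Sol l)" unfolding rep_lam_def Sol_def ..
  have "Sol (\<lambda>n. rep_lam G n ?x)" unfolding eq by (rule theI'[OF ex1])
  then show "rep_lam G n (vrep G V W) \<in> carrier PR"
    "lambda_series r W T * Abs_fps (\<lambda>n. ev T (rep_lam G n (vrep G V W))) = lambda_series r V T"
    using SolD by (auto simp: Sol_def)
qed

lemma rep_aug_ev: assumes "x \<in> carrier PR" shows "rep_aug x = ev {} x"
  using assms
proof (rule carrierE)
  fix V W assume x: "V \<in> RP" "W \<in> RP" "x = vrep G V W"
  have d: "int (rep_dim A) - int (rep_dim B) = ev {} x" if "(A, B) \<in> x" for A B
  proof -
    have AB: "A \<in> RP" "B \<in> RP" "brauer_char r A {} - brauer_char r B {} = brauer_char r V {} - brauer_char r W {}"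
      using that x unfolding x(3) by (auto simp: vrep_iff)
    then show ?thesis using x by (simp add: ev_vrep brauer_char_empty[OF _ two])
  qed
  have self: "(V, W) \<in> x" using x by (simp add: vrep_iff)
  show ?thesis unfolding rep_aug_def
  proof (rule the_equality)
    show "\<forall>(V, W)\<in>x. ev {} x = int (rep_dim V) - int (rep_dim W)" using d by auto
    fix e assume "\<forall>(V, W)\<in>x. e = int (rep_dim V) - int (rep_dim W)"
    then show "e = ev {} x" using d self by fastforce
  qed
qed

lemma ev_int_elt: "int_elt K m \<in> carrier PR" "ev T (int_elt K m) = m"
proof -
  have n: "add_pow K n \<one>\<^bsub>K\<^esub> \<in> carrier PR \<and> ev T (add_pow K n \<one>\<^bsub>K\<^esub>) = int n" for n :: nat
  proof (induction n)
    case 0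
    then show ?case using K.add.nat_pow_0[of "\<one>\<^bsub>K\<^esub>"] by (simp add: PR_consts)
  next
    case (Suc n)
    then show ?case using K.add.nat_pow_Suc[of n "\<one>\<^bsub>K\<^esub>"] by (simp add: PR_consts ev_add PR_add_closed)
  qed
  have "int_elt K m \<in> carrier PR \<and> ev T (int_elt K m) = m"
  proof (cases "m \<ge> 0")
    case True
    then show ?thesis using n[of "nat m"] by (simp add: int_elt_def add_pow_int_ge)
  next
    case False
    let ?y = "add_pow K (nat (- m)) \<one>\<^bsub>K\<^esub>"
    have e: "int_elt K m = \<zero>\<^bsub>K\<^esub> \<ominus>\<^bsub>K\<^esub> ?y"
      using False n[of "nat (- m)"] by (simp add: int_elt_def add_pow_int_lt a_minus_def K.a_inv_closed[simplified] K.l_zero[simplified])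
    show ?thesis unfolding e
      using ev_minus[of "\<zero>\<^bsub>PR\<^esub>" ?y T] n[of "nat (- m)"] False K.minus_closed[of "\<zero>\<^bsub>K\<^esub>" ?y] by (simp add: PR_consts)
  qed
  then show "int_elt K m \<in> carrier PR" "ev T (int_elt K m) = m" by auto
qed

text \<open>The value of \<open>\<gamma>\<^sup>k(x)\<close> at \<open>T\<close> is the \<open>k\<close>th coefficient of a quotient of lambda series of two
  representations whose dimensions differ by \<open>k - 1\<close>. At the identity the quotient is
  \<open>(1 + t)\<^bsup>k-1\<^esup>\<close>, of degree less than \<open>k\<close>.\<close>

lemma gamma_facts:
  assumes x: "x \<in> carrier PR" "ev {} x = 0"
  shows gamma_in: "gamma_op K k x \<in> carrier PR"
    and gamma_dvd: "2 ^ k dvd ev T (gamma_op K k x)"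
    and gamma_aug: "k \<ge> 1 \<Longrightarrow> ev {} (gamma_op K k x) = 0"
    and gamma_1: "gamma_op K 1 x = x"
proof -
  have *: "gamma_op K k x \<in> carrier PR \<and> 2 ^ k dvd ev T (gamma_op K k x) \<and> (k \<ge> 1 \<longrightarrow> ev {} (gamma_op K k x) = 0)
     \<and> (k = 1 \<longrightarrow> ev T (gamma_op K k x) = ev T x)" for k T
  proof -
    let ?y = "x \<oplus>\<^bsub>PR\<^esub> int_elt K (int k - 1)"
    have y: "?y \<in> carrier PR" "ev T ?y = ev T x + (int k - 1)" for T
      using x by (simp_all add: ev_add ev_int_elt PR_add_closed)
    obtain V W where R: "V \<in> RP" "W \<in> RP" and yy: "?y = vrep G V W" using y(1) by (rule carrierE)
    have g: "gamma_op K k x = rep_lam G k (vrep G V W)" by (simp add: gamma_op_def yy)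
    have eT: "brauer_char r V T - brauer_char r W T = ev T x + (int k - 1)" for T
      using y(2)[of T] R unfolding yy by (simp add: ev_vrep)
    define L where "L = (\<lambda>T. Abs_fps (\<lambda>n. ev T (rep_lam G n (vrep G V W))))"
    have Lk: "fps_nth (L T) n = ev T (rep_lam G n (vrep G V W))" for T n by (simp add: L_def)
    have LT: "lambda_series r W T * L T = lambda_series r V T" for T unfolding L_def by (rule rep_lam_spec(2)[OF R])
    have L0: "fps_nth (L T) 0 = 1" for T
      using arg_cong[OF LT[of T], of "\<lambda>f. fps_nth f 0"] by (simp add: lambda_series_0)
    have d: "int (rep_dim V) = int (rep_dim W) + (int k - 1)"
      using eT[of "{}"] x(2) R by (simp add: brauer_char_empty[OF _ two])
    have le: "neg_mult r V T \<le> rep_dim V" "neg_mult r W T \<le> rep_dim W" for T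
      using neg_mult_le[OF two] R by auto
    have big: "2 ^ k dvd fps_nth (L T) k" if k: "k \<ge> 1" for T
      by (rule gamma_series_dvd(1)[OF LT[of T, unfolded lambda_series_def] _ k]) (use le[of T] d k in linarith)
    have nul: "fps_nth (L {}) k = 0" if k: "k \<ge> 1"
    proof (rule gamma_series_dvd(2)[OF LT[of "{}", unfolded lambda_series_def] _ k])
      show "rep_dim V - neg_mult r V {} + neg_mult r V {} = rep_dim W - neg_mult r W {} + neg_mult r W {} + (k - 1)"
        using le[of "{}"] d k by linarith
      have "neg_mult r V {} = 0" "neg_mult r W {} = 0"
        using brauer_char_empty[OF R(1) two] brauer_char_empty[OF R(2) two] by (simp_all add: brauer_char_def)
      then show "neg_mult r W {} = neg_mult r V {}" by simp
    qed
    have one: "fps_nth (L T) 1 = ev T x" if k: "k = 1"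
    proof -
      have "fps_nth (lambda_series r W T * L T) 1 = fps_nth (lambda_series r W T) 0 * fps_nth (L T) 1 + fps_nth (lambda_series r W T) 1 * fps_nth (L T) 0"
        by (simp add: fps_mult_nth)
      then show ?thesis using eT[of T] k unfolding LT by (simp add: lambda_series_0 L0 lambda_series_1[simplified] R)
    qed
    show ?thesis
      using rep_lam_spec(1)[OF R, of k] big[of T] nul one unfolding g Lk
      by (cases "k = 0") auto
  qed
  show "gamma_op K k x \<in> carrier PR" "2 ^ k dvd ev T (gamma_op K k x)" "k \<ge> 1 \<Longrightarrow> ev {} (gamma_op K k x) = 0"
    using *[of k T] by auto
  show "gamma_op K 1 x = x" using *[of 1] x by (intro ev_inj) auto
qed

lemma aug_ideal_iff: "x \<in> aug_ideal K \<longleftrightarrow> x \<in> carrier PR \<and> ev {} x = 0"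
  by (auto simp: aug_ideal_def rep_aug_ev)

lemma gamma_prod_Cons: "gamma_prod K ((k, x) # ps) = gamma_op K k x \<otimes>\<^bsub>PR\<^esub> gamma_prod K ps"
  by (simp add: gamma_prod_def)

lemma gamma_prod_facts:
  assumes "snd ` set ps \<subseteq> aug_ideal K"
  shows "gamma_prod K ps \<in> carrier PR" "2 ^ sum_list (map fst ps) dvd ev T (gamma_prod K ps)"
    "sum_list (map fst ps) \<ge> 1 \<Longrightarrow> ev {} (gamma_prod K ps) = 0"
proof -
  have "gamma_prod K ps \<in> carrier PR \<and> (\<forall>T. 2 ^ sum_list (map fst ps) dvd ev T (gamma_prod K ps)) \<and>
    (sum_list (map fst ps) \<ge> 1 \<longrightarrow> ev {} (gamma_prod K ps) = 0)"
    using assms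
  proof (induction ps)
    case Nil
    then show ?case by (simp add: gamma_prod_def PR_consts)
  next
    case (Cons p ps)
    obtain k x where p: "p = (k, x)" by (cases p)
    have x: "x \<in> carrier PR" "ev {} x = 0" using Cons.prems by (auto simp: p aug_ideal_iff)
    have IH: "gamma_prod K ps \<in> carrier PR" "\<And>T. 2 ^ sum_list (map fst ps) dvd ev T (gamma_prod K ps)"
      "sum_list (map fst ps) \<ge> 1 \<longrightarrow> ev {} (gamma_prod K ps) = 0" using Cons by auto
    note g = gamma_in[OF x, of k]
    have "2 ^ (k + sum_list (map fst ps)) dvd ev T (gamma_op K k x) * ev T (gamma_prod K ps)" for T
      unfolding power_add using gamma_dvd[OF x, of k T] IH(2)[of T] by (rule mult_dvd_mono)
    moreover have "ev {} (gamma_op K k x) * ev {} (gamma_prod K ps) = 0" if "k + sum_list (map fst ps) \<ge> 1"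
      using gamma_aug[OF x, of k] IH(3) that by (cases "k = 0") auto
    ultimately show ?case using g IH(1) unfolding p gamma_prod_Cons by (simp add: ev_mult PR_mult_closed)
  qed
  then show "gamma_prod K ps \<in> carrier PR" "2 ^ sum_list (map fst ps) dvd ev T (gamma_prod K ps)"
    "sum_list (map fst ps) \<ge> 1 \<Longrightarrow> ev {} (gamma_prod K ps) = 0" by auto
qed

section \<open>The gamma filtration\<close>

text \<open>The explicit description of the gamma filtration.\<close>

definition Fil :: "nat \<Rightarrow> (nat \<Rightarrow> int, 'k) vrep set"
  where "Fil n = {x \<in> carrier PR. n = 0 \<or> ev {} x = 0 \<and> (\<forall>T. 2 ^ n dvd ev T x)}"

text \<open>The generator \<open>\<epsilon>\<^sub>i - 1\<close> of the augmentation ideal, whose class in degree one is \<open>c\<^sub>1(\<epsilon>\<^sub>i)\<close>.\<close>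

definition aug_gen :: "nat \<Rightarrow> (nat \<Rightarrow> int, 'k) vrep"
  where "aug_gen i = rep_class G (char_sum r [{i}]) \<ominus>\<^bsub>K\<^esub> \<one>\<^bsub>K\<^esub>"

lemma aug_gen_facts:
  assumes i: "i \<in> {1..r}"
  shows "aug_gen i \<in> carrier PR" "ev T (aug_gen i) = (if i \<in> T then -2 else 0)" "aug_gen i \<in> aug_ideal K"
proof -
  have S: "\<forall>S\<in>set [{i}]. S \<subseteq> {1..r}" using i by auto
  note c = ev_rep_class[OF char_sum_in[OF S]] 
  show x: "aug_gen i \<in> carrier PR" using c(1) K.minus_closed[OF _ K.one_closed] by (simp add: aug_gen_def)
  have "ev T (aug_gen i) = subset_char {i} T - 1" for T
    unfolding aug_gen_def using c ev_minus[of "rep_class G (char_sum r [{i}])" "\<one>\<^bsub>PR\<^esub>" T]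
    by (simp add: PR_consts brauer_char_char_sum[OF two S])
  then show e: "ev T (aug_gen i) = (if i \<in> T then -2 else 0)" for T by (simp add: subset_char_prod)
  show "aug_gen i \<in> aug_ideal K" using x e by (simp add: aug_ideal_iff)
qed

text \<open>A product of generators, written as a product of values of \<open>\<gamma>\<^sup>1\<close>.\<close>

definition aug_gen_prod :: "nat list \<Rightarrow> (nat \<Rightarrow> int, 'k) vrep"
  where "aug_gen_prod ls = gamma_prod K (map (\<lambda>i. (1, aug_gen i)) ls)"

lemma aug_gen_prod_facts:
  assumes "set ls \<subseteq> {1..r}"
  shows "aug_gen_prod ls \<in> carrier PR" "ev T (aug_gen_prod ls) = (if set ls \<subseteq> T then (-2) ^ length ls else 0)"
proof -
  have "aug_gen_prod ls \<in> carrier PR \<and> ev T (aug_gen_prod ls) = (if set ls \<subseteq> T then (-2) ^ length ls else 0)"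
    using assms
  proof (induction ls)
    case Nil
    then show ?case by (simp add: aug_gen_prod_def gamma_prod_def PR_consts)
  next
    case (Cons i ls)
    then have i: "i \<in> {1..r}" by simp
    note x = aug_gen_facts[OF i]
    have "aug_gen_prod (i # ls) = gamma_op K 1 (aug_gen i) \<otimes>\<^bsub>PR\<^esub> aug_gen_prod ls"
      unfolding aug_gen_prod_def list.map gamma_prod_Cons ..
    also have "gamma_op K 1 (aug_gen i) = aug_gen i" using x by (intro gamma_1) auto
    finally show ?case using Cons x by (auto simp: ev_mult PR_mult_closed)
  qed
  then show "aug_gen_prod ls \<in> carrier PR" "ev T (aug_gen_prod ls) = (if set ls \<subseteq> T then (-2) ^ length ls else 0)" by auto
qed

text \<open>From \<open>\<epsilon>\<^sub>i = 1 + x\<^sub>i\<close> one gets \<open>\<chi>\<^sub>U = \<Prod>\<^sub>i\<^sub>\<in>\<^sub>U (1 + x\<^sub>i)\<close>, and the product of the \<open>x\<^sub>i\<close> with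
  \<open>i \<in> S\<close> has value \<open>(-2)\<^bsup>|S|\<^esup>\<close> at the \<open>T\<close> that contain \<open>S\<close>, and \<open>0\<close> elsewhere.\<close>

lemma subset_char_expand:
  assumes U: "U \<subseteq> {1..r}"
  shows "subset_char U T = (\<Sum>S\<in>Pow {1..r}. if S \<subseteq> T then (if S \<subseteq> U then 1 else 0) * (-2) ^ card S else 0)"
proof -
  have f: "finite U" using U finite_subset by blast
  have "subset_char U T = (\<Prod>i\<in>U. 1 + (if i \<in> T then -2 else 0))"
    unfolding subset_char_prod[OF f] by (rule prod.cong) auto
  also have "\<dots> = (\<Sum>S\<in>Pow U. \<Prod>i\<in>S. if i \<in> T then -2 else 0)" by (rule sum_prod_Pow[OF f])
  also have "\<dots> = (\<Sum>S\<in>Pow U. if S \<subseteq> T then (-2) ^ card S else 0)"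
  proof (rule sum.cong[OF refl])
    fix S assume "S \<in> Pow U"
    then have fS: "finite S" using f finite_subset by blast
    show "(\<Prod>i\<in>S. if i \<in> T then -2 else 0) = (if S \<subseteq> T then (-2) ^ card S else (0::int))"
    proof (cases "S \<subseteq> T")
      case True
      then have "(\<Prod>i\<in>S. if i \<in> T then -2 else 0) = (\<Prod>i\<in>S. (-2::int))" by (intro prod.cong) auto
      then show ?thesis using True by simp
    next
      case False
      then show ?thesis using fS by (auto intro!: prod_zero)
    qed
  qed
  also have "\<dots> = (\<Sum>S\<in>Pow {1..r}. if S \<subseteq> T then (if S \<subseteq> U then 1 else 0) * (-2) ^ card S else 0)"
    using U by (intro sum.mono_neutral_cong_left) auto
  finally show ?thesis .
qed

text \<open>The squarefree products of the \<open>x\<^sub>i\<close> span the representation ring.\<close>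

lemma ev_expand:
  assumes "x \<in> carrier PR"
  shows "\<exists>a. \<forall>T. ev T x = (\<Sum>S\<in>Pow {1..r}. if S \<subseteq> T then a S * (-2) ^ card S else 0)"
proof -
  have add: "(\<Sum>S\<in>Pow {1..r}. if S \<subseteq> T then a S * (-2) ^ card S else 0) + c * (\<Sum>S\<in>Pow {1..r}. if S \<subseteq> T then b S * (-2) ^ card S else 0)
    = (\<Sum>S\<in>Pow {1..r}. if S \<subseteq> T then (a S + c * b S) * (-2) ^ card S else 0)" for a b :: "nat set \<Rightarrow> int" and c and T :: "nat set"
    unfolding sum_distrib_left sum.distrib[symmetric] by (rule sum.cong) (auto simp: algebra_simps)
  have one: "\<exists>a. \<forall>T. brauer_char r V T = (\<Sum>S\<in>Pow {1..r}. if S \<subseteq> T then a S * (-2) ^ card S else 0)" if V: "V \<in> RP" for V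
  proof -
    obtain Ss where Ss: "\<forall>S\<in>set Ss. S \<subseteq> {1..r}" "rep_iso G V (char_sum r Ss)" using ex_char_sum[OF two V] by blast
    have "brauer_char r V T = (\<Sum>S\<leftarrow>Ss. subset_char S T)" for T
      using brauer_char_iso(1)[OF Ss(2) V char_sum_in[OF Ss(1)]] brauer_char_char_sum[OF two Ss(1)] by simp
    moreover have "\<exists>a. \<forall>T. (\<Sum>S\<leftarrow>Ss. subset_char S T) = (\<Sum>S\<in>Pow {1..r}. if S \<subseteq> T then a S * (-2) ^ card S else 0)"
      using Ss(1)
    proof (induction Ss)
      case Nil
      show ?case by (intro exI[of _ "\<lambda>_. 0"]) (simp cong: if_cong)
    next
      case (Cons U Ss)
      then obtain a where a: "\<And>T. (\<Sum>S\<leftarrow>Ss. subset_char S T) = (\<Sum>S\<in>Pow {1..r}. if S \<subseteq> T then a S * (-2) ^ card S else 0)" by auto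
      have U: "U \<subseteq> {1..r}" using Cons.prems by simp
      have "(\<Sum>S\<leftarrow>U # Ss. subset_char S T) = (\<Sum>S\<in>Pow {1..r}. if S \<subseteq> T then ((if S \<subseteq> U then 1 else 0) + 1 * a S) * (-2) ^ card S else 0)" for T
        unfolding add[symmetric] using a[of T] subset_char_expand[OF U, of T] by simp
      then show ?case by (intro exI[of _ "\<lambda>S. (if S \<subseteq> U then 1 else 0) + 1 * a S"] allI)
    qed
    ultimately show ?thesis by simp
  qed
  obtain V W where R: "V \<in> RP" "W \<in> RP" and x: "x = vrep G V W" using assms by (rule carrierE)
  obtain a where a: "\<And>T. brauer_char r V T = (\<Sum>S\<in>Pow {1..r}. if S \<subseteq> T then a S * (-2) ^ card S else 0)" using one[OF R(1)] by blast
  obtain b where b: "\<And>T. brauer_char r W T = (\<Sum>S\<in>Pow {1..r}. if S \<subseteq> T then b S * (-2) ^ card S else 0)" using one[OF R(2)] by blast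
  have "ev T x = (\<Sum>S\<in>Pow {1..r}. if S \<subseteq> T then (a S + (-1) * b S) * (-2) ^ card S else 0)" for T
    unfolding add[symmetric] x ev_vrep[OF R] a b by simp
  then show ?thesis by (intro exI[of _ "\<lambda>S. a S + (-1) * b S"] allI)
qed

text \<open>With \<open>x = \<Sum>\<^sub>S a\<^sub>S x\<^sub>S\<close> over squarefree products \<open>x\<^sub>S\<close>, the numbers \<open>2\<^sup>n c\<^sub>S = a\<^sub>S (-2)\<^bsup>|S|\<^esup>\<close>
  are obtained from the values of \<open>x\<close> by inclusion-exclusion, and hence divisible by \<open>2\<^sup>n\<close>. The second
  conclusion remembers that \<open>a\<^sub>S\<close> is an integer.\<close>

lemma Fil_coeffs:
  assumes x: "x \<in> Fil n"
  shows "\<exists>c. (\<forall>T. ev T x = 2 ^ n * (\<Sum>S\<in>Pow {1..r}. if S \<subseteq> T then c S else 0)) \<and>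
    (\<forall>S. 2 ^ card S dvd 2 ^ n * c S) \<and> (n \<ge> 1 \<longrightarrow> c {} = (0::int))"
proof -
  have xc: "x \<in> carrier PR" using x by (simp add: Fil_def)
  have dv: "2 ^ n dvd ev T x" for T using x by (auto simp: Fil_def)
  obtain a where a: "\<And>T. ev T x = (\<Sum>S\<in>Pow {1..r}. if S \<subseteq> T then a S * (-2) ^ card S else 0)"
    using ev_expand[OF xc] by blast
  have aS: "2 ^ n dvd a S * (-2) ^ card S" if "S \<subseteq> {1..r}" for S
  proof -
    have "finite S" using that finite_subset by blast
    then show ?thesis using that
    proof (induction S rule: finite_psubset_induct)
      case (psubset S)
      have "ev S x = (\<Sum>U\<in>Pow S. a U * (-2) ^ card U)"
        unfolding a using psubset.prems by (intro sum.mono_neutral_cong_right) auto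
      also have "\<dots> = a S * (-2) ^ card S + (\<Sum>U\<in>Pow S - {S}. a U * (-2) ^ card U)"
        using psubset.hyps by (subst sum.remove[of _ S]) auto
      finally have "a S * (-2) ^ card S = ev S x - (\<Sum>U\<in>Pow S - {S}. a U * (-2) ^ card U)" by simp
      moreover have "2 ^ n dvd (\<Sum>U\<in>Pow S - {S}. a U * (-2) ^ card U)"
        using psubset.IH psubset.prems by (intro dvd_sum) auto
      ultimately show ?case using dv[of S] by simp
    qed
  qed
  define c where "c = (\<lambda>S. if S \<subseteq> {1..r} then a S * (-2) ^ card S div 2 ^ n else 0)"
  have c: "2 ^ n * c S = a S * (-2) ^ card S" if "S \<subseteq> {1..r}" for S
    using aS[OF that] that by (simp add: c_def)
  have "ev T x = 2 ^ n * (\<Sum>S\<in>Pow {1..r}. if S \<subseteq> T then c S else 0)" for T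
    unfolding a sum_distrib_left by (rule sum.cong) (auto simp: c)
  moreover have "2 ^ card S dvd 2 ^ n * c S" for S
  proof (cases "S \<subseteq> {1..r}")
    case True
    have "(2::int) ^ card S dvd (-2) ^ card S" by (metis dvd_refl minus_dvd_iff power_minus_Bit0 dvd_power_same dvd_minus_iff)
    then show ?thesis unfolding c[OF True] by simp
  qed (simp add: c_def)
  moreover have "c {} = 0" if n: "n \<ge> 1"
  proof -
    have "ev {} x = (\<Sum>S\<in>{{}}. a S * (-2) ^ card S)"
      unfolding a by (intro sum.mono_neutral_cong_right) auto
    then have "a {} = 0" using x n by (simp add: Fil_def)
    then show ?thesis using c[of "{}"] by simp
  qed
  ultimately show ?thesis by blast
qed

lemma K_a_inv: "y \<in> carrier PR \<Longrightarrow> inv\<^bsub>add_monoid K\<^esub> y \<in> carrier PR"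
  "y \<in> carrier PR \<Longrightarrow> ev T (inv\<^bsub>add_monoid K\<^esub> y) = - ev T y"
proof -
  assume y: "y \<in> carrier PR"
  have "inv\<^bsub>add_monoid K\<^esub> y = \<ominus>\<^bsub>K\<^esub> y" by (simp add: a_inv_def)
  moreover have "\<ominus>\<^bsub>K\<^esub> y \<in> carrier PR" using K.a_inv_closed y by simp
  moreover have "ev T (\<zero>\<^bsub>K\<^esub> \<ominus>\<^bsub>K\<^esub> y) = - ev T y" using ev_minus[of "\<zero>\<^bsub>PR\<^esub>" y T] y by (simp add: PR_consts)
  moreover have "\<zero>\<^bsub>K\<^esub> \<ominus>\<^bsub>K\<^esub> y = \<ominus>\<^bsub>K\<^esub> y" using K.l_zero[of "\<ominus>\<^bsub>K\<^esub> y"] K.a_inv_closed[of y] y by (simp add: a_minus_def)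
  ultimately show "inv\<^bsub>add_monoid K\<^esub> y \<in> carrier PR" "ev T (inv\<^bsub>add_monoid K\<^esub> y) = - ev T y" by simp_all
qed

text \<open>One inclusion is the divisibility of values of gamma operations. For the other, each term \<open>a\<^sub>S x\<^sub>S\<close> of
  \<open>x\<close> is an integral multiple of a product of at least \<open>n\<close> generators: if \<open>|S| < n\<close>, the missing
  power of 2 dividing \<open>a\<^sub>S\<close> is traded for extra factors, since \<open>x\<^sub>i\<^sup>2 = -2 x\<^sub>i\<close>.\<close>

theorem gamma_filt_eq: "gamma_filt K n = Fil n"
proof (cases "n = 0")
  case True
  then show ?thesis by (simp add: gamma_filt_def Fil_def)
next
  case n: False
  define H where "H = {gamma_prod K ps |ps. snd ` set ps \<subseteq> aug_ideal K \<and> n \<le> sum_list (map fst ps)}"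
  define \<Gamma> where "\<Gamma> = generate (add_monoid K) H"
  have H: "h \<in> carrier PR \<and> ev {} h = 0 \<and> (\<forall>T. 2 ^ n dvd ev T h)" if h: "h \<in> H" for h
  proof -
    obtain ps where ps: "h = gamma_prod K ps" "snd ` set ps \<subseteq> aug_ideal K" "n \<le> sum_list (map fst ps)"
      using h by (auto simp: H_def)
    have "(2::int) ^ n dvd 2 ^ sum_list (map fst ps)" using ps(3) by (rule le_imp_power_dvd)
    then show ?thesis using gamma_prod_facts[OF ps(2)] n ps(1,3) by (auto intro: dvd_trans)
  qed
  have sub: "subgroup \<Gamma> (add_monoid K)"
    unfolding \<Gamma>_def by (rule K.add.generate_is_subgroup) (use H in auto)
  have "\<Gamma> = Fil n"
  proof
    show "\<Gamma> \<subseteq> Fil n"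
    proof
      fix x assume "x \<in> \<Gamma>"
      then have "x \<in> carrier PR \<and> ev {} x = 0 \<and> (\<forall>T. 2 ^ n dvd ev T x)" unfolding \<Gamma>_def
      proof (induction x rule: generate.induct)
        case one
        then show ?case by (simp add: PR_consts)
      next
        case (incl h)
        then show ?case by (rule H)
      next
        case (inv h)
        then have h: "h \<in> carrier PR" using H[OF inv] by simp
        show ?case unfolding K_a_inv(2)[OF h] using K_a_inv(1)[OF h] H[OF inv] by (intro conjI allI) simp_all
      next
        case (eng h1 h2)
        then show ?case by (simp add: ev_add PR_add_closed)
      qed
      then show "x \<in> Fil n" by (simp add: Fil_def)
    qed
  next
    show "Fil n \<subseteq> \<Gamma>"
    proof
      fix x assume x: "x \<in> Fil n"
      then have xc: "x \<in> carrier PR" by (simp add: Fil_def)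
      obtain c where c: "\<And>T. ev T x = 2 ^ n * (\<Sum>S\<in>Pow {1..r}. if S \<subseteq> T then c S else 0)"
        "\<And>S. 2 ^ card S dvd 2 ^ n * c S" "c {} = (0::int)" using Fil_coeffs[OF x] n by auto
      have \<Gamma>c: "y \<in> carrier PR" if "y \<in> \<Gamma>" for y using subgroup.subset[OF sub] that by auto
      have zero: "\<zero>\<^bsub>PR\<^esub> \<in> \<Gamma>" using subgroup.one_closed[OF sub] by simp
      have plus: "y \<oplus>\<^bsub>PR\<^esub> z \<in> \<Gamma>" if "y \<in> \<Gamma>" "z \<in> \<Gamma>" for y z using subgroup.m_closed[OF sub that] by simp
      have minus: "inv\<^bsub>add_monoid K\<^esub> y \<in> \<Gamma>" if "y \<in> \<Gamma>" for y using subgroup.m_inv_closed[OF sub that] .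
      have nmult: "\<exists>z\<in>\<Gamma>. \<forall>T. ev T z = int m * ev T y" if "y \<in> \<Gamma>" for y m
      proof (induction m)
        case 0
        then show ?case using zero by (intro bexI[of _ "\<zero>\<^bsub>PR\<^esub>"]) (simp_all add: PR_consts)
      next
        case (Suc m)
        then obtain z where "z \<in> \<Gamma>" "\<forall>T. ev T z = int m * ev T y" by blast
        then show ?case using that \<Gamma>c plus by (intro bexI[of _ "y \<oplus>\<^bsub>PR\<^esub> z"]) (auto simp: ev_add algebra_simps)
      qed
      have mult: "\<exists>z\<in>\<Gamma>. \<forall>T. ev T z = m * ev T y" if y: "y \<in> \<Gamma>" for y m
      proof (cases "m \<ge> 0")
        case True
        then show ?thesis using nmult[OF y, of "nat m"] by simp
      next
        case False
        obtain z where z: "z \<in> \<Gamma>" "\<forall>T. ev T z = int (nat (- m)) * ev T y" using nmult[OF y] by blast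
        have "\<forall>T. ev T (inv\<^bsub>add_monoid K\<^esub> z) = m * ev T y"
          using K_a_inv(2)[OF \<Gamma>c[OF z(1)]] z(2) False by simp
        then show ?thesis using minus[OF z(1)] by blast
      qed
      have summand: "\<exists>z\<in>\<Gamma>. \<forall>T. ev T z = 2 ^ n * (if S \<subseteq> T then c S else 0)" if S: "S \<subseteq> {1..r}" for S
      proof (cases "S = {}")
        case True
        then show ?thesis using zero c(3) by (intro bexI[of _ "\<zero>\<^bsub>PR\<^esub>"]) (simp_all add: PR_consts)
      next
        case False
        have f: "finite S" using S finite_subset by blast
        obtain i where i: "i \<in> S" using False by blast
        (* Pad the product over S with copies of one generator up to at least n factors. *)
        define ls where "ls = sorted_list_of_set S @ replicate (n - card S) i"
        have ls: "set ls = S" using f i by (auto simp: ls_def)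
        have len: "length ls = max n (card S)" using f by (auto simp: ls_def)
        have "aug_gen_prod ls \<in> H" unfolding H_def
        proof (intro CollectI exI[of _ "map (\<lambda>i. (1, aug_gen i)) ls"] conjI)
          show "snd ` set (map (\<lambda>i. (1, aug_gen i)) ls) \<subseteq> aug_ideal K" using aug_gen_facts(3) ls S by auto
          have "sum_list (map fst (map (\<lambda>i. (1::nat, aug_gen i)) ls)) = length ls" by (induction ls) auto
          then show "n \<le> sum_list (map fst (map (\<lambda>i. (1, aug_gen i)) ls))" using len by simp
        qed (simp add: aug_gen_prod_def)
        then have "aug_gen_prod ls \<in> \<Gamma>" unfolding \<Gamma>_def by (rule generate.incl)
        have "(2::int) ^ length ls dvd 2 ^ n * c S" using c(2)[of S] len by (cases "n \<le> card S") auto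
        then obtain b where "2 ^ n * c S = 2 ^ length ls * b" by blast
        also have "(2::int) ^ length ls = (-2) ^ length ls * (-1) ^ length ls" by (simp flip: power_mult_distrib)
        finally have b: "2 ^ n * c S = ((-1) ^ length ls * b) * (-2) ^ length ls" by simp
        obtain z where "z \<in> \<Gamma>" "\<forall>T. ev T z = ((-1) ^ length ls * b) * ev T (aug_gen_prod ls)"
          using mult[OF \<open>aug_gen_prod ls \<in> \<Gamma>\<close>] by blast
        then show ?thesis using b aug_gen_prod_facts(2)[of ls] ls S by (intro bexI[of _ z]) auto
      qed
      have "\<exists>z\<in>\<Gamma>. \<forall>T. ev T z = (\<Sum>S\<in>F. 2 ^ n * (if S \<subseteq> T then c S else 0))" if "finite F" "F \<subseteq> Pow {1..r}" for F
        using that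
      proof (induction F)
        case empty
        then show ?case using zero by (intro bexI[of _ "\<zero>\<^bsub>PR\<^esub>"]) (simp_all add: PR_consts)
      next
        case (insert S F)
        then obtain z where z: "z \<in> \<Gamma>" "\<forall>T. ev T z = (\<Sum>S\<in>F. 2 ^ n * (if S \<subseteq> T then c S else 0))" by auto
        obtain y where y: "y \<in> \<Gamma>" "\<forall>T. ev T y = 2 ^ n * (if S \<subseteq> T then c S else 0)" using summand[of S] insert.prems by auto
        have "\<forall>T. ev T (y \<oplus>\<^bsub>PR\<^esub> z) = (\<Sum>S\<in>insert S F. 2 ^ n * (if S \<subseteq> T then c S else 0))"
          using y z \<Gamma>c insert.hyps by (simp add: ev_add)
        then show ?case using plus[OF y(1) z(1)] by blast
      qed
      from this[of "Pow {1..r}"] obtain z where z: "z \<in> \<Gamma>" "\<forall>T. ev T z = (\<Sum>S\<in>Pow {1..r}. 2 ^ n * (if S \<subseteq> T then c S else 0))" by auto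
      have "x = z" using xc \<Gamma>c[OF z(1)] by (rule ev_inj) (simp only: c(1) z(2)[rule_format] sum_distrib_left)
      then show "x \<in> \<Gamma>" using z(1) by simp
    qed
  qed
  then show ?thesis using n by (simp add: gamma_filt_def \<Gamma>_def H_def)
qed

end

section \<open>Cosets of the gamma filtration\<close>

lemma of_int_bit_eq_iff: "(of_int a :: bit) = of_int b \<longleftrightarrow> 2 dvd a - b"
proof -
  have e: "(of_int c :: bit) = 0 \<longleftrightarrow> 2 dvd c" for c
  proof
    assume 0: "(of_int c :: bit) = 0"
    show "2 dvd c"
    proof (rule ccontr)
      assume "\<not> 2 dvd c"
      then obtain k where "c = 2 * k + 1" by (meson oddE)
      then have "(of_int c :: bit) = 2 * of_int k + 1" by simp
      then show False using 0 by simp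
    qed
  next
    assume "2 dvd c"
    then obtain k where "c = 2 * k" by blast
    then have "(of_int c :: bit) = 2 * of_int k" by simp
    then show "(of_int c :: bit) = 0" by simp
  qed
  have "(of_int a :: bit) = of_int b \<longleftrightarrow> (of_int (a - b) :: bit) = 0" 
    unfolding of_int_diff by (rule eq_iff_diff_eq_0)
  then show ?thesis by (simp only: e)
qed

context elem_ab_2_reps
begin

definition gcos :: "nat \<Rightarrow> (nat \<Rightarrow> int, 'k) vrep \<Rightarrow> (nat \<Rightarrow> int, 'k) vrep set"
  where "gcos n x = Fil (Suc n) +>\<^bsub>K\<^esub> x"

abbreviation FM :: "nat \<Rightarrow> (nat \<Rightarrow> int, 'k) vrep monoid"
  where "FM n \<equiv> \<lparr>carrier = Fil n, monoid.mult = add K, one = \<zero>\<^bsub>K\<^esub>\<rparr>"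

lemma gr_piece_eq: "gr_piece K n = FM n Mod Fil (Suc n)"
  by (simp add: gr_piece_def gamma_filt_eq)

lemma Fil_carrier: "x \<in> Fil n \<Longrightarrow> x \<in> carrier PR" by (simp add: Fil_def)

lemma Fil_zero: "\<zero>\<^bsub>PR\<^esub> \<in> Fil n" by (simp add: Fil_def PR_consts)

lemma Fil_add: "x \<in> Fil n \<Longrightarrow> y \<in> Fil n \<Longrightarrow> x \<oplus>\<^bsub>PR\<^esub> y \<in> Fil n"
  by (auto simp: Fil_def PR_add_closed ev_add)

lemma Fil_dvd: "x \<in> Fil n \<Longrightarrow> 2 ^ n dvd ev T x"
  by (auto simp: Fil_def)

lemma Fil_minus: "x \<in> Fil n \<Longrightarrow> y \<in> Fil n \<Longrightarrow> x \<ominus>\<^bsub>K\<^esub> y \<in> Fil n"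
  using K.minus_closed[of x y] by (auto simp: Fil_def ev_minus)

lemma Fil_mult: "x \<in> Fil i \<Longrightarrow> y \<in> Fil j \<Longrightarrow> x \<otimes>\<^bsub>PR\<^esub> y \<in> Fil (i + j)"
  by (auto simp: Fil_def PR_mult_closed ev_mult power_add mult_dvd_mono intro: dvd_trans)

lemma Fil_mono: "x \<in> Fil (Suc n) \<Longrightarrow> x \<in> Fil n"
  using dvd_trans[OF le_imp_power_dvd[of n "Suc n" "2::int"]] by (auto simp: Fil_def simp del: power_Suc)

lemma comm_group_FM: "comm_group (FM n)"
proof -
  have "\<exists>y\<in>Fil n. y \<oplus>\<^bsub>PR\<^esub> x = \<zero>\<^bsub>PR\<^esub>" if x: "x \<in> Fil n" for x
  proof (intro bexI ev_inj)
    let ?y = "\<zero>\<^bsub>PR\<^esub> \<ominus>\<^bsub>K\<^esub> x"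
    show y: "?y \<in> Fil n" using Fil_minus[OF Fil_zero x] .
    show "?y \<oplus>\<^bsub>PR\<^esub> x \<in> carrier PR" using Fil_carrier[OF y] Fil_carrier[OF x] by (rule PR_add_closed)
    show "ev T (?y \<oplus>\<^bsub>PR\<^esub> x) = ev T \<zero>\<^bsub>PR\<^esub>" for T
      using Fil_carrier[OF x] Fil_carrier[OF y] by (simp add: ev_add ev_minus PR_consts)
  qed (rule PR_consts)
  then show ?thesis
    by (intro comm_groupI) (auto simp: Fil_add Fil_zero Fil_carrier
      K.a_assoc[simplified] K.a_comm[simplified] K.l_zero[simplified] K.r_zero[simplified])
qed

lemma subgroup_Fil: "subgroup (Fil (Suc n)) (FM n)"
proof -
  interpret comm_group "FM n" by (rule comm_group_FM)
  show ?thesis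
  proof (rule subgroupI)
    show "Fil (Suc n) \<subseteq> carrier (FM n)" using Fil_mono by auto
    show "Fil (Suc n) \<noteq> {}" using Fil_zero by auto
    fix a assume a: "a \<in> Fil (Suc n)"
    let ?y = "\<zero>\<^bsub>PR\<^esub> \<ominus>\<^bsub>K\<^esub> a"
    have y: "?y \<in> Fil (Suc n)" using Fil_minus[OF Fil_zero a] .
    have "?y \<oplus>\<^bsub>PR\<^esub> a = \<zero>\<^bsub>PR\<^esub>"
      by (rule ev_inj) (use Fil_carrier[OF a] Fil_carrier[OF y] in \<open>auto simp: ev_add ev_minus PR_consts PR_add_closed\<close>)
    then have "inv\<^bsub>FM n\<^esub> a = ?y" using Fil_mono[OF y] Fil_mono[OF a] by (intro inv_equality) auto
    then show "inv\<^bsub>FM n\<^esub> a \<in> Fil (Suc n)" using y by simp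
  qed (auto simp: Fil_add)
qed

lemma normal_Fil: "normal (Fil (Suc n)) (FM n)"
  by (rule comm_group.normal_iff_subgroup[OF comm_group_FM, THEN iffD2]) (rule subgroup_Fil)

lemma comm_group_gr_piece: "comm_group (gr_piece K n)"
  unfolding gr_piece_eq by (rule comm_group.abelian_FactGroup[OF comm_group_FM subgroup_Fil])

lemma gcos_rcoset: "gcos n x = r_coset (FM n) (Fil (Suc n)) x"
  by (simp add: gcos_def a_r_coset_def r_coset_def)

text \<open>The value at the identity must agree exactly because it vanishes on the next filtration step.\<close>

lemma gcos_iff:
  assumes x: "x \<in> carrier PR"
  shows "y \<in> gcos n x \<longleftrightarrow> y \<in> carrier PR \<and> ev {} y = ev {} x \<and> (\<forall>T. 2 ^ Suc n dvd ev T y - ev T x)"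
proof
  assume "y \<in> gcos n x"
  then obtain h where h: "h \<in> Fil (Suc n)" "y = h \<oplus>\<^bsub>PR\<^esub> x" by (auto simp: gcos_rcoset r_coset_def)
  then show "y \<in> carrier PR \<and> ev {} y = ev {} x \<and> (\<forall>T. 2 ^ Suc n dvd ev T y - ev T x)"
    using x Fil_carrier[OF h(1)] Fil_dvd[OF h(1)] by (auto simp: ev_add PR_add_closed Fil_def)
next
  assume y: "y \<in> carrier PR \<and> ev {} y = ev {} x \<and> (\<forall>T. 2 ^ Suc n dvd ev T y - ev T x)"
  let ?h = "y \<ominus>\<^bsub>K\<^esub> x"
  have hc: "?h \<in> carrier PR" using K.minus_closed[of y x] x y by simp
  have h: "?h \<in> Fil (Suc n)" using x y hc by (auto simp: Fil_def ev_minus)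
  have "y = ?h \<oplus>\<^bsub>PR\<^esub> x" using x y hc by (intro ev_inj) (auto simp: ev_add ev_minus PR_add_closed)
  then show "y \<in> gcos n x" using h unfolding gcos_rcoset r_coset_def by auto
qed

lemma gcos_eqI:
  assumes "x \<in> carrier PR" "y \<in> carrier PR" "ev {} x = ev {} y" "\<And>T. 2 ^ Suc n dvd ev T x - ev T y"
  shows "gcos n x = gcos n y"
proof -
  have "z \<in> gcos n x \<longleftrightarrow> z \<in> gcos n y" for z
  proof -
    have "2 ^ Suc n dvd ev T z - ev T x \<longleftrightarrow> 2 ^ Suc n dvd ev T z - ev T y" for T
    proof -
      have "ev T z - ev T y = (ev T z - ev T x) + (ev T x - ev T y)" by simp
      then show ?thesis using assms(4)[of T] by (metis dvd_add_left_iff)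
    qed
    then show ?thesis unfolding gcos_iff[OF assms(1)] gcos_iff[OF assms(2)] assms(3) by simp
  qed
  then show ?thesis by blast
qed

lemma gcos_self: "x \<in> carrier PR \<Longrightarrow> x \<in> gcos n x" by (simp add: gcos_iff)

lemma carrier_gr_piece: "carrier (gr_piece K n) = gcos n ` Fil n"
  unfolding gr_piece_eq carrier_FactGroup by (auto simp: gcos_rcoset)

lemma one_gr_piece: "\<one>\<^bsub>gr_piece K n\<^esub> = gcos n \<zero>\<^bsub>PR\<^esub>"
proof -
  have "Fil (Suc n) = gcos n \<zero>\<^bsub>PR\<^esub>"
  proof (rule Set.set_eqI)
    fix y show "y \<in> Fil (Suc n) \<longleftrightarrow> y \<in> gcos n \<zero>\<^bsub>PR\<^esub>"
      unfolding gcos_iff[OF PR_consts(1)] by (auto simp: Fil_def PR_consts)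
  qed
  then show ?thesis by (simp add: gr_piece_eq)
qed

lemma mult_gr_piece:
  "x \<in> Fil n \<Longrightarrow> y \<in> Fil n \<Longrightarrow> gcos n x \<otimes>\<^bsub>gr_piece K n\<^esub> gcos n y = gcos n (x \<oplus>\<^bsub>PR\<^esub> y)"
  using normal.rcos_sum[OF normal_Fil, of x n y] by (simp add: gr_piece_eq gcos_rcoset)

text \<open>The product of cosets is a single coset: \<open>ab - xy = (a - x) b + x (b - y)\<close>, and both terms gain the
  extra factor 2.\<close>

lemma rcoset_mult_gcos:
  assumes x: "x \<in> Fil i" and y: "y \<in> Fil j"
  shows "rcoset_mult K (gamma_filt K (Suc (i + j))) (gcos i x) (gcos j y) = gcos (i + j) (x \<otimes>\<^bsub>PR\<^esub> y)"
proof -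
  note xc = Fil_carrier[OF x] and yc = Fil_carrier[OF y]
  have "Fil (Suc (i + j)) +>\<^bsub>K\<^esub> (a \<otimes>\<^bsub>PR\<^esub> b) = gcos (i + j) (x \<otimes>\<^bsub>PR\<^esub> y)"
    if ab: "a \<in> gcos i x" "b \<in> gcos j y" for a b
  proof -
    have a: "a \<in> carrier PR" "ev {} a = ev {} x" "\<And>T. 2 ^ Suc i dvd ev T a - ev T x" using ab(1) by (auto simp: gcos_iff[OF xc])
    have b: "b \<in> carrier PR" "ev {} b = ev {} y" "\<And>T. 2 ^ Suc j dvd ev T b - ev T y" using ab(2) by (auto simp: gcos_iff[OF yc])
    have "2 ^ Suc (i + j) dvd ev T (a \<otimes>\<^bsub>PR\<^esub> b) - ev T (x \<otimes>\<^bsub>PR\<^esub> y)" for T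
    proof -
      have e: "ev T (a \<otimes>\<^bsub>PR\<^esub> b) - ev T (x \<otimes>\<^bsub>PR\<^esub> y) = (ev T a - ev T x) * ev T b + ev T x * (ev T b - ev T y)"
        using a(1) b(1) xc yc by (simp add: ev_mult algebra_simps)
      have "2 ^ j dvd ev T b"
      proof -
        have "2 ^ j dvd ev T b - ev T y" using b(3)[of T] by (rule power_le_dvd) simp
        then show ?thesis using Fil_dvd[OF y, of T] by (metis diff_add_cancel dvd_add)
      qed
      then have "2 ^ Suc i * 2 ^ j dvd (ev T a - ev T x) * ev T b" using a(3) by (intro mult_dvd_mono)
      moreover have "2 ^ i * 2 ^ Suc j dvd ev T x * (ev T b - ev T y)" using Fil_dvd[OF x] b(3) by (intro mult_dvd_mono)
      ultimately show ?thesis unfolding e by (intro dvd_add) (simp_all add: power_add mult_ac)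
    qed
    then show ?thesis unfolding gcos_def[symmetric]
      using a b xc yc by (intro gcos_eqI) (simp_all add: PR_mult_closed ev_mult)
  qed
  then have "rcoset_mult K (gamma_filt K (Suc (i + j))) (gcos i x) (gcos j y) = (\<Union>a\<in>gcos i x. \<Union>b\<in>gcos j y. gcos (i + j) (x \<otimes>\<^bsub>PR\<^esub> y))"
    unfolding rcoset_mult_def gamma_filt_eq by (intro SUP_cong refl) simp
  also have "\<dots> = gcos (i + j) (x \<otimes>\<^bsub>PR\<^esub> y)" using gcos_self[OF xc, of i] gcos_self[OF yc, of j] by auto
  finally show ?thesis .
qed

lemma finprod_gcos:
  assumes "finite A" "\<And>i. i \<in> A \<Longrightarrow> z i \<in> Fil n"
  shows "finprod (gr_piece K n) (\<lambda>i. gcos n (z i)) A = gcos n (finsum PR z A)" "finsum PR z A \<in> Fil n"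
proof -
  interpret P: comm_group "gr_piece K n" by (rule comm_group_gr_piece)
  interpret PR: cring PR by (rule cring_PR)
  have "finprod (gr_piece K n) (\<lambda>i. gcos n (z i)) A = gcos n (finsum PR z A) \<and> finsum PR z A \<in> Fil n"
    using assms
  proof (induction A)
    case empty
    then show ?case by (simp add: one_gr_piece Fil_zero)
  next
    case (insert x F)
    then have z: "z \<in> F \<rightarrow> carrier PR" "z x \<in> carrier PR" using Fil_carrier by auto
    have c: "(\<lambda>i. gcos n (z i)) \<in> F \<rightarrow> carrier (gr_piece K n)" "gcos n (z x) \<in> carrier (gr_piece K n)"
      using insert.prems by (auto simp: carrier_gr_piece)
    show ?case using insert z c by (simp add: PR.finsum_insert P.finprod_insert mult_gr_piece Fil_add)
  qed
  then show "finprod (gr_piece K n) (\<lambda>i. gcos n (z i)) A = gcos n (finsum PR z A)" "finsum PR z A \<in> Fil n" by auto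
qed

section \<open>The graded ring as a ring of polynomial-valued functions\<close>

abbreviation "GR \<equiv> gr_ring K"

lemma carrier_GR: "f \<in> carrier GR \<longleftrightarrow> (\<forall>n. f n \<in> carrier (gr_piece K n)) \<and> finite {n. f n \<noteq> \<one>\<^bsub>gr_piece K n\<^esub>}"
proof -
  have "group (gr_piece K n)" for n using comm_group_gr_piece by (rule comm_group.axioms(2))
  then show ?thesis by (simp add: gr_ring_def carrier_sum_group PiE_iff)
qed

text \<open>A finitely supported family of lifts of the components of \<open>f\<close>. All operations of the graded ring are
  computed on such lifts.\<close>

definition represents :: "(nat \<Rightarrow> (nat \<Rightarrow> int, 'k) vrep) \<Rightarrow> (nat \<Rightarrow> (nat \<Rightarrow> int, 'k) vrep set) \<Rightarrow> bool"
  where "represents x f \<longleftrightarrow> (\<forall>n. x n \<in> Fil n \<and> f n = gcos n (x n)) \<and> finite {n. x n \<noteq> \<zero>\<^bsub>PR\<^esub>}"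

lemma represents_ex: assumes "f \<in> carrier GR" shows "\<exists>x. represents x f"
proof -
  have "\<exists>x. x \<in> Fil n \<and> f n = gcos n x \<and> (f n = \<one>\<^bsub>gr_piece K n\<^esub> \<longrightarrow> x = \<zero>\<^bsub>PR\<^esub>)" for n
  proof (cases "f n = \<one>\<^bsub>gr_piece K n\<^esub>")
    case True
    then show ?thesis using one_gr_piece Fil_zero by auto
  next
    case False
    then show ?thesis using assms by (auto simp: carrier_GR carrier_gr_piece)
  qed
  then obtain x where x: "\<And>n. x n \<in> Fil n \<and> f n = gcos n (x n) \<and> (f n = \<one>\<^bsub>gr_piece K n\<^esub> \<longrightarrow> x n = \<zero>\<^bsub>PR\<^esub>)" by metis
  have "{n. x n \<noteq> \<zero>\<^bsub>PR\<^esub>} \<subseteq> {n. f n \<noteq> \<one>\<^bsub>gr_piece K n\<^esub>}" using x by auto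
  then have "finite {n. x n \<noteq> \<zero>\<^bsub>PR\<^esub>}" using assms finite_subset by (auto simp: carrier_GR)
  then show ?thesis using x by (auto simp: represents_def)
qed

lemma represents_carrier: assumes "represents x f" shows "f \<in> carrier GR"
proof -
  have "{n. f n \<noteq> \<one>\<^bsub>gr_piece K n\<^esub>} \<subseteq> {n. x n \<noteq> \<zero>\<^bsub>PR\<^esub>}"
    using assms by (auto simp: represents_def one_gr_piece)
  then show ?thesis using assms finite_subset by (auto simp: represents_def carrier_GR carrier_gr_piece)
qed

text \<open>The binary digit of \<open>ev T\<close> at place \<open>n\<close>; it is the same for all members of the coset \<open>c\<close>.\<close>

definition digit :: "nat set \<Rightarrow> nat \<Rightarrow> (nat \<Rightarrow> int, 'k) vrep set \<Rightarrow> bit"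
  where "digit T n c = of_int (ev T (SOME y. y \<in> c) div 2 ^ n)"

lemma digit_gcos: assumes x: "x \<in> Fil n" shows "digit T n (gcos n x) = of_int (ev T x div 2 ^ n)"
proof -
  define y where "y = (SOME y. y \<in> gcos n x)"
  have "y \<in> gcos n x" unfolding y_def using gcos_self[OF Fil_carrier[OF x]] by (rule someI)
  then have d: "2 ^ Suc n dvd ev T y - ev T x" by (simp add: gcos_iff[OF Fil_carrier[OF x]])
  obtain a where a: "ev T x = 2 ^ n * a" using Fil_dvd[OF x] by blast
  obtain b where b: "ev T y - ev T x = 2 ^ Suc n * b" using d by blast
  have "ev T y = 2 ^ n * (a + 2 * b)" using a b by (simp add: algebra_simps)
  then have "ev T y div 2 ^ n - ev T x div 2 ^ n = 2 * b" using a by simp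
  then show ?thesis unfolding digit_def y_def[symmetric] of_int_bit_eq_iff by simp
qed

definition digits :: "nat set \<Rightarrow> (nat \<Rightarrow> (nat \<Rightarrow> int, 'k) vrep set) \<Rightarrow> bit poly"
  where "digits T f = (\<Sum>n | f n \<noteq> \<one>\<^bsub>gr_piece K n\<^esub>. monom (digit T n (f n)) n)"

text \<open>The degree-zero component is an integer, of which \<open>digits\<close> sees only the residue modulo 2; this
  integer restores injectivity.\<close>

definition dim0 :: "(nat \<Rightarrow> (nat \<Rightarrow> int, 'k) vrep set) \<Rightarrow> int"
  where "dim0 f = ev {} (SOME y. y \<in> f 0)"

lemma digit_one: "digit T n \<one>\<^bsub>gr_piece K n\<^esub> = 0"
  unfolding one_gr_piece digit_gcos[OF Fil_zero] by (simp add: PR_consts)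

lemma coeff_digits: 
  assumes f: "f \<in> carrier GR" shows "coeff (digits T f) n = digit T n (f n)"
proof -
  have fin: "finite {n. f n \<noteq> \<one>\<^bsub>gr_piece K n\<^esub>}" using f by (simp add: carrier_GR)
  have "coeff (digits T f) n = (\<Sum>m | f m \<noteq> \<one>\<^bsub>gr_piece K m\<^esub>. if m = n then digit T m (f m) else 0)"
    by (simp add: digits_def coeff_sum)
  also have "\<dots> = (if f n \<noteq> \<one>\<^bsub>gr_piece K n\<^esub> then digit T n (f n) else 0)"
    using fin by (simp add: sum.delta')
  finally show ?thesis by (auto simp: digit_one)
qed

lemma represents_coeff: "represents x f \<Longrightarrow> coeff (digits T f) n = of_int (ev T (x n) div 2 ^ n)"
  using coeff_digits[OF represents_carrier] digit_gcos by (auto simp: represents_def)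

lemma represents_dim0: assumes "represents x f" shows "dim0 f = ev {} (x 0)"
proof -
  have f: "f 0 = gcos 0 (x 0)" and x: "x 0 \<in> carrier PR" using assms Fil_carrier by (auto simp: represents_def)
  have "(SOME y. y \<in> f 0) \<in> f 0" unfolding f using gcos_self[OF x] by (rule someI)
  then show ?thesis unfolding dim0_def f by (simp add: gcos_iff[OF x])
qed

lemma represents_add:
  assumes f: "represents x f" and g: "represents y g"
  shows "represents (\<lambda>n. x n \<oplus>\<^bsub>PR\<^esub> y n) (f \<oplus>\<^bsub>GR\<^esub> g)"
proof -
  interpret PR: cring PR by (rule cring_PR)
  have sub: "{n. x n \<oplus>\<^bsub>PR\<^esub> y n \<noteq> \<zero>\<^bsub>PR\<^esub>} \<subseteq> {n. x n \<noteq> \<zero>\<^bsub>PR\<^esub>} \<union> {n. y n \<noteq> \<zero>\<^bsub>PR\<^esub>}" by auto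
  have "finite {n. x n \<oplus>\<^bsub>PR\<^esub> y n \<noteq> \<zero>\<^bsub>PR\<^esub>}"
    by (rule finite_subset[OF sub]) (use f g in \<open>simp add: represents_def\<close>)
  then show ?thesis using f g by (auto simp: represents_def gr_ring_def mult_gr_piece Fil_add)
qed

lemma represents_mult:
  assumes f: "represents x f" and g: "represents y g"
  shows "represents (\<lambda>n. finsum PR (\<lambda>i. x i \<otimes>\<^bsub>PR\<^esub> y (n - i)) {..n}) (f \<otimes>\<^bsub>GR\<^esub> g)"
proof -
  interpret PR: cring PR by (rule cring_PR)
  have F: "x i \<otimes>\<^bsub>PR\<^esub> y (n - i) \<in> Fil n" if "i \<le> n" for i n
    using Fil_mult[of "x i" i "y (n - i)" "n - i"] f g that by (simp add: represents_def)
  have "(f \<otimes>\<^bsub>GR\<^esub> g) n = gcos n (finsum PR (\<lambda>i. x i \<otimes>\<^bsub>PR\<^esub> y (n - i)) {..n})" for n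
  proof -
    interpret P: comm_group "gr_piece K n" by (rule comm_group_gr_piece)
    have "(f \<otimes>\<^bsub>GR\<^esub> g) n = finprod (gr_piece K n) (\<lambda>i. rcoset_mult K (gamma_filt K (Suc n)) (f i) (g (n - i))) {..n}"
      by (simp add: gr_ring_def)
    also have "\<dots> = finprod (gr_piece K n) (\<lambda>i. gcos n (x i \<otimes>\<^bsub>PR\<^esub> y (n - i))) {..n}"
    proof (rule P.finprod_cong')
      fix i assume i: "i \<in> {..n}"
      show "rcoset_mult K (gamma_filt K (Suc n)) (f i) (g (n - i)) = gcos n (x i \<otimes>\<^bsub>PR\<^esub> y (n - i))"
        using rcoset_mult_gcos[of "x i" i "y (n - i)" "n - i"] f g i by (simp add: represents_def)
    qed (use F in \<open>auto simp: carrier_gr_piece\<close>)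
    also have "\<dots> = gcos n (finsum PR (\<lambda>i. x i \<otimes>\<^bsub>PR\<^esub> y (n - i)) {..n})"
      using F by (intro finprod_gcos) auto
    finally show ?thesis .
  qed
  moreover have "finsum PR (\<lambda>i. x i \<otimes>\<^bsub>PR\<^esub> y (n - i)) {..n} \<in> Fil n" for n using F by (intro finprod_gcos) auto
  moreover have "finite {n. finsum PR (\<lambda>i. x i \<otimes>\<^bsub>PR\<^esub> y (n - i)) {..n} \<noteq> \<zero>\<^bsub>PR\<^esub>}"
  proof -
    obtain N where N: "\<And>n. x n \<noteq> \<zero>\<^bsub>PR\<^esub> \<Longrightarrow> n < N" using f by (auto simp: represents_def finite_nat_set_iff_bounded)
    obtain M where M: "\<And>n. y n \<noteq> \<zero>\<^bsub>PR\<^esub> \<Longrightarrow> n < M" using g by (auto simp: represents_def finite_nat_set_iff_bounded)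
    have xc: "x i \<in> carrier PR" "y i \<in> carrier PR" for i using f g Fil_carrier unfolding represents_def by blast+
    have "finsum PR (\<lambda>i. x i \<otimes>\<^bsub>PR\<^esub> y (n - i)) {..n} = \<zero>\<^bsub>PR\<^esub>" if n: "n \<ge> N + M" for n
    proof -
      have "x i \<otimes>\<^bsub>PR\<^esub> y (n - i) = \<zero>\<^bsub>PR\<^esub>" if "i \<in> {..n}" for i
      proof (cases "i < N")
        case True
        then have "y (n - i) = \<zero>\<^bsub>PR\<^esub>" using M[of "n - i"] n by force
        then show ?thesis using xc by simp
      next
        case False
        then have "x i = \<zero>\<^bsub>PR\<^esub>" using N by blast
        then show ?thesis using xc by simp
      qed
      then have "finsum PR (\<lambda>i. x i \<otimes>\<^bsub>PR\<^esub> y (n - i)) {..n} = finsum PR (\<lambda>i. \<zero>\<^bsub>PR\<^esub>) {..n}"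
        by (intro PR.finsum_cong') auto
      then show ?thesis by simp
    qed
    then have "{n. finsum PR (\<lambda>i. x i \<otimes>\<^bsub>PR\<^esub> y (n - i)) {..n} \<noteq> \<zero>\<^bsub>PR\<^esub>} \<subseteq> {..<N + M}"
      by (auto simp: not_less[symmetric])
    then show ?thesis using finite_subset by blast
  qed
  ultimately show ?thesis by (simp add: represents_def)
qed

lemma represents_zero: "represents (\<lambda>_. \<zero>\<^bsub>PR\<^esub>) \<zero>\<^bsub>GR\<^esub>"
  by (simp add: represents_def Fil_zero gr_ring_def one_gr_piece)

lemma represents_homog:
  assumes "x \<in> Fil i" shows "represents (\<lambda>n. if n = i then x else \<zero>\<^bsub>PR\<^esub>) (gr_homog K i x)"
  using assms by (auto simp: represents_def gr_homog_def gamma_filt_eq gcos_def[symmetric] one_gr_piece Fil_zero)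

lemma one_GR: "\<one>\<^bsub>GR\<^esub> = gr_homog K 0 \<one>\<^bsub>PR\<^esub>" by (simp add: gr_ring_def)

lemma div_add_dvd: "(d::int) dvd a \<Longrightarrow> d dvd b \<Longrightarrow> (a + b) div d = a div d + b div d"
  by (rule div_plus_div_distrib_dvd_left)

lemma digits_add:
  assumes "f \<in> carrier GR" "g \<in> carrier GR"
  shows "digits T (f \<oplus>\<^bsub>GR\<^esub> g) = digits T f + digits T g" "dim0 (f \<oplus>\<^bsub>GR\<^esub> g) = dim0 f + dim0 g" "f \<oplus>\<^bsub>GR\<^esub> g \<in> carrier GR"
proof -
  obtain x where rx: "represents x f" using represents_ex[OF assms(1)] by (rule exE)
  obtain y where ry: "represents y g" using represents_ex[OF assms(2)] by (rule exE)
  note r = rx ry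
  note s = represents_add[OF r]
  have xc: "x n \<in> Fil n" "y n \<in> Fil n" for n using r by (auto simp: represents_def)
  show "f \<oplus>\<^bsub>GR\<^esub> g \<in> carrier GR" using s by (rule represents_carrier)
  show "digits T (f \<oplus>\<^bsub>GR\<^esub> g) = digits T f + digits T g"
  proof (rule poly_eqI)
    fix n
    have "ev T (x n \<oplus>\<^bsub>PR\<^esub> y n) div 2 ^ n = ev T (x n) div 2 ^ n + ev T (y n) div 2 ^ n"
      using Fil_carrier[OF xc(1)] Fil_carrier[OF xc(2)] Fil_dvd[OF xc(1)] Fil_dvd[OF xc(2)]
      by (simp only: ev_add div_add_dvd)
    then show "coeff (digits T (f \<oplus>\<^bsub>GR\<^esub> g)) n = coeff (digits T f + digits T g) n"
      by (simp add: represents_coeff[OF s] represents_coeff[OF r(1)] represents_coeff[OF r(2)])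
  qed
  show "dim0 (f \<oplus>\<^bsub>GR\<^esub> g) = dim0 f + dim0 g"
    using Fil_carrier[OF xc(1)] Fil_carrier[OF xc(2)]
    by (simp add: represents_dim0[OF s] represents_dim0[OF r(1)] represents_dim0[OF r(2)] ev_add)
qed

text \<open>The \<open>n\<close>th component of the product is \<open>\<Sum>\<^sub>i x\<^sub>i y\<^sub>n\<^sub>-\<^sub>i\<close>, and the division by \<open>2\<^sup>n\<close> distributes over
  the factors as division by \<open>2\<^sup>i\<close> and by \<open>2\<^bsup>n-i\<^esup>\<close>.\<close>

lemma digits_mult:
  assumes "f \<in> carrier GR" "g \<in> carrier GR"
  shows "digits T (f \<otimes>\<^bsub>GR\<^esub> g) = digits T f * digits T g" "dim0 (f \<otimes>\<^bsub>GR\<^esub> g) = dim0 f * dim0 g" "f \<otimes>\<^bsub>GR\<^esub> g \<in> carrier GR"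
proof -
  obtain x where rx: "represents x f" using represents_ex[OF assms(1)] by (rule exE)
  obtain y where ry: "represents y g" using represents_ex[OF assms(2)] by (rule exE)
  note r = rx ry
  note s = represents_mult[OF r]
  have xf: "x n \<in> Fil n" "y n \<in> Fil n" for n using r by (auto simp: represents_def)
  have xc: "x n \<in> carrier PR" "y n \<in> carrier PR" for n using Fil_carrier[OF xf(1)] Fil_carrier[OF xf(2)] by auto
  have evs: "ev T (finsum PR (\<lambda>i. x i \<otimes>\<^bsub>PR\<^esub> y (n - i)) {..n}) = (\<Sum>i\<le>n. ev T (x i) * ev T (y (n - i)))" for T n
    using xc by (subst ev_finsum) (auto simp: PR_mult_closed ev_mult)
  show "f \<otimes>\<^bsub>GR\<^esub> g \<in> carrier GR" using s by (rule represents_carrier)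
  show "digits T (f \<otimes>\<^bsub>GR\<^esub> g) = digits T f * digits T g"
  proof (rule poly_eqI)
    fix n
    have e: "ev T (x i) * ev T (y (n - i)) = 2 ^ n * ((ev T (x i) div 2 ^ i) * (ev T (y (n - i)) div 2 ^ (n - i)))" if "i \<le> n" for i
    proof -
      obtain a where a: "ev T (x i) = 2 ^ i * a" using Fil_dvd[OF xf(1)] by blast
      obtain b where b: "ev T (y (n - i)) = 2 ^ (n - i) * b" using Fil_dvd[OF xf(2)] by blast
      have "(2::int) ^ n = 2 ^ i * 2 ^ (n - i)" using that by (simp flip: power_add)
      then show ?thesis by (simp add: a b)
    qed
    have "(\<Sum>i\<le>n. ev T (x i) * ev T (y (n - i))) = 2 ^ n * (\<Sum>i\<le>n. (ev T (x i) div 2 ^ i) * (ev T (y (n - i)) div 2 ^ (n - i)))"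
      unfolding sum_distrib_left by (rule sum.cong) (use e in auto)
    then have "(\<Sum>i\<le>n. ev T (x i) * ev T (y (n - i))) div 2 ^ n = (\<Sum>i\<le>n. (ev T (x i) div 2 ^ i) * (ev T (y (n - i)) div 2 ^ (n - i)))" by simp
    then show "coeff (digits T (f \<otimes>\<^bsub>GR\<^esub> g)) n = coeff (digits T f * digits T g) n"
      unfolding represents_coeff[OF s] coeff_mult represents_coeff[OF r(1)] represents_coeff[OF r(2)] evs by simp
  qed
  show "dim0 (f \<otimes>\<^bsub>GR\<^esub> g) = dim0 f * dim0 g"
    by (simp only: represents_dim0[OF s] represents_dim0[OF r(1)] represents_dim0[OF r(2)] evs) simp
qed

lemma digits_homog:
  assumes "x \<in> Fil i"
  shows "gr_homog K i x \<in> carrier GR" "digits T (gr_homog K i x) = monom (of_int (ev T x div 2 ^ i)) i"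
    "i = 0 \<Longrightarrow> dim0 (gr_homog K i x) = ev {} x"
proof -
  note r = represents_homog[OF assms]
  show "gr_homog K i x \<in> carrier GR" using r by (rule represents_carrier)
  show "digits T (gr_homog K i x) = monom (of_int (ev T x div 2 ^ i)) i"
    by (rule poly_eqI) (simp add: represents_coeff[OF r] PR_consts)
  show "dim0 (gr_homog K i x) = ev {} x" if "i = 0" using represents_dim0[OF r] that by simp
qed

lemma digits_inj:
  assumes "f \<in> carrier GR" "g \<in> carrier GR" "\<And>T. digits T f = digits T g" "dim0 f = dim0 g"
  shows "f = g"
proof
  fix n
  obtain x where rx: "represents x f" using represents_ex[OF assms(1)] by (rule exE)
  obtain y where ry: "represents y g" using represents_ex[OF assms(2)] by (rule exE)
  note r = rx ry
  have xf: "x n \<in> Fil n" "y n \<in> Fil n" and fg: "f n = gcos n (x n)" "g n = gcos n (y n)" using r by (auto simp: represents_def)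
  have "gcos n (x n) = gcos n (y n)"
  proof (rule gcos_eqI[OF Fil_carrier[OF xf(1)] Fil_carrier[OF xf(2)]])
    show "ev {} (x n) = ev {} (y n)"
      using xf represents_dim0[OF r(1)] represents_dim0[OF r(2)] assms(4) by (cases "n = 0") (auto simp: Fil_def)
    fix T
    have "(of_int (ev T (x n) div 2 ^ n) :: bit) = of_int (ev T (y n) div 2 ^ n)"
      using assms(3)[of T] represents_coeff[OF r(1)] represents_coeff[OF r(2)] by metis
    then obtain k where k: "ev T (x n) div 2 ^ n - ev T (y n) div 2 ^ n = 2 * k" unfolding of_int_bit_eq_iff by blast
    have "ev T (x n) - ev T (y n) = 2 ^ n * (ev T (x n) div 2 ^ n - ev T (y n) div 2 ^ n)"
      using Fil_dvd[OF xf(1), of T] Fil_dvd[OF xf(2), of T] by (simp add: algebra_simps)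
    then show "2 ^ Suc n dvd ev T (x n) - ev T (y n)" unfolding k by simp
  qed
  then show "f n = g n" using fg by simp
qed

lemma digits_zero: "digits T \<zero>\<^bsub>GR\<^esub> = 0" "dim0 \<zero>\<^bsub>GR\<^esub> = 0" "\<zero>\<^bsub>GR\<^esub> \<in> carrier GR"
proof -
  note r = represents_zero
  show "digits T \<zero>\<^bsub>GR\<^esub> = 0" by (rule poly_eqI) (simp add: represents_coeff[OF r] PR_consts)
  show "dim0 \<zero>\<^bsub>GR\<^esub> = 0" by (simp add: represents_dim0[OF r] PR_consts)
  show "\<zero>\<^bsub>GR\<^esub> \<in> carrier GR" using r by (rule represents_carrier)
qed

lemma digits_one: "digits T \<one>\<^bsub>GR\<^esub> = 1" "dim0 \<one>\<^bsub>GR\<^esub> = 1" "\<one>\<^bsub>GR\<^esub> \<in> carrier GR"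
proof -
  have o: "\<one>\<^bsub>PR\<^esub> \<in> Fil 0" by (simp add: Fil_def PR_consts)
  show "digits T \<one>\<^bsub>GR\<^esub> = 1" "dim0 \<one>\<^bsub>GR\<^esub> = 1" "\<one>\<^bsub>GR\<^esub> \<in> carrier GR"
    unfolding one_GR using digits_homog[OF o] by (simp_all add: PR_consts)
qed

lemma cring_GR: "cring GR"
proof (rule cring_by_homs[where h=digits and h'=dim0])
  fix f assume "f \<in> carrier GR"
  then obtain x where r: "represents x f" using represents_ex by blast
  define y where "y = (\<lambda>n. \<zero>\<^bsub>PR\<^esub> \<ominus>\<^bsub>K\<^esub> x n)"
  have xf: "x n \<in> Fil n" for n using r by (auto simp: represents_def)
  have "y n = \<zero>\<^bsub>PR\<^esub>" if "x n = \<zero>\<^bsub>PR\<^esub>" for n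
    using ev_minus[of "\<zero>\<^bsub>PR\<^esub>" "\<zero>\<^bsub>PR\<^esub>"] K.minus_closed[of "\<zero>\<^bsub>PR\<^esub>" "\<zero>\<^bsub>PR\<^esub>"] that
    unfolding y_def by (intro ev_inj) (simp_all add: PR_consts)
  then have "{n. y n \<noteq> \<zero>\<^bsub>PR\<^esub>} \<subseteq> {n. x n \<noteq> \<zero>\<^bsub>PR\<^esub>}" by auto
  then have "finite {n. y n \<noteq> \<zero>\<^bsub>PR\<^esub>}" using r finite_subset by (auto simp: represents_def)
  moreover have yf: "y n \<in> Fil n" for n unfolding y_def using Fil_minus[OF Fil_zero xf] .
  ultimately have ry: "represents y (\<lambda>n. gcos n (y n))" by (simp add: represents_def)
  note s = represents_add[OF ry r]
  have z: "y n \<oplus>\<^bsub>PR\<^esub> x n = \<zero>\<^bsub>PR\<^esub>" for n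
    using Fil_carrier[OF xf] Fil_carrier[OF yf]
    by (intro ev_inj) (simp_all add: ev_add PR_add_closed PR_consts, simp add: y_def ev_minus PR_consts)
  have "(\<lambda>n. gcos n (y n)) \<oplus>\<^bsub>GR\<^esub> f = \<zero>\<^bsub>GR\<^esub>"
    using s represents_zero by (simp add: represents_def z fun_eq_iff)
  then show "\<exists>g\<in>carrier GR. g \<oplus>\<^bsub>GR\<^esub> f = \<zero>\<^bsub>GR\<^esub>" using represents_carrier[OF ry] by blast
next
  fix f g assume "f \<in> carrier GR" "g \<in> carrier GR" "\<And>T. digits T f = digits T g" "dim0 f = dim0 g"
  then show "f = g" by (rule digits_inj)
qed (simp_all add: digits_zero digits_one digits_add digits_mult)

text \<open>An element with vanishing digits is concentrated in degree zero, where it is an even integer.\<close>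

lemma digits_kernel:
  assumes f: "f \<in> carrier GR" and 0: "\<And>T. digits T f = 0"
  shows "\<exists>g\<in>carrier GR. f = g \<oplus>\<^bsub>GR\<^esub> g"
proof -
  obtain x where r: "represents x f" using f represents_ex by blast
  have "(of_int (dim0 f) :: bit) = of_int 0"
    using represents_coeff[OF r, of "{}" 0] 0[of "{}"] represents_dim0[OF r] by simp
  then obtain m where m: "dim0 f = 2 * m" unfolding of_int_bit_eq_iff by auto
  let ?g = "gr_homog K 0 (int_elt K m)"
  have F: "int_elt K m \<in> Fil 0" by (simp add: Fil_def ev_int_elt)
  note g = digits_homog[OF F]
  have "f = ?g \<oplus>\<^bsub>GR\<^esub> ?g"
  proof (rule digits_inj[OF f])
    show "?g \<oplus>\<^bsub>GR\<^esub> ?g \<in> carrier GR" using digits_add(3)[OF g(1) g(1)] .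
    have "a + a = 0" for a :: bit by (cases a) auto
    then have "digits T ?g + digits T ?g = 0" for T by (intro poly_eqI) (simp only: coeff_add coeff_0)
    then show "digits T f = digits T (?g \<oplus>\<^bsub>GR\<^esub> ?g)" for T using 0 by (simp add: digits_add(1)[OF g(1) g(1)])
    show "dim0 f = dim0 (?g \<oplus>\<^bsub>GR\<^esub> ?g)" by (simp add: digits_add(2)[OF g(1) g(1)] m g(3) ev_int_elt)
  qed
  then show ?thesis using g(1) by blast
qed

lemma chern_eq:
  assumes i: "i \<in> {1..r}"
  shows "chern K 1 (rep_class G (char_sum r [{i}])) = gr_homog K 1 (aug_gen i)"
proof -
  have S: "\<forall>S\<in>set [{i}]. S \<subseteq> {1..r}" using i by auto
  let ?c = "rep_class G (char_sum r [{i}]) :: (nat \<Rightarrow> int, 'k) vrep"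
  note c = ev_rep_class[OF char_sum_in[OF S]]
  have ec: "ev T ?c = subset_char {i} T" for T using c(2) brauer_char_char_sum[OF two S] by simp
  have a: "rep_aug ?c = 1" using rep_aug_ev[OF c(1)] ec[of "{}"] by (simp add: subset_char_def)
  have ie: "int_elt K 1 = \<one>\<^bsub>PR\<^esub>" by (rule ev_inj) (simp_all add: ev_int_elt PR_consts)
  have "?c \<ominus>\<^bsub>K\<^esub> int_elt K (aug K ?c) = aug_gen i" by (simp add: aug_gen_def a ie)
  moreover have "gamma_op K 1 (aug_gen i) = aug_gen i" using aug_gen_facts[OF i] by (intro gamma_1) auto
  ultimately show ?thesis by (simp add: chern_def)
qed

lemma aug_gen_Fil: "i \<in> {1..r} \<Longrightarrow> aug_gen i \<in> Fil 1"
  using aug_gen_facts[of i] by (simp add: Fil_def)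

lemma digits_chern:
  assumes i: "i \<in> {1..r}"
  shows "chern K 1 (rep_class G (char_sum r [{i}])) \<in> carrier GR"
    "digits T (chern K 1 (rep_class G (char_sum r [{i}]))) = (if i \<in> T then monom 1 1 else 0)"
proof -
  show "chern K 1 (rep_class G (char_sum r [{i}])) \<in> carrier GR"
    unfolding chern_eq[OF i] by (rule digits_homog(1)[OF aug_gen_Fil[OF i]])
  have "(of_int (-1) :: bit) = 1" by simp
  then show "digits T (chern K 1 (rep_class G (char_sum r [{i}]))) = (if i \<in> T then monom 1 1 else 0)"
    unfolding chern_eq[OF i] digits_homog(2)[OF aug_gen_Fil[OF i]] by (simp add: aug_gen_facts[OF i])
qed

end

section \<open>Polynomials as polynomial-valued functions\<close>

type_synonym mono = "nat \<Rightarrow>\<^sub>0 nat"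

definition mdeg :: "mono \<Rightarrow> nat"
  where "mdeg m = (\<Sum>i\<in>Poly_Mapping.keys m. Poly_Mapping.lookup m i)"

lemma mdeg_superset: "finite A \<Longrightarrow> Poly_Mapping.keys m \<subseteq> A \<Longrightarrow> mdeg m = (\<Sum>i\<in>A. Poly_Mapping.lookup m i)"
  unfolding mdeg_def by (rule sum.mono_neutral_left) (auto simp: in_keys_iff)

lemma keys_plus_nat: "Poly_Mapping.keys (m + n) = Poly_Mapping.keys m \<union> Poly_Mapping.keys (n :: mono)"
  by (auto simp: in_keys_iff lookup_add)

lemma mdeg_add: "mdeg (m + n) = mdeg m + mdeg n"
proof -
  let ?A = "Poly_Mapping.keys m \<union> Poly_Mapping.keys n"
  have "mdeg (m + n) = (\<Sum>i\<in>?A. Poly_Mapping.lookup (m + n) i)" "mdeg m = (\<Sum>i\<in>?A. Poly_Mapping.lookup m i)"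
    "mdeg n = (\<Sum>i\<in>?A. Poly_Mapping.lookup n i)"
    by (rule mdeg_superset; simp add: keys_plus_nat)+
  then show ?thesis by (simp add: lookup_add sum.distrib)
qed

lemma mdeg_0 [simp]: "mdeg 0 = 0" by (simp add: mdeg_def)

lemma mdeg_single: "mdeg (Poly_Mapping.single i k) = k"
  by (cases "k = 0") (simp_all add: mdeg_def)

text \<open>The value of a monomial when the variables with index in \<open>T\<close> are set to \<open>t\<close> and the others to \<open>0\<close>.\<close>

definition mval :: "nat set \<Rightarrow> mono \<Rightarrow> 'c::comm_ring_1 poly"
  where "mval T m = (if Poly_Mapping.keys m \<subseteq> T then monom 1 (mdeg m) else 0)"

lemma mval_add: "mval T (m + n) = mval T m * mval T n"
  by (auto simp: mval_def keys_plus_nat mdeg_add mult_monom)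

lemma mval_0: "mval T 0 = 1"
  by (simp add: mval_def mdeg_def)

definition pval :: "nat set \<Rightarrow> (mono \<Rightarrow>\<^sub>0 'c::comm_ring_1) \<Rightarrow> 'c poly"
  where "pval T p = (\<Sum>m\<in>Poly_Mapping.keys p. smult (Poly_Mapping.lookup p m) (mval T m))"

lemma pval_superset:
  "finite A \<Longrightarrow> Poly_Mapping.keys p \<subseteq> A \<Longrightarrow> pval T p = (\<Sum>m\<in>A. smult (Poly_Mapping.lookup p m) (mval T m))"
  unfolding pval_def by (rule sum.mono_neutral_left) (auto simp: in_keys_iff)

lemma pval_add: "pval T (p + q) = pval T p + pval T q"
proof -
  let ?A = "Poly_Mapping.keys p \<union> Poly_Mapping.keys q"
  have k: "Poly_Mapping.keys (p + q) \<subseteq> ?A" by (rule Poly_Mapping.keys_add)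
  have "pval T (p + q) = (\<Sum>m\<in>?A. smult (Poly_Mapping.lookup (p + q) m) (mval T m))"
    by (rule pval_superset[OF _ k]) simp
  also have "\<dots> = (\<Sum>m\<in>?A. smult (Poly_Mapping.lookup p m) (mval T m)) + (\<Sum>m\<in>?A. smult (Poly_Mapping.lookup q m) (mval T m))"
    by (simp add: lookup_add smult_add_left sum.distrib)
  also have "(\<Sum>m\<in>?A. smult (Poly_Mapping.lookup p m) (mval T m)) = pval T p"
    by (rule pval_superset[symmetric]) auto
  also have "(\<Sum>m\<in>?A. smult (Poly_Mapping.lookup q m) (mval T m)) = pval T q"
    by (rule pval_superset[symmetric]) auto
  finally show ?thesis .
qed

lemma pval_0 [simp]: "pval T 0 = 0" by (simp add: pval_def)

lemma pval_single: "pval T (Poly_Mapping.single m c) = smult c (mval T m)"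
  by (cases "c = 0") (simp_all add: pval_def)

lemma pval_sum: "pval T (sum f A) = (\<Sum>i\<in>A. pval T (f i))"
  by (induction A rule: infinite_finite_induct) (auto simp: pval_add)

lemma sum_singles: "p = (\<Sum>m\<in>Poly_Mapping.keys p. Poly_Mapping.single m (Poly_Mapping.lookup p m))"
proof (rule poly_mapping_eqI)
  fix k
  show "Poly_Mapping.lookup p k = Poly_Mapping.lookup (\<Sum>m\<in>Poly_Mapping.keys p. Poly_Mapping.single m (Poly_Mapping.lookup p m)) k"
    by (simp add: lookup_sum lookup_single when_def sum.delta' in_keys_iff)
qed

lemma single_sum: "(\<Sum>m\<in>A. Poly_Mapping.single k (g m)) = Poly_Mapping.single k (\<Sum>m\<in>A. g m :: 'c::comm_monoid_add)"
  by (induction A rule: infinite_finite_induct) (auto simp: single_add)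

lemma pval_mult: "pval T (p * q) = pval T p * pval T q"
proof -
  let ?s = "\<lambda>p m. Poly_Mapping.single m (Poly_Mapping.lookup p m)"
  have "p * q = (\<Sum>m\<in>Poly_Mapping.keys p. ?s p m) * (\<Sum>n\<in>Poly_Mapping.keys q. ?s q n)"
    using sum_singles[of p] sum_singles[of q] by simp
  also have "\<dots> = (\<Sum>m\<in>Poly_Mapping.keys p. \<Sum>n\<in>Poly_Mapping.keys q. Poly_Mapping.single (m + n) (Poly_Mapping.lookup p m * Poly_Mapping.lookup q n))"
    by (simp add: sum_product mult_single)
  finally have "pval T (p * q) = (\<Sum>m\<in>Poly_Mapping.keys p. \<Sum>n\<in>Poly_Mapping.keys q.
      smult (Poly_Mapping.lookup p m) (mval T m) * smult (Poly_Mapping.lookup q n) (mval T n))"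
    by (simp add: pval_sum pval_single mval_add mult_ac)
  then show ?thesis by (simp add: pval_def sum_product)
qed

lemma pval_1: "pval T 1 = 1"
  using pval_single[of T 0 1] by (simp add: mval_0 one_pCons)

text \<open>The common target of the homomorphisms from the polynomial ring and from the graded ring.\<close>

definition Dring :: "(nat set \<Rightarrow> bit poly) ring"
  where "Dring = \<lparr>carrier = UNIV, monoid.mult = (\<lambda>f g T. f T * g T), one = (\<lambda>_. 1), zero = (\<lambda>_. 0), add = (\<lambda>f g T. f T + g T)\<rparr>"

lemma cring_Dring: "cring Dring"
proof (rule cring_by_homs[where h="\<lambda>T f. f T" and h'="\<lambda>f. f {}"])
  fix x show "\<exists>y\<in>carrier Dring. y \<oplus>\<^bsub>Dring\<^esub> x = \<zero>\<^bsub>Dring\<^esub>"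
    by (rule bexI[of _ "\<lambda>T. - x T"]) (simp_all add: Dring_def)
qed (auto simp: Dring_def)

lemma mpoly_ring_simps:
  "p \<in> carrier (mpoly_ring r) \<longleftrightarrow> (\<forall>m\<in>Poly_Mapping.keys p. Poly_Mapping.keys m \<subseteq> {1..r})"
  "p \<oplus>\<^bsub>mpoly_ring r\<^esub> q = p + q" "p \<otimes>\<^bsub>mpoly_ring r\<^esub> q = p * q" "\<zero>\<^bsub>mpoly_ring r\<^esub> = 0" "\<one>\<^bsub>mpoly_ring r\<^esub> = 1"
  by (simp_all add: mpoly_ring_def ring_of_type_algebra_def)

lemma mpoly_closed:
  assumes "p \<in> carrier (mpoly_ring r)" "q \<in> carrier (mpoly_ring r)"
  shows "p + q \<in> carrier (mpoly_ring r)" "p * q \<in> carrier (mpoly_ring r)" "- p \<in> carrier (mpoly_ring r)"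
proof -
  show "p + q \<in> carrier (mpoly_ring r)" "- p \<in> carrier (mpoly_ring r)"
    using assms Poly_Mapping.keys_add[of p q] by (auto simp: mpoly_ring_simps in_keys_iff)
  show "p * q \<in> carrier (mpoly_ring r)" unfolding mpoly_ring_simps
  proof
    fix m assume "m \<in> Poly_Mapping.keys (p * q)"
    then obtain a b where "m = a + b" "a \<in> Poly_Mapping.keys p" "b \<in> Poly_Mapping.keys q"
      using keys_mult[of p q] by blast
    then show "Poly_Mapping.keys m \<subseteq> {1..r}" using assms by (simp add: keys_plus_nat mpoly_ring_simps)
  qed
qed

lemma mpoly_zero_in: "0 \<in> carrier (mpoly_ring r)" by (simp add: mpoly_ring_simps(1))

lemma cring_mpoly_ring: "cring (mpoly_ring r)"
proof (rule cring_by_homs[where h="\<lambda>_::unit. id" and h'=id])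
  fix p assume p: "p \<in> carrier (mpoly_ring r)"
  show "\<exists>q\<in>carrier (mpoly_ring r). q \<oplus>\<^bsub>mpoly_ring r\<^esub> p = \<zero>\<^bsub>mpoly_ring r\<^esub>"
    using mpoly_closed(3)[OF p p] by (intro bexI[of _ "- p"]) (simp_all add: mpoly_ring_simps(2,4))
next
  show "\<zero>\<^bsub>mpoly_ring r\<^esub> \<in> carrier (mpoly_ring r)" "\<one>\<^bsub>mpoly_ring r\<^esub> \<in> carrier (mpoly_ring r)"
    by (auto simp: mpoly_ring_simps)
qed (simp_all add: mpoly_closed mpoly_ring_simps(2-))

lemma pval_hom: "ring_hom_ring (mpoly_ring r) Dring (\<lambda>p T. pval T p)"
proof (rule ring_hom_ringI)
  show "ring (mpoly_ring r)" "ring Dring"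
    by (rule cring.axioms(1)[OF cring_mpoly_ring] cring.axioms(1)[OF cring_Dring])+
qed (simp_all add: mpoly_ring_simps(2-) Dring_def pval_add pval_mult pval_1)

lemma mvar_in: "i \<in> {1..r} \<Longrightarrow> mvar i \<in> carrier (mpoly_ring r)"
  by (simp add: mvar_def mpoly_ring_simps)

lemma pval_mvar: "pval T (mvar i) = (if i \<in> T then monom 1 1 else 0)"
  by (simp add: mvar_def pval_single mval_def mdeg_single)

definition chern_rels :: "nat \<Rightarrow> (mono \<Rightarrow>\<^sub>0 bit) set"
  where "chern_rels r = {mvar i ^ 2 * mvar j + mvar i * mvar j ^ 2 |i j. i \<in> {1..r} \<and> j \<in> {1..r}}"

lemma chern_rels_in: "chern_rels r \<subseteq> carrier (mpoly_ring r)"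
  by (auto simp: chern_rels_def power2_eq_square intro!: mpoly_closed mvar_in)

lemma bit_poly_add_self: "(q::bit poly) + q = 0"
proof (rule poly_eqI)
  fix n
  have "a + a = 0" for a :: bit by (cases a) auto
  then show "coeff (q + q) n = coeff 0 n" by (simp only: coeff_add coeff_0)
qed

text \<open>Both variables take values in \<open>{0, t}\<close>, and \<open>a\<^sup>2 b = a b\<^sup>2\<close> there; the sum vanishes in characteristic 2.\<close>

lemma pval_chern_rels: "p \<in> chern_rels r \<Longrightarrow> pval T p = 0"
proof -
  assume "p \<in> chern_rels r"
  then obtain i j where p: "p = mvar i ^ 2 * mvar j + mvar i * mvar j ^ 2" by (auto simp: chern_rels_def)
  define a where "a = pval T (mvar i)"
  define b where "b = pval T (mvar j)"
  have e: "pval T p = (a * a) * b + a * (b * b)"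
    unfolding p power2_eq_square pval_add pval_mult a_def b_def ..
  have "a = b \<or> a = 0 \<or> b = 0" unfolding a_def b_def pval_mvar by auto
  then show "pval T p = 0"
  proof (elim disjE)
    assume "a = b"
    then show ?thesis unfolding e by (simp only: mult.assoc bit_poly_add_self)
  qed (simp_all only: e mult_zero_left mult_zero_right add_0)
qed

section \<open>Normal forms modulo the Chern class relations\<close>

definition base_var :: "nat set \<Rightarrow> nat" where "base_var S = (SOME i. i \<in> S)"

lemma base_var_in: "S \<noteq> {} \<Longrightarrow> base_var S \<in> S"
  by (simp add: base_var_def some_in_eq)

text \<open>The representative for degree \<open>n\<close> and set of variables \<open>S\<close>: each variable once, and the remaining
  degree on one chosen variable of \<open>S\<close>.\<close>

definition normal_mono :: "nat \<Rightarrow> nat set \<Rightarrow> mono"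
  where "normal_mono n S = (\<Sum>i\<in>S. Poly_Mapping.single i 1) + Poly_Mapping.single (base_var S) (n - card S)"

lemma lookup_normal_mono:
  assumes "finite S"
  shows "Poly_Mapping.lookup (normal_mono n S) i = (if i \<in> S then 1 else 0) + (if i = base_var S then n - card S else 0)"
proof -
  have 1: "(\<Sum>j\<in>S. Poly_Mapping.lookup (Poly_Mapping.single j (1::nat)) i) = (if i \<in> S then 1 else 0)"
    using assms by (simp add: lookup_single when_def)
  have 2: "Poly_Mapping.lookup (Poly_Mapping.single (base_var S) (n - card S)) i = (if i = base_var S then n - card S else 0)"
    by (cases "i = base_var S") (simp_all add: lookup_single)
  show ?thesis unfolding normal_mono_def lookup_add lookup_sum 1 2 ..
qed

lemma keys_normal_mono:
  assumes "finite S" "card S \<le> n" "S = {} \<Longrightarrow> n = 0"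
  shows "Poly_Mapping.keys (normal_mono n S) = S" "mdeg (normal_mono n S) = n"
proof -
  have b: "base_var S \<in> S \<or> S = {} \<and> n = 0" using base_var_in[of S] assms(3) by (cases "S = {}") simp_all
  have l: "Poly_Mapping.lookup (normal_mono n S) i = (if i \<in> S then 1 + (if i = base_var S then n - card S else 0) else 0)" for i
  proof (cases "i \<in> S")
    case False
    then have "i \<noteq> base_var S \<or> n = 0" using b by blast
    then show ?thesis unfolding lookup_normal_mono[OF assms(1)] using False by auto
  qed (simp add: lookup_normal_mono[OF assms(1)])
  show k: "Poly_Mapping.keys (normal_mono n S) = S"
    by (rule Set.set_eqI) (simp add: in_keys_iff l)
  have "mdeg (normal_mono n S) = (\<Sum>i\<in>S. 1 + (if i = base_var S then n - card S else 0))"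
    unfolding mdeg_def k by (rule sum.cong) (simp_all add: l)
  also have "\<dots> = card S + (\<Sum>i\<in>S. if i = base_var S then n - card S else 0)"
    unfolding sum.distrib by simp
  also have "(\<Sum>i\<in>S. if i = base_var S then n - card S else 0) = (if base_var S \<in> S then n - card S else 0)"
    using assms(1) by simp
  also have "card S + \<dots> = n" using b assms(2) by auto
  finally show "mdeg (normal_mono n S) = n" .
qed

lemma chern_ideal: "ideal (chern_rel_ideal r) (mpoly_ring r)"
  and chern_rels_sub: "chern_rels r \<subseteq> chern_rel_ideal r"
proof -
  interpret cring "mpoly_ring r" by (rule cring_mpoly_ring)
  have e: "chern_rel_ideal r = genideal (mpoly_ring r) (chern_rels r)"
    by (simp add: chern_rel_ideal_def chern_rels_def)
  show "ideal (chern_rel_ideal r) (mpoly_ring r)" unfolding e using chern_rels_in by (rule genideal_ideal)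
  show "chern_rels r \<subseteq> chern_rel_ideal r" unfolding e using chern_rels_in by (rule genideal_self)
qed

lemma chern_ideal_closed:
  "0 \<in> chern_rel_ideal r"
  "p \<in> chern_rel_ideal r \<Longrightarrow> q \<in> chern_rel_ideal r \<Longrightarrow> p + q \<in> chern_rel_ideal r"
  "p \<in> chern_rel_ideal r \<Longrightarrow> u \<in> carrier (mpoly_ring r) \<Longrightarrow> u * p \<in> chern_rel_ideal r"
proof -
  note sub = ideal.axioms(1)[OF chern_ideal[of r]]
  show "0 \<in> chern_rel_ideal r" using additive_subgroup.zero_closed[OF sub] by (simp add: mpoly_ring_simps)
  show "p \<in> chern_rel_ideal r \<Longrightarrow> q \<in> chern_rel_ideal r \<Longrightarrow> p + q \<in> chern_rel_ideal r"
    using additive_subgroup.a_closed[OF sub, of p q] by (simp add: mpoly_ring_simps)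
  show "p \<in> chern_rel_ideal r \<Longrightarrow> u \<in> carrier (mpoly_ring r) \<Longrightarrow> u * p \<in> chern_rel_ideal r"
    using ideal.I_l_closed[OF chern_ideal, of p r u] by (simp add: mpoly_ring_simps(3))
qed

lemma poly_bit_add_self: "(p :: mono \<Rightarrow>\<^sub>0 bit) + p = 0"
proof (rule poly_mapping_eqI)
  fix k
  have "a + a = 0" for a :: bit by (cases a) auto
  then show "Poly_Mapping.lookup (p + p) k = Poly_Mapping.lookup 0 k" by (simp only: lookup_add lookup_zero)
qed

text \<open>A relation, multiplied by a monomial, moves one unit of exponent from a variable with exponent at
  least 2 to another variable of the monomial. Moving everything to the chosen variable reaches the
  normal form; the induction is on the total exponent of the other variables.\<close>

lemma monomial_cong_normal_mono:
  assumes m: "Poly_Mapping.keys m \<subseteq> {1..r}"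
  shows "Poly_Mapping.single m 1 + Poly_Mapping.single (normal_mono (mdeg m) (Poly_Mapping.keys m)) 1 \<in> chern_rel_ideal r"
  using m
proof (induction "\<Sum>j\<in>Poly_Mapping.keys m - {base_var (Poly_Mapping.keys m)}. Poly_Mapping.lookup m j" arbitrary: m rule: less_induct)
  case less
  define S where "S = Poly_Mapping.keys m"
  define b where "b = base_var S"
  have fS: "finite S" by (simp add: S_def)
  show ?case
  proof (cases "\<exists>j\<in>S - {b}. Poly_Mapping.lookup m j \<ge> 2")
    case True
    then obtain j where j: "j \<in> S" "j \<noteq> b" "Poly_Mapping.lookup m j \<ge> 2" by blast
    have b: "b \<in> S" unfolding b_def using j by (intro base_var_in) auto
    have bm: "Poly_Mapping.lookup m b \<ge> 1" using b by (simp add: S_def in_keys_iff)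
    let ?e = "\<lambda>i. Poly_Mapping.single i (1::nat)"
    define u where "u = m - (?e j + ?e j + ?e b)"
    have mu: "m = u + (?e j + ?e j + ?e b)"
      by (rule poly_mapping_eqI) (use j bm in \<open>auto simp: u_def lookup_add lookup_minus lookup_single when_def\<close>)
    (* m' arises from m by trading one factor x_j for a factor x_b. *)
    define m' where "m' = u + (?e j + ?e b + ?e b)"
    have lm': "Poly_Mapping.lookup m' i = (if i = j then Poly_Mapping.lookup m i - 1 else if i = b then Poly_Mapping.lookup m i + 1 else Poly_Mapping.lookup m i)" for i
      using j bm by (auto simp: m'_def mu lookup_add lookup_single when_def)
    have k': "Poly_Mapping.keys m' = S"
      using j bm b unfolding S_def by (auto simp: in_keys_iff lm' split: if_splits)
    have d': "mdeg m' = mdeg m" unfolding mu m'_def by (simp add: mdeg_add mdeg_single)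
    have keysu: "Poly_Mapping.keys u \<subseteq> {1..r}" using less.prems unfolding mu keys_plus_nat by auto
    have jb: "j \<in> {1..r}" "b \<in> {1..r}" using j b less.prems by (auto simp: S_def)
    have "(\<Sum>i\<in>S - {b}. Poly_Mapping.lookup m' i) < (\<Sum>i\<in>S - {b}. Poly_Mapping.lookup m i)"
      by (rule sum_strict_mono_ex1) (use fS j in \<open>auto simp: lm' intro!: bexI[of _ j]\<close>)
    then have "(\<Sum>i\<in>Poly_Mapping.keys m' - {base_var (Poly_Mapping.keys m')}. Poly_Mapping.lookup m' i)
        < (\<Sum>i\<in>Poly_Mapping.keys m - {base_var (Poly_Mapping.keys m)}. Poly_Mapping.lookup m i)"
      unfolding k' b_def[symmetric] S_def[symmetric] .
    then have IH: "Poly_Mapping.single m' 1 + Poly_Mapping.single (normal_mono (mdeg m') (Poly_Mapping.keys m')) 1 \<in> chern_rel_ideal r"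
      using less.prems k' by (intro less.hyps) (auto simp: S_def)
    have rel: "mvar j ^ 2 * mvar b + mvar j * mvar b ^ 2 \<in> chern_rel_ideal r"
      using chern_rels_sub jb by (auto simp: chern_rels_def)
    have uin: "(Poly_Mapping.single u 1 :: mono \<Rightarrow>\<^sub>0 bit) \<in> carrier (mpoly_ring r)" using keysu by (simp add: mpoly_ring_simps)
    have "Poly_Mapping.single u 1 * (mvar j ^ 2 * mvar b + mvar j * mvar b ^ 2) = Poly_Mapping.single m 1 + Poly_Mapping.single m' 1"
      by (simp add: mvar_def power2_eq_square mult_single distrib_left mu m'_def add.assoc)
    then have st: "Poly_Mapping.single m (1::bit) + Poly_Mapping.single m' 1 \<in> chern_rel_ideal r"
      using chern_ideal_closed(3)[OF rel uin] by simp
    have eq: "Poly_Mapping.single m (1::bit) + Poly_Mapping.single (normal_mono (mdeg m) S) 1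
      = (Poly_Mapping.single m 1 + Poly_Mapping.single m' 1) + (Poly_Mapping.single m' 1 + Poly_Mapping.single (normal_mono (mdeg m) S) 1)"
      using poly_bit_add_self[of "Poly_Mapping.single m' 1"] by (metis add.assoc add_0)
    show ?thesis using chern_ideal_closed(2)[OF st IH] unfolding k' d' S_def[symmetric] eq .
  next
    case False
    have one: "Poly_Mapping.lookup m i = 1" if "i \<in> S - {b}" for i
    proof -
      have "Poly_Mapping.lookup m i \<noteq> 0" using that by (simp add: S_def in_keys_iff)
      then show ?thesis using False that by force
    qed
    have "m = normal_mono (mdeg m) S"
    proof (cases "S = {}")
      case True
      then have "m = 0" by (simp add: S_def)
      then show ?thesis by (simp add: normal_mono_def mdeg_def S_def)
    next
      case ne: False
      have b: "b \<in> S" unfolding b_def using ne by (rule base_var_in)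
      have "mdeg m = (\<Sum>i\<in>S. Poly_Mapping.lookup m i)" by (simp add: mdeg_def S_def)
      also have "\<dots> = Poly_Mapping.lookup m b + (\<Sum>i\<in>S - {b}. Poly_Mapping.lookup m i)"
        using fS b by (rule sum.remove)
      also have "(\<Sum>i\<in>S - {b}. Poly_Mapping.lookup m i) = card S - 1" using one fS b by simp
      finally have db: "mdeg m = Poly_Mapping.lookup m b + (card S - 1)" .
      have cS: "card S \<ge> 1" using fS ne by (simp add: Suc_leI card_gt_0_iff)
      have bm: "Poly_Mapping.lookup m b \<ge> 1" using b by (simp add: S_def in_keys_iff)
      show ?thesis
      proof (rule poly_mapping_eqI)
        fix i
        show "Poly_Mapping.lookup m i = Poly_Mapping.lookup (normal_mono (mdeg m) S) i"
          unfolding lookup_normal_mono[OF fS] b_def[symmetric]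
          using db cS bm b one[of i] by (cases "i \<in> S"; cases "i = b") (auto simp: S_def in_keys_iff)
      qed
    qed
    then have "Poly_Mapping.single m (1::bit) + Poly_Mapping.single (normal_mono (mdeg m) S) 1 = 0"
      using poly_bit_add_self by metis
    then show ?thesis unfolding S_def using chern_ideal_closed(1) by simp
  qed
qed

text \<open>Group the monomials of \<open>p\<close> by degree \<open>n\<close> and set of variables \<open>S\<close>. The coefficient of \<open>t\<^sup>n\<close> in
  \<open>pval T p\<close> is the sum of the group totals over the \<open>S \<subseteq> T\<close>, so by induction on \<open>S\<close> all group totals
  vanish. But modulo the relations all monomials of a group are equal.\<close>

lemma pval_kernel:
  assumes p: "p \<in> carrier (mpoly_ring r)" and 0: "\<And>T. pval T p = 0"
  shows "p \<in> chern_rel_ideal r"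
proof -
  let ?k = "Poly_Mapping.keys p" and ?c = "\<lambda>m. Poly_Mapping.lookup p m"
  define \<kappa> where "\<kappa> = (\<lambda>m::mono. (mdeg m, Poly_Mapping.keys m))"
  define \<beta> where "\<beta> = (\<lambda>n S. \<Sum>m | m \<in> ?k \<and> \<kappa> m = (n, S). ?c m)"
  have coe: "(\<Sum>m | m \<in> ?k \<and> mdeg m = n \<and> Poly_Mapping.keys m \<subseteq> T. ?c m) = 0" for n T
  proof -
    have "coeff (pval T p) n = (\<Sum>m\<in>?k. if mdeg m = n \<and> Poly_Mapping.keys m \<subseteq> T then ?c m else 0)"
      unfolding pval_def coeff_sum by (rule sum.cong) (auto simp: mval_def)
    also have "\<dots> = (\<Sum>m | m \<in> ?k \<and> mdeg m = n \<and> Poly_Mapping.keys m \<subseteq> T. ?c m)"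
      by (simp add: sum.If_cases Int_def)
    finally show ?thesis using 0[of T] by simp
  qed
  have \<beta>0: "\<beta> n S = 0" if "finite S" for n S
    using that
  proof (induction S rule: finite_psubset_induct)
    case (psubset S)
    have "0 = (\<Sum>m | m \<in> ?k \<and> mdeg m = n \<and> Poly_Mapping.keys m \<subseteq> S. ?c m)" using coe by simp
    also have "\<dots> = (\<Sum>U\<in>Pow S. \<Sum>m | m \<in> {m. m \<in> ?k \<and> mdeg m = n \<and> Poly_Mapping.keys m \<subseteq> S} \<and> Poly_Mapping.keys m = U. ?c m)"
      by (rule sum.group[symmetric]) (use psubset.hyps in auto)
    also have "\<dots> = (\<Sum>U\<in>Pow S. \<beta> n U)"
      unfolding \<beta>_def \<kappa>_def by (intro sum.cong refl) auto
    also have "\<dots> = \<beta> n S + (\<Sum>U\<in>Pow S - {S}. \<beta> n U)"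
      using psubset.hyps by (subst sum.remove[of _ S]) auto
    also have "(\<Sum>U\<in>Pow S - {S}. \<beta> n U) = 0" using psubset.IH by (intro sum.neutral) auto
    finally show ?case by simp
  qed
  let ?h = "\<lambda>m. normal_mono (fst (\<kappa> m)) (snd (\<kappa> m))"
  have "(\<Sum>m\<in>?k. Poly_Mapping.single (?h m) (?c m))
    = (\<Sum>y\<in>\<kappa> ` ?k. \<Sum>m\<in>{m\<in>?k. \<kappa> m = y}. Poly_Mapping.single (?h m) (?c m))"
    by (rule sum.image_gen) simp
  also have "\<dots> = (\<Sum>y\<in>\<kappa> ` ?k. 0)"
  proof (rule sum.cong[OF refl])
    fix y assume "y \<in> \<kappa> ` ?k"
    then obtain n S where y: "y = (n, S)" "finite S" by (auto simp: \<kappa>_def)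
    have "(\<Sum>m\<in>{m\<in>?k. \<kappa> m = y}. Poly_Mapping.single (?h m) (?c m)) = (\<Sum>m\<in>{m\<in>?k. \<kappa> m = y}. Poly_Mapping.single (normal_mono n S) (?c m))"
      by (rule sum.cong) (auto simp: y)
    also have "\<dots> = Poly_Mapping.single (normal_mono n S) (\<beta> n S)"
      unfolding \<beta>_def y(1) by (simp only: single_sum)
    finally show "(\<Sum>m\<in>{m\<in>?k. \<kappa> m = y}. Poly_Mapping.single (?h m) (?c m)) = 0" using \<beta>0[OF y(2)] by simp
  qed
  finally have h0: "(\<Sum>m\<in>?k. Poly_Mapping.single (?h m) (?c m)) = 0" by simp
  have "p = (\<Sum>m\<in>?k. Poly_Mapping.single m (?c m)) + (\<Sum>m\<in>?k. Poly_Mapping.single (?h m) (?c m))"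
    unfolding h0 using sum_singles[of p] by simp
  also have "\<dots> = (\<Sum>m\<in>?k. Poly_Mapping.single m (?c m) + Poly_Mapping.single (?h m) (?c m))" by (simp add: sum.distrib)
  finally have pe: "p = (\<Sum>m\<in>?k. Poly_Mapping.single m (?c m) + Poly_Mapping.single (?h m) (?c m))" .
  have mem: "Poly_Mapping.single m (?c m) + Poly_Mapping.single (?h m) (?c m) \<in> chern_rel_ideal r" if m: "m \<in> ?k" for m
  proof -
    have "?c m \<noteq> 0" using m by (simp add: in_keys_iff)
    then have "?c m = 1" by simp
    then show ?thesis using monomial_cong_normal_mono[of m r] m p by (simp add: \<kappa>_def mpoly_ring_simps)
  qed
  have sumI: "sum f A \<in> chern_rel_ideal r" if "\<And>m. m \<in> A \<Longrightarrow> f m \<in> chern_rel_ideal r" for f and A :: "mono set"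
    using that by (induction A rule: infinite_finite_induct) (auto intro: chern_ideal_closed)
  have "(\<Sum>m\<in>?k. Poly_Mapping.single m (?c m) + Poly_Mapping.single (?h m) (?c m)) \<in> chern_rel_ideal r"
    by (rule sumI) (rule mem)
  then show ?thesis unfolding pe[symmetric] .
qed

lemma kernel_pval: "a_kernel (mpoly_ring r) Dring (\<lambda>p T. pval T p) = chern_rel_ideal r"
proof
  interpret M: cring "mpoly_ring r" by (rule cring_mpoly_ring)
  interpret h: ring_hom_ring "mpoly_ring r" Dring "\<lambda>p T. pval T p" by (rule pval_hom)
  show "chern_rel_ideal r \<subseteq> a_kernel (mpoly_ring r) Dring (\<lambda>p T. pval T p)"
    unfolding chern_rel_ideal_def
  proof (rule M.genideal_minimal[OF h.kernel_is_ideal])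
    show "{mvar i ^ 2 * mvar j + mvar i * mvar j ^ 2 |i j. i \<in> {1..r} \<and> j \<in> {1..r}} \<subseteq> a_kernel (mpoly_ring r) Dring (\<lambda>p T. pval T p)"
      unfolding chern_rels_def[symmetric]
    proof
      fix p assume p: "p \<in> chern_rels r"
      have "(\<lambda>T. pval T p) = \<zero>\<^bsub>Dring\<^esub>" using pval_chern_rels[OF p] by (simp add: Dring_def)
      then show "p \<in> a_kernel (mpoly_ring r) Dring (\<lambda>p T. pval T p)"
        using chern_rels_in p unfolding a_kernel_def' by blast
    qed
  qed
  show "a_kernel (mpoly_ring r) Dring (\<lambda>p T. pval T p) \<subseteq> chern_rel_ideal r"
  proof
    fix p assume "p \<in> a_kernel (mpoly_ring r) Dring (\<lambda>p T. pval T p)"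
    then have p: "p \<in> carrier (mpoly_ring r)" and z: "(\<lambda>T. pval T p) = (\<lambda>T. 0)"
      unfolding a_kernel_def' by (simp_all add: Dring_def)
    have "pval T p = 0" for T using z by (rule fun_cong)
    then show "p \<in> chern_rel_ideal r" by (rule pval_kernel[OF p])
  qed
qed

section \<open>Comparison of the images\<close>

context elem_ab_2_reps
begin

text \<open>The product of the \<open>x\<^sub>i\<close> has value \<open>\<plusminus>2\<^sup>n\<close> or \<open>0\<close>, and the sign disappears modulo 2.\<close>

lemma digits_monomial:
  assumes m: "Poly_Mapping.keys m \<subseteq> {1..r}"
  shows "\<exists>f\<in>carrier GR. \<forall>T. digits T f = mval T m"
proof -
  let ?l = "sorted_list_of_set (Poly_Mapping.keys m)"
  define ls where "ls = concat (map (\<lambda>i. replicate (Poly_Mapping.lookup m i) i) ?l)"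
  have ls: "set ls = Poly_Mapping.keys m" by (auto simp: ls_def in_keys_iff)
  have "length ls = (\<Sum>i\<leftarrow>?l. Poly_Mapping.lookup m i)" by (simp add: ls_def length_concat comp_def)
  also have "\<dots> = mdeg m" by (simp add: mdeg_def sum_list_distinct_conv_sum_set)
  finally have len: "length ls = mdeg m" .
  note x = aug_gen_prod_facts[of ls, unfolded ls len, OF m]
  have ev0: "ev {} (aug_gen_prod ls) = 0" if "mdeg m \<noteq> 0"
  proof -
    have "Poly_Mapping.keys m \<noteq> {}" using that by (auto simp: mdeg_def)
    then show ?thesis using x(2)[of "{}"] by simp
  qed
  have dv: "(2::int) ^ n dvd (-2) ^ n" for n by (simp add: power_minus[of "2::int"])
  have F: "aug_gen_prod ls \<in> Fil (mdeg m)" unfolding Fil_def using x ev0 dv by auto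
  have q: "(-2) ^ n div 2 ^ n = (-1::int) ^ n" for n by (simp add: power_minus[of "2::int"])
  have "(of_int ((-1) ^ n) :: bit) = 1" for n by simp
  then have "digits T (gr_homog K (mdeg m) (aug_gen_prod ls)) = mval T m" for T
    using digits_homog(2)[OF F, of T] x(2)[of T] q[of "mdeg m"] by (auto simp: mval_def)
  then show ?thesis using digits_homog(1)[OF F] by blast
qed

lemma digits_sum:
  assumes "finite A" "\<And>i. i \<in> A \<Longrightarrow> \<exists>f\<in>carrier GR. \<forall>T. digits T f = q i T"
  shows "\<exists>f\<in>carrier GR. \<forall>T. digits T f = (\<Sum>i\<in>A. q i T)"
  using assms
proof (induction A)
  case empty
  then show ?case using digits_zero by (intro bexI[of _ "\<zero>\<^bsub>GR\<^esub>"]) auto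
next
  case (insert x F)
  obtain f where f: "f \<in> carrier GR" "\<forall>T. digits T f = (\<Sum>i\<in>F. q i T)" using insert by auto
  obtain g where g: "g \<in> carrier GR" "\<forall>T. digits T g = q x T" using insert.prems by auto
  show ?case using digits_add[OF g(1) f(1)] f g insert.hyps by (intro bexI[of _ "g \<oplus>\<^bsub>GR\<^esub> f"]) auto
qed

lemma pval_in_digits:
  assumes p: "p \<in> carrier (mpoly_ring r)"
  shows "\<exists>f\<in>carrier GR. \<forall>T. digits T f = pval T p"
  unfolding pval_def
proof (rule digits_sum)
  fix m assume m: "m \<in> Poly_Mapping.keys p"
  then have "Poly_Mapping.lookup p m = 1" by (simp add: in_keys_iff)
  moreover have "Poly_Mapping.keys m \<subseteq> {1..r}" using p m by (simp add: mpoly_ring_simps)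
  ultimately show "\<exists>f\<in>carrier GR. \<forall>T. digits T f = smult (Poly_Mapping.lookup p m) (mval T m)"
    using digits_monomial by simp
qed simp

text \<open>By inclusion-exclusion the digits of \<open>x\<close> are sums of the \<open>c\<^sub>S\<close> over \<open>S \<subseteq> T\<close>. The \<open>c\<^sub>S\<close> with
  \<open>|S| > n\<close> are even, and every other nonempty \<open>S\<close> is the set of variables of a monomial of degree \<open>n\<close>.\<close>

lemma Fil_in_pval:
  assumes x: "x \<in> Fil n"
  shows "\<exists>p\<in>carrier (mpoly_ring r). \<forall>T. pval T p = monom (of_int (ev T x div 2 ^ n)) n"
proof -
  obtain c where c: "\<And>T. ev T x = 2 ^ n * (\<Sum>S\<in>Pow {1..r}. if S \<subseteq> T then c S else 0)"
    "\<And>S. 2 ^ card S dvd 2 ^ n * c S" "n \<ge> 1 \<Longrightarrow> c {} = (0::int)" using Fil_coeffs[OF x] by blast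
  let ?P = "\<lambda>S. card S \<le> n \<and> (S = {} \<longrightarrow> n = 0)"
  have even: "(of_int (c S) :: bit) = 0" if "\<not> ?P S" for S
  proof (cases "card S \<le> n")
    case True
    then show ?thesis using that c(3) by auto
  next
    case False
    then have "(2::int) ^ Suc n dvd 2 ^ card S" by (intro le_imp_power_dvd) simp
    then have "2 ^ Suc n dvd 2 ^ n * c S" using c(2)[of S] by (rule dvd_trans)
    then have "2 ^ n * 2 dvd 2 ^ n * c S" by (simp only: power_Suc2)
    then have "2 dvd c S" by simp
    then show ?thesis using of_int_bit_eq_iff[of "c S" 0] by simp
  qed
  let ?A = "{S \<in> Pow {1..r}. ?P S}"
  define p where "p = (\<Sum>S\<in>?A. Poly_Mapping.single (normal_mono n S) (of_int (c S) :: bit))"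
  have k: "Poly_Mapping.keys (normal_mono n S) = S" "mdeg (normal_mono n S) = n" if "S \<in> ?A" for S
  proof -
    have S: "finite S" "card S \<le> n" "S = {} \<Longrightarrow> n = 0" using that finite_subset[of S "{1..r}"] by auto
    show "Poly_Mapping.keys (normal_mono n S) = S" "mdeg (normal_mono n S) = n" by (rule keys_normal_mono[OF S]; assumption)+
  qed
  have "p \<in> carrier (mpoly_ring r)"
    unfolding mpoly_ring_simps
  proof
    fix m assume "m \<in> Poly_Mapping.keys p"
    then have "m \<in> (\<Union>S\<in>?A. Poly_Mapping.keys (Poly_Mapping.single (normal_mono n S) (of_int (c S) :: bit)))"
      unfolding p_def by (rule subsetD[OF Poly_Mapping.keys_sum])
    then obtain S where S: "S \<in> ?A" "m \<in> Poly_Mapping.keys (Poly_Mapping.single (normal_mono n S) (of_int (c S) :: bit))"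
      by (rule UN_E)
    have "m = normal_mono n S" using S(2) unfolding keys_single by (metis empty_iff singletonD)
    then show "Poly_Mapping.keys m \<subseteq> {1..r}" using k(1)[OF S(1)] S(1) by auto
  qed
  moreover have "pval T p = monom (of_int (ev T x div 2 ^ n)) n" for T
  proof -
    have "pval T p = (\<Sum>S\<in>?A. monom (if S \<subseteq> T then of_int (c S) else 0) n)"
      unfolding p_def pval_sum pval_single
      by (rule sum.cong) (use k in \<open>auto simp: mval_def smult_monom\<close>)
    also have "\<dots> = monom (\<Sum>S\<in>?A. if S \<subseteq> T then of_int (c S) else 0) n"
      by (rule poly_eqI) (simp add: coeff_sum)
    also have "(\<Sum>S\<in>?A. if S \<subseteq> T then of_int (c S) else (0::bit)) = (\<Sum>S\<in>Pow {1..r}. if S \<subseteq> T then of_int (c S) else 0)"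
      by (rule sum.mono_neutral_left) (use even in auto)
    also have "\<dots> = of_int (\<Sum>S\<in>Pow {1..r}. if S \<subseteq> T then c S else 0)"
      unfolding of_int_sum by (rule sum.cong) auto
    also have "(\<Sum>S\<in>Pow {1..r}. if S \<subseteq> T then c S else 0) = ev T x div 2 ^ n" unfolding c(1) by simp
    finally show ?thesis .
  qed
  ultimately show ?thesis by blast
qed

lemma digits_in_pval:
  assumes f: "f \<in> carrier GR"
  shows "\<exists>p\<in>carrier (mpoly_ring r). \<forall>T. pval T p = digits T f"
proof -
  obtain x where x: "represents x f" using represents_ex[OF f] by (rule exE)
  have "\<exists>p\<in>carrier (mpoly_ring r). \<forall>T. pval T p = monom (of_int (ev T (x n) div 2 ^ n)) n" for n
    using x by (intro Fil_in_pval) (simp add: represents_def)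
  then obtain q where q: "\<And>n. q n \<in> carrier (mpoly_ring r)" "\<And>n T. pval T (q n) = monom (of_int (ev T (x n) div 2 ^ n)) n"
    by metis
  let ?A = "{n. x n \<noteq> \<zero>\<^bsub>PR\<^esub>}"
  have fin: "finite ?A" using x by (simp add: represents_def)
  have "sum q B \<in> carrier (mpoly_ring r)" for B
    by (induction B rule: infinite_finite_induct) (simp_all add: mpoly_closed(1) q(1) mpoly_zero_in)
  moreover have "pval T (sum q ?A) = digits T f" for T
  proof (rule poly_eqI)
    fix n
    have "coeff (pval T (sum q ?A)) n = (\<Sum>m\<in>?A. if m = n then of_int (ev T (x m) div 2 ^ m) else 0)"
      by (simp add: pval_sum q(2) coeff_sum)
    also have "\<dots> = (if n \<in> ?A then of_int (ev T (x n) div 2 ^ n) else 0)" using fin by (simp add: sum.delta')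
    also have "\<dots> = of_int (ev T (x n) div 2 ^ n)" by (auto simp: PR_consts)
    also have "\<dots> = coeff (digits T f) n" by (rule represents_coeff[OF x, symmetric])
    finally show "coeff (pval T (sum q ?A)) n = coeff (digits T f) n" .
  qed
  ultimately show ?thesis by blast
qed

lemma images_eq: "(\<lambda>p T. pval T p) ` carrier (mpoly_ring r) = (\<lambda>f T. digits T f) ` carrier GR"
proof (intro equalityI subsetI)
  fix h assume "h \<in> (\<lambda>p T. pval T p) ` carrier (mpoly_ring r)"
  then obtain p where p: "p \<in> carrier (mpoly_ring r)" "h = (\<lambda>T. pval T p)" by blast
  obtain f where f: "f \<in> carrier GR" "\<forall>T. digits T f = pval T p" using pval_in_digits[OF p(1)] by blast
  have "h = (\<lambda>T. digits T f)" using f(2) p(2) by auto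
  then show "h \<in> (\<lambda>f T. digits T f) ` carrier GR" using f(1) by blast
next
  fix h assume "h \<in> (\<lambda>f T. digits T f) ` carrier GR"
  then obtain f where f: "f \<in> carrier GR" "h = (\<lambda>T. digits T f)" by blast
  obtain p where p: "p \<in> carrier (mpoly_ring r)" "\<forall>T. pval T p = digits T f" using digits_in_pval[OF f(1)] by blast
  have "h = (\<lambda>T. pval T p)" using f(2) p(2) by auto
  then show "h \<in> (\<lambda>p T. pval T p) ` carrier (mpoly_ring r)" using p(1) by blast
qed

end

section \<open>The tensor product with the field of two elements\<close>

lemma frag_extend_add_fun: "frag_extend (\<lambda>x. f x + g x) s = frag_extend f s + frag_extend g s"
  by (simp add: frag_extend_def frag_cmul_distrib2 sum.distrib)

lemma frag_extend_diff_fun: "frag_extend (\<lambda>x. f x - g x) s = frag_extend f s - frag_extend g s"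
proof -
  have "frag_extend (\<lambda>x. (f x - g x) + g x) s = frag_extend (\<lambda>x. f x - g x) s + frag_extend g s"
    by (rule frag_extend_add_fun)
  then show ?thesis by simp
qed

lemma frag_extend_0_fun: "frag_extend (\<lambda>x. 0) s = 0"
  by (simp add: frag_extend_def)

text \<open>The product of formal sums, named so that its bilinearity can be stated.\<close>

definition free_mult :: "('a, 'c) ring_scheme \<Rightarrow> ('b, 'd) ring_scheme \<Rightarrow> ('a \<times> 'b \<Rightarrow>\<^sub>0 int) \<Rightarrow> ('a \<times> 'b \<Rightarrow>\<^sub>0 int) \<Rightarrow> ('a \<times> 'b \<Rightarrow>\<^sub>0 int)"
  where "free_mult A B s t = frag_extend (\<lambda>(a, b). frag_extend
        (\<lambda>(a', b'). frag_of (a \<otimes>\<^bsub>A\<^esub> a', b \<otimes>\<^bsub>B\<^esub> b')) t) s"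

lemma free_prod_ring_simps:
  "s \<in> carrier (free_prod_ring A B) \<longleftrightarrow> Poly_Mapping.keys s \<subseteq> carrier A \<times> carrier B"
  "s \<otimes>\<^bsub>free_prod_ring A B\<^esub> t = free_mult A B s t"
  "s \<oplus>\<^bsub>free_prod_ring A B\<^esub> t = s + t"
  "\<one>\<^bsub>free_prod_ring A B\<^esub> = frag_of (\<one>\<^bsub>A\<^esub>, \<one>\<^bsub>B\<^esub>)" "\<zero>\<^bsub>free_prod_ring A B\<^esub> = 0"
  by (simp_all add: free_prod_ring_def free_mult_def)

lemma free_mult_of: "free_mult A B (frag_of (a, b)) (frag_of (a', b')) = frag_of (a \<otimes>\<^bsub>A\<^esub> a', b \<otimes>\<^bsub>B\<^esub> b')"
  by (simp add: free_mult_def)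

lemma free_mult_linear:
  "free_mult A B 0 t = 0" "free_mult A B s 0 = 0"
  "free_mult A B (s + s') t = free_mult A B s t + free_mult A B s' t"
  "free_mult A B s (t + t') = free_mult A B s t + free_mult A B s t'"
  "free_mult A B (s - s') t = free_mult A B s t - free_mult A B s' t"
  "free_mult A B s (t - t') = free_mult A B s t - free_mult A B s t'"
  by (simp_all add: free_mult_def frag_extend_add frag_extend_diff case_prod_unfold
      frag_extend_add_fun frag_extend_diff_fun frag_extend_0_fun)

text \<open>All laws are bilinear or trilinear, so they follow from the laws for generators.\<close>

lemma ring_free_prod_ring:
  assumes "ring A" "ring B" shows "ring (free_prod_ring A B)"
proof -
  interpret A: ring A by fact
  interpret B: ring B by fact
  let ?X = "carrier A \<times> carrier B" and ?M = "free_mult A B"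
  have closed: "Poly_Mapping.keys (?M s t) \<subseteq> ?X" if s: "Poly_Mapping.keys s \<subseteq> ?X" and t: "Poly_Mapping.keys t \<subseteq> ?X" for s t
    using s
  proof (induction s rule: frag_induction)
    case (one x)
    obtain a b where x: "x = (a, b)" "a \<in> carrier A" "b \<in> carrier B" using one by auto
    show ?case using t
    proof (induction t rule: frag_induction)
      case (one y)
      then show ?case using x by (cases y) (auto simp: free_mult_of)
    next
      case (diff t t')
      then show ?case using keys_diff[of "?M (frag_of x) t" "?M (frag_of x) t'"] by (auto simp: free_mult_linear)
    qed (simp add: free_mult_linear)
  next
    case (diff s s')
    then show ?case using keys_diff[of "?M s t" "?M s' t"] by (auto simp: free_mult_linear)
  qed (simp add: free_mult_linear)
  have assoc: "?M (?M s t) u = ?M s (?M t u)"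
    if s: "Poly_Mapping.keys s \<subseteq> ?X" and t: "Poly_Mapping.keys t \<subseteq> ?X" and u: "Poly_Mapping.keys u \<subseteq> ?X" for s t u
    using s
  proof (induction s rule: frag_induction)
    case (one x)
    show ?case using t
    proof (induction t rule: frag_induction)
      case (one y)
      show ?case using u
      proof (induction u rule: frag_induction)
        case (one z)
        then show ?case using \<open>x \<in> ?X\<close> \<open>y \<in> ?X\<close>
          by (cases x; cases y; cases z) (simp add: free_mult_of A.m_assoc B.m_assoc)
      qed (simp_all add: free_mult_linear)
    qed (simp_all add: free_mult_linear)
  qed (simp_all add: free_mult_linear)
  have unit: "?M (frag_of (\<one>\<^bsub>A\<^esub>, \<one>\<^bsub>B\<^esub>)) s = s" "?M s (frag_of (\<one>\<^bsub>A\<^esub>, \<one>\<^bsub>B\<^esub>)) = s"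
    if s: "Poly_Mapping.keys s \<subseteq> ?X" for s
  proof -
    show "?M (frag_of (\<one>\<^bsub>A\<^esub>, \<one>\<^bsub>B\<^esub>)) s = s" using s
    proof (induction s rule: frag_induction)
      case (one x)
      then show ?case by (cases x) (simp add: free_mult_of)
    qed (simp_all add: free_mult_linear)
    show "?M s (frag_of (\<one>\<^bsub>A\<^esub>, \<one>\<^bsub>B\<^esub>)) = s" using s
    proof (induction s rule: frag_induction)
      case (one x)
      then show ?case by (cases x) (simp add: free_mult_of)
    qed (simp_all add: free_mult_linear)
  qed
  show ?thesis
  proof (rule ringI)
    show "abelian_group (free_prod_ring A B)"
    proof (rule abelian_groupI)
      fix s t assume "s \<in> carrier (free_prod_ring A B)" "t \<in> carrier (free_prod_ring A B)"
      then show "s \<oplus>\<^bsub>free_prod_ring A B\<^esub> t \<in> carrier (free_prod_ring A B)"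
        using Poly_Mapping.keys_add[of s t] by (auto simp: free_prod_ring_simps)
    next
      fix s assume "s \<in> carrier (free_prod_ring A B)"
      then show "\<exists>t\<in>carrier (free_prod_ring A B). t \<oplus>\<^bsub>free_prod_ring A B\<^esub> s = \<zero>\<^bsub>free_prod_ring A B\<^esub>"
        by (intro bexI[of _ "- s"]) (simp_all add: free_prod_ring_simps)
    qed (simp_all add: free_prod_ring_simps ac_simps)
    show "monoid (free_prod_ring A B)"
      by (rule monoidI) (simp_all add: free_prod_ring_simps closed assoc unit)
  qed (simp_all add: free_prod_ring_simps free_mult_linear)
qed

text \<open>The additive extension of \<open>\<phi>\<close>, with values in a ring rather than in formal sums.\<close>

definition lin_ext :: "('x \<Rightarrow> 'y::comm_ring_1) \<Rightarrow> ('x \<Rightarrow>\<^sub>0 int) \<Rightarrow> 'y"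
  where "lin_ext \<phi> s = (\<Sum>x\<in>Poly_Mapping.keys s. of_int (Poly_Mapping.lookup s x) * \<phi> x)"

lemma lin_ext_superset:
  "finite A \<Longrightarrow> Poly_Mapping.keys s \<subseteq> A \<Longrightarrow> lin_ext \<phi> s = (\<Sum>x\<in>A. of_int (Poly_Mapping.lookup s x) * \<phi> x)"
  unfolding lin_ext_def by (rule sum.mono_neutral_left) (auto simp: in_keys_iff)

lemma lin_ext_add: "lin_ext \<phi> (s + t) = lin_ext \<phi> s + lin_ext \<phi> t"
proof -
  let ?A = "Poly_Mapping.keys s \<union> Poly_Mapping.keys t"
  have "lin_ext \<phi> (s + t) = (\<Sum>x\<in>?A. of_int (Poly_Mapping.lookup (s + t) x) * \<phi> x)"
    by (rule lin_ext_superset[OF _ Poly_Mapping.keys_add]) simp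
  also have "\<dots> = (\<Sum>x\<in>?A. of_int (Poly_Mapping.lookup s x) * \<phi> x) + (\<Sum>x\<in>?A. of_int (Poly_Mapping.lookup t x) * \<phi> x)"
    by (simp add: lookup_add distrib_right sum.distrib)
  also have "(\<Sum>x\<in>?A. of_int (Poly_Mapping.lookup s x) * \<phi> x) = lin_ext \<phi> s"
    by (rule lin_ext_superset[symmetric]) auto
  also have "(\<Sum>x\<in>?A. of_int (Poly_Mapping.lookup t x) * \<phi> x) = lin_ext \<phi> t"
    by (rule lin_ext_superset[symmetric]) auto
  finally show ?thesis .
qed

lemma lin_ext_0 [simp]: "lin_ext \<phi> 0 = 0" by (simp add: lin_ext_def)

lemma lin_ext_diff: "lin_ext \<phi> (s - t) = lin_ext \<phi> s - lin_ext \<phi> t"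
  using lin_ext_add[of \<phi> "s - t" t] by simp

lemma lin_ext_of [simp]: "lin_ext \<phi> (frag_of x) = \<phi> x"
  by (simp add: lin_ext_def)

lemma F2_simps [simp]: "carrier F2 = UNIV" "x \<oplus>\<^bsub>F2\<^esub> y = x + y" "x \<otimes>\<^bsub>F2\<^esub> y = x * y" "\<one>\<^bsub>F2\<^esub> = 1" "\<zero>\<^bsub>F2\<^esub> = 0"
  by (simp_all add: ring_of_type_algebra_def)

lemma ring_F2: "ring F2"
  by (rule ring_from_type_algebra)

lemma smult_mult_mult: "smult (a * b) (p * q) = smult a p * smult b q"
  by (simp only: mult_smult_left mult_smult_right smult_smult mult.commute[of b a])

context elem_ab_2_reps
begin

abbreviation "FP \<equiv> free_prod_ring GR F2"
abbreviation "J \<equiv> tensor_ideal GR F2"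

lemma ring_FP: "ring FP"
  by (rule ring_free_prod_ring[OF cring.axioms(1)[OF cring_GR] ring_F2])

definition \<Theta> :: "((nat \<Rightarrow> (nat \<Rightarrow> int, 'k) vrep set) \<times> bit \<Rightarrow>\<^sub>0 int) \<Rightarrow> nat set \<Rightarrow> bit poly"
  where "\<Theta> s = (\<lambda>T. lin_ext (\<lambda>(f, b). smult b (digits T f)) s)"

lemma \<Theta>_of: "\<Theta> (frag_of (f, b)) = (\<lambda>T. smult b (digits T f))"
  by (simp add: \<Theta>_def)

lemma \<Theta>_mult:
  assumes s: "s \<in> carrier FP" and t: "t \<in> carrier FP"
  shows "\<Theta> (free_mult GR F2 s t) T = \<Theta> s T * \<Theta> t T"
  using s unfolding free_prod_ring_simps
proof (induction s rule: frag_induction)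
  case (one x)
  show ?case using t unfolding free_prod_ring_simps
  proof (induction t rule: frag_induction)
    case (one y)
    then show ?case using \<open>x \<in> carrier GR \<times> carrier F2\<close>
      by (cases x; cases y) (simp only: free_mult_of \<Theta>_of F2_simps digits_mult smult_mult_mult mem_Sigma_iff)
  qed (simp_all add: free_mult_linear \<Theta>_def lin_ext_diff right_diff_distrib)
qed (simp_all add: free_mult_linear \<Theta>_def lin_ext_diff left_diff_distrib)

lemma \<Theta>_hom: "ring_hom_ring FP Dring \<Theta>"
proof (rule ring_hom_ringI)
  show "ring FP" by (rule ring_FP)
  show "ring Dring" by (rule cring.axioms(1)[OF cring_Dring])
  fix s t assume "s \<in> carrier FP" "t \<in> carrier FP"
  then show "\<Theta> (s \<otimes>\<^bsub>FP\<^esub> t) = \<Theta> s \<otimes>\<^bsub>Dring\<^esub> \<Theta> t"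
    unfolding free_prod_ring_simps(2) by (intro ext) (simp add: \<Theta>_mult Dring_def)
next
  fix s t show "\<Theta> (s \<oplus>\<^bsub>FP\<^esub> t) = \<Theta> s \<oplus>\<^bsub>Dring\<^esub> \<Theta> t"
    unfolding free_prod_ring_simps(3) by (simp add: \<Theta>_def lin_ext_add Dring_def)
next
  show "\<Theta> \<one>\<^bsub>FP\<^esub> = \<one>\<^bsub>Dring\<^esub>"
    unfolding free_prod_ring_simps by (simp add: \<Theta>_of digits_one Dring_def one_pCons)
qed (simp add: Dring_def)

lemma rels_in: "tensor_rels GR F2 \<subseteq> carrier FP"
proof
  interpret GR: cring GR by (rule cring_GR)
  fix s assume "s \<in> tensor_rels GR F2"
  then have "\<exists>x y z. s = frag_of x - frag_of y - frag_of z \<and> x \<in> carrier GR \<times> UNIV \<and> y \<in> carrier GR \<times> UNIV \<and> z \<in> carrier GR \<times> UNIV"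
    unfolding tensor_rels_def
  proof (elim UnE CollectE exE conjE)
    fix a a' b assume s: "s = frag_of (a \<oplus>\<^bsub>GR\<^esub> a', b) - frag_of (a, b) - frag_of (a', b)" and c: "a \<in> carrier GR" "a' \<in> carrier GR"
    show ?thesis
      by (rule exI[of _ "(a \<oplus>\<^bsub>GR\<^esub> a', b)"], rule exI[of _ "(a, b)"], rule exI[of _ "(a', b)"])
        (use s c GR.a_closed[OF c] in simp)
  next
    fix a b b' assume s: "s = frag_of (a, b \<oplus>\<^bsub>F2\<^esub> b') - frag_of (a, b) - frag_of (a, b')" and c: "a \<in> carrier GR"
    show ?thesis
      by (rule exI[of _ "(a, b \<oplus>\<^bsub>F2\<^esub> b')"], rule exI[of _ "(a, b)"], rule exI[of _ "(a, b')"])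
        (use s c in \<open>simp del: F2_simps(2)\<close>)
  qed
  then obtain x y z where s: "s = frag_of x - frag_of y - frag_of z" "x \<in> carrier GR \<times> UNIV" "y \<in> carrier GR \<times> UNIV" "z \<in> carrier GR \<times> UNIV" by blast
  have "Poly_Mapping.keys s \<subseteq> {x, y, z}"
    unfolding s(1) using keys_diff[of "frag_of x - frag_of y" "frag_of z"] keys_diff[of "frag_of x" "frag_of y"] by auto
  then show "s \<in> carrier FP" unfolding free_prod_ring_simps using s(2-) by auto
qed

lemma J_ideal: "ideal J FP" and rels_J: "tensor_rels GR F2 \<subseteq> J"
  unfolding tensor_ideal_def using ring.genideal_ideal[OF ring_FP rels_in] ring.genideal_self[OF ring_FP rels_in] by auto

lemma J_closed:
  "0 \<in> J" "s \<in> J \<Longrightarrow> t \<in> J \<Longrightarrow> s + t \<in> J" "s \<in> J \<Longrightarrow> - s \<in> J" "s \<in> J \<Longrightarrow> t \<in> J \<Longrightarrow> s - t \<in> J"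
proof -
  interpret FP: ring FP by (rule ring_FP)
  note sub = ideal.axioms(1)[OF J_ideal]
  show "0 \<in> J" using additive_subgroup.zero_closed[OF sub] by (simp add: free_prod_ring_simps)
  show add: "s \<in> J \<Longrightarrow> t \<in> J \<Longrightarrow> s + t \<in> J" for s t using additive_subgroup.a_closed[OF sub, of s t] by (simp add: free_prod_ring_simps)
  show neg: "s \<in> J \<Longrightarrow> - s \<in> J" for s
  proof -
    assume s: "s \<in> J"
    then have c: "s \<in> carrier FP" using additive_subgroup.a_Hcarr[OF sub] by blast
    have "\<ominus>\<^bsub>FP\<^esub> s = - s" by (rule FP.minus_equality) (use c in \<open>auto simp: free_prod_ring_simps\<close>)
    then show ?thesis using additive_subgroup.a_inv_closed[OF sub s] by simp
  qed
  show "s \<in> J \<Longrightarrow> t \<in> J \<Longrightarrow> s - t \<in> J" using add[of s "- t"] neg by simp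
qed

lemma J_rel_left: "f \<in> carrier GR \<Longrightarrow> g \<in> carrier GR \<Longrightarrow> frag_of (f \<oplus>\<^bsub>GR\<^esub> g, b) - frag_of (f, b) - frag_of (g, b) \<in> J"
  by (rule subsetD[OF rels_J]) (unfold tensor_rels_def, rule UnI1, rule CollectI,
      intro exI[of _ f] exI[of _ g] exI[of _ b], simp)

lemma J_rel_right: "f \<in> carrier GR \<Longrightarrow> frag_of (f, b + c) - frag_of (f, b) - frag_of (f, c) \<in> J"
  by (rule subsetD[OF rels_J]) (unfold tensor_rels_def, rule UnI2, rule CollectI,
      intro exI[of _ f] exI[of _ b] exI[of _ c], simp only: F2_simps, simp)

lemma J_ker: "J \<subseteq> a_kernel FP Dring \<Theta>"
proof -
  interpret FP: ring FP by (rule ring_FP)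
  interpret h: ring_hom_ring FP Dring \<Theta> by (rule \<Theta>_hom)
  show ?thesis unfolding tensor_ideal_def
  proof (rule FP.genideal_minimal[OF h.kernel_is_ideal])
    show "tensor_rels GR F2 \<subseteq> a_kernel FP Dring \<Theta>"
    proof
      fix s assume s: "s \<in> tensor_rels GR F2"
      have "\<Theta> s = (\<lambda>T. 0)" using s unfolding tensor_rels_def
      proof (elim UnE CollectE exE conjE)
        fix a a' b assume "s = frag_of (a \<oplus>\<^bsub>GR\<^esub> a', b) - frag_of (a, b) - frag_of (a', b)" "a \<in> carrier GR" "a' \<in> carrier GR"
        then show ?thesis by (simp add: \<Theta>_def lin_ext_diff digits_add smult_add_right)
      next
        fix a b b' assume "s = frag_of (a, b \<oplus>\<^bsub>F2\<^esub> b') - frag_of (a, b) - frag_of (a, b')"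
        then show ?thesis by (simp only: F2_simps \<Theta>_def lin_ext_diff lin_ext_of prod.case smult_add_left) simp
      qed
      then show "s \<in> a_kernel FP Dring \<Theta>" using rels_in s unfolding a_kernel_def' by (auto simp: Dring_def)
    qed
  qed
qed

lemma J_zero: "f \<in> carrier GR \<Longrightarrow> frag_of (f, 0) \<in> J" "frag_of (\<zero>\<^bsub>GR\<^esub>, b) \<in> J"
proof -
  interpret GR: cring GR by (rule cring_GR)
  show "frag_of (f, 0) \<in> J" if "f \<in> carrier GR"
    using J_closed(3)[OF J_rel_right[OF that, of 0 0]] by simp
  show "frag_of (\<zero>\<^bsub>GR\<^esub>, b) \<in> J"
    using J_closed(3)[OF J_rel_left[of "\<zero>\<^bsub>GR\<^esub>" "\<zero>\<^bsub>GR\<^esub>" b]] by simp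
qed

text \<open>Since \<open>\<F>\<^sub>2\<close> is generated by 1, every tensor equals \<open>f \<otimes> 1\<close> for some \<open>f\<close>.\<close>

lemma reduce_to_pure:
  assumes "s \<in> carrier FP"
  shows "\<exists>f\<in>carrier GR. s - frag_of (f, 1) \<in> J"
  using assms unfolding free_prod_ring_simps
proof (induction s rule: frag_induction)
  case zero
  then show ?case using J_closed(3)[OF J_zero(2)[of 1]] digits_zero(3) by (intro bexI[of _ "\<zero>\<^bsub>GR\<^esub>"]) simp_all
next
  case (one x)
  obtain f b where x: "x = (f, b)" "f \<in> carrier GR" using one by auto
  show ?case
  proof (cases "b = 1")
    case True
    then show ?thesis using x J_closed(1) by (intro bexI[of _ f]) simp_all
  next
    case False
    then have "b = 0" by simp
    then show ?thesis using x J_closed(4)[OF J_zero(1)[OF x(2)] J_zero(2)[of 1]] digits_zero(3)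
      by (intro bexI[of _ "\<zero>\<^bsub>GR\<^esub>"]) simp_all
  qed
next
  case (diff s t)
  interpret GR: cring GR by (rule cring_GR)
  obtain f g where f: "f \<in> carrier GR" "s - frag_of (f, 1) \<in> J" and g: "g \<in> carrier GR" "t - frag_of (g, 1) \<in> J" using diff by blast
  let ?d = "f \<ominus>\<^bsub>GR\<^esub> g"
  have d: "?d \<in> carrier GR" using f g by simp
  have fd: "?d \<oplus>\<^bsub>GR\<^esub> g = f" using f g by (simp add: GR.minus_eq GR.a_assoc GR.l_neg)
  have "(s - frag_of (f, 1)) - (t - frag_of (g, 1)) + (frag_of (f, 1) - frag_of (?d, 1) - frag_of (g, 1)) \<in> J"
    using J_closed(2)[OF J_closed(4)[OF f(2) g(2)] J_rel_left[OF d g(1), of 1]] unfolding fd .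
  moreover have "(s - frag_of (f, 1)) - (t - frag_of (g, 1)) + (frag_of (f, 1) - frag_of (?d, 1) - frag_of (g, 1))
    = s - t - frag_of (?d, 1)" by simp
  ultimately show ?case using d by (intro bexI[of _ ?d]) simp_all
qed

lemma \<Theta>_reduced:
  assumes "s \<in> carrier FP" "f \<in> carrier GR" "s - frag_of (f, 1) \<in> J"
  shows "\<Theta> s = (\<lambda>T. digits T f)"
proof
  fix T
  have "\<Theta> (s - frag_of (f, 1)) = (\<lambda>T. 0)" using J_ker assms(3) unfolding a_kernel_def' by (auto simp: Dring_def)
  then have "\<Theta> (s - frag_of (f, 1)) T = 0" by simp
  then show "\<Theta> s T = digits T f" by (simp add: \<Theta>_def lin_ext_diff)
qed

lemma kernel_\<Theta>: "a_kernel FP Dring \<Theta> = J"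
proof
  show "J \<subseteq> a_kernel FP Dring \<Theta>" by (rule J_ker)
  show "a_kernel FP Dring \<Theta> \<subseteq> J"
  proof
    fix s assume "s \<in> a_kernel FP Dring \<Theta>"
    then have s: "s \<in> carrier FP" and z: "\<Theta> s = (\<lambda>T. 0)" unfolding a_kernel_def' by (simp_all add: Dring_def)
    obtain f where f: "f \<in> carrier GR" "s - frag_of (f, 1) \<in> J" using reduce_to_pure[OF s] by blast
    have "digits T f = 0" for T using fun_cong[OF \<Theta>_reduced[OF s f], of T] z by simp
    then obtain g where g: "g \<in> carrier GR" "f = g \<oplus>\<^bsub>GR\<^esub> g" using digits_kernel[OF f(1)] by blast
    (* With f = g + g, the tensor of f and 1 equals that of g and 1 + 1 = 0. *)
    have "(1::bit) + 1 = 0" by simp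
    then have r: "frag_of (g, 0) - frag_of (g, 1) - frag_of (g, 1) \<in> J" using J_rel_right[OF g(1), of 1 1] by (simp only:)
    have l: "frag_of (f, 1) - frag_of (g, 1) - frag_of (g, 1) \<in> J" unfolding g(2) by (rule J_rel_left[OF g(1) g(1)])
    have "(s - frag_of (f, 1)) + ((frag_of (f, 1) - frag_of (g, 1) - frag_of (g, 1)) - (frag_of (g, 0) - frag_of (g, 1) - frag_of (g, 1)) + frag_of (g, 0)) \<in> J"
      by (intro J_closed(2) J_closed(4) f(2) l r J_zero(1) g(1))
    then show "s \<in> J" by simp
  qed
qed

lemma pure_in: "f \<in> carrier GR \<Longrightarrow> frag_of (f, b) \<in> carrier FP"
  by (simp add: free_prod_ring_simps)

lemma image_\<Theta>: "\<Theta> ` carrier FP = (\<lambda>f T. digits T f) ` carrier GR"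
proof (intro equalityI subsetI)
  fix h assume "h \<in> \<Theta> ` carrier FP"
  then obtain s where s: "s \<in> carrier FP" "h = \<Theta> s" by blast
  obtain f where f: "f \<in> carrier GR" "s - frag_of (f, 1) \<in> J" using reduce_to_pure[OF s(1)] by blast
  show "h \<in> (\<lambda>f T. digits T f) ` carrier GR" unfolding s(2) \<Theta>_reduced[OF s(1) f] using f(1) by blast
next
  fix h assume "h \<in> (\<lambda>f T. digits T f) ` carrier GR"
  then obtain f where f: "f \<in> carrier GR" "h = (\<lambda>T. digits T f)" by blast
  have "h = \<Theta> (frag_of (f, 1))" unfolding f(2) by (simp add: \<Theta>_of)
  then show "h \<in> \<Theta> ` carrier FP" using pure_in[OF f(1)] by blast
qed

text \<open>Both rings are quotients by the kernels of homomorphisms to the same ring with the same image, and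
  corresponding generators have the same image.\<close>

theorem graded_iso:
  "\<exists>\<phi>\<in>ring_iso (mpoly_ring r Quot chern_rel_ideal r) (tensor_ring GR F2).
    \<forall>i\<in>{1..r}. \<phi> (chern_rel_ideal r +>\<^bsub>mpoly_ring r\<^esub> mvar i) =
      pure_tensor GR F2 (chern K 1 (rep_class G (char_sum r [{i}]))) 1"
proof -
  interpret h: ring_hom_ring "mpoly_ring r" Dring "\<lambda>p T. pval T p" by (rule pval_hom)
  interpret t: ring_hom_ring FP Dring \<Theta> by (rule \<Theta>_hom)
  define \<phi>1 where "\<phi>1 = (\<lambda>Y. the_elem ((\<lambda>(p :: mono \<Rightarrow>\<^sub>0 bit) T. pval T p) ` Y))"
  define \<phi>2 where "\<phi>2 = (\<lambda>Y. the_elem (\<Theta> ` Y))"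
  let ?D = "Dring\<lparr>carrier := \<Theta> ` carrier FP\<rparr>"
  have 1: "\<phi>1 \<in> ring_iso (mpoly_ring r Quot chern_rel_ideal r) ?D"
    using h.FactRing_iso_set_aux unfolding \<phi>1_def kernel_pval image_\<Theta> images_eq .
  have 2: "\<phi>2 \<in> ring_iso (tensor_ring GR F2) ?D"
    using t.FactRing_iso_set_aux unfolding \<phi>2_def kernel_\<Theta> tensor_ring_def .
  have rT: "ring (tensor_ring GR F2)" unfolding tensor_ring_def by (rule ideal.quotient_is_ring[OF J_ideal])
  let ?\<psi> = "inv_into (carrier (tensor_ring GR F2)) \<phi>2"
  have 3: "?\<psi> \<circ> \<phi>1 \<in> ring_iso (mpoly_ring r Quot chern_rel_ideal r) (tensor_ring GR F2)"
    by (rule ring_iso_set_trans[OF 1 ring_iso_set_sym[OF rT 2]])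
  have "(?\<psi> \<circ> \<phi>1) (chern_rel_ideal r +>\<^bsub>mpoly_ring r\<^esub> mvar i) = pure_tensor GR F2 (chern K 1 (rep_class G (char_sum r [{i}]))) 1"
    if i: "i \<in> {1..r}" for i
  proof -
    let ?c = "chern K 1 (rep_class G (char_sum r [{i}]))"
    note c = digits_chern[OF i]
    have p1: "\<phi>1 (chern_rel_ideal r +>\<^bsub>mpoly_ring r\<^esub> mvar i) = (\<lambda>T. pval T (mvar i))"
      using h.the_elem_simp[OF mvar_in[OF i]] unfolding \<phi>1_def kernel_pval .
    have p2: "\<phi>2 (pure_tensor GR F2 ?c 1) = \<Theta> (frag_of (?c, 1))"
      using t.the_elem_simp[OF pure_in[OF c(1), of 1]] unfolding \<phi>2_def kernel_\<Theta> pure_tensor_def .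
    have e: "(\<lambda>T. pval T (mvar i)) = \<Theta> (frag_of (?c, 1))"
      unfolding \<Theta>_of pval_mvar c(2) by simp
    have m: "pure_tensor GR F2 ?c 1 \<in> carrier (tensor_ring GR F2)"
      unfolding pure_tensor_def tensor_ring_def FactRing_def using pure_in[OF c(1), of 1] by (auto simp: A_RCOSETS_def')
    have inj: "inj_on \<phi>2 (carrier (tensor_ring GR F2))" using 2 by (simp add: ring_iso_def bij_betw_def)
    show ?thesis unfolding comp_def p1 e p2[symmetric] by (rule inv_into_f_f[OF inj m])
  qed
  then show ?thesis using 3 by blast
qed

end

section \<open>The graded representation ring modulo 2\<close>

theorem proposition3p11:
  fixes r :: nat
  assumes "CHAR('k::field) \<noteq> 2"
  shows "\<exists>e :: nat \<Rightarrow> (nat \<Rightarrow> int, 'k) rep.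
    (\<forall>i\<in>{1..r}. e i \<in> reps (elem_ab_2_group r) \<and> rep_dim (e i) = 1) \<and>
    (\<exists>\<phi> \<in> ring_iso (mpoly_ring r Quot chern_rel_ideal r)
            (tensor_ring (gr_ring (rep_ring (elem_ab_2_group r) :: (nat \<Rightarrow> int, 'k) vrep aug_lambda_ring)) F2).
      \<forall>i\<in>{1..r}. \<phi> (chern_rel_ideal r +>\<^bsub>mpoly_ring r\<^esub> mvar i) =
        pure_tensor (gr_ring (rep_ring (elem_ab_2_group r))) F2
          (chern (rep_ring (elem_ab_2_group r)) 1 (rep_class (elem_ab_2_group r) (e i))) 1)"
proof -
  have "(2::'k) \<noteq> 0"
  proof
    assume "(2::'k) = 0"
    then have "of_nat 2 = (0::'k)" by simp
    then have d: "CHAR('k) dvd 2" by (simp only: of_nat_eq_0_iff_char_dvd)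
    have "CHAR('k) \<noteq> 0" using d by (metis dvd_0_left_iff zero_neq_numeral)
    moreover have "CHAR('k) \<le> 2" by (rule dvd_imp_le[OF d]) simp
    ultimately have "CHAR('k) = 1" using assms by linarith
    then show False using CHAR_not_1[where ?'a = 'k] by simp
  qed
  then interpret elem_ab_2_reps r "TYPE('k)" by unfold_locales
  have "char_sum r [{i}] \<in> RP \<and> rep_dim (char_sum r [{i}] :: (nat \<Rightarrow> int, 'k) rep) = 1" if "i \<in> {1..r}" for i
    using that by (auto intro!: char_sum_in)
  then show ?thesis using graded_iso by (intro exI[of _ "\<lambda>i. char_sum r [{i}]"] conjI ballI) auto
qed

end
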